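(* Consider the problems $(P)$, $(P_{\gamma_k}^N)$ and the data described in the context (under the standing hypotheses stated there). Let $(\bar x,\bar u)$ be an optimal solution of $(P)$. Then for every $\varepsilon>0$ there exist $k_\varepsilon\in\mathbb N$ and $N_\varepsilon\in\mathbb N$ such that for all $k\ge k_\varepsilon$ and all $N\ge N_\varepsilon$ the following holds: if $(\hat x^N_{\gamma_k},\hat u^N_{\gamma_k})$ is an optimal solution of $(P_{\gamma_k}^N)$ and $\tilde x^N_{\gamma_k}$ is the solution of $(D)$ corresponding to the control $\hat u^N_{\gamma_k}$, then $$g(\bar x(T))\le g(\tilde x^N_{\gamma_k}(T))\le g(\bar x(T))+\varepsilon,$$ $$g(\bar x(T))-\frac{\varepsilon}{3}\le g(\hat x^N_{\gamma_k}(T))\le g(\bar x(T))+\frac{2\varepsilon}{3}.$$ Moreover, there exists an optimal solution $(\hat x,\hat u)$ of $(P)$ such that, up to a subsequence, both sequences $\hat x^N_{\gamma_k}$ and $\tilde x^N_{\gamma_k}$ converge uniformly on $[0,T]$ to $\hat x$ as $N\to\infty$ and $k\to\infty$.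
   Context: Data: $T>0$; $g\colon\mathbb R^n\to\mathbb R$; $f\colon\mathbb R^n\times\mathbb R^m\to\mathbb R^n$; $U\subset\mathbb R^m$ nonempty; $\psi_1,\dots,\psi_r\colon\mathbb R^n\to\mathbb R$; $C_i=\{x:\psi_i(x)\le 0\}$, $C=\bigcap_{i=1}^r C_i$; $x_0\in C$. $\mathscr U$ is the set of measurable $u\colon[0,T]\to\mathbb R^m$ with $u(t)\in U$ a.e. $N_C$ and $T_C$ denote the Clarke normal and tangent cones to $C$. $\|\cdot\|$ is the Euclidean norm. Standing hypotheses. (1) $f$ is continuous on $C\times U$; there is $M>0$ such that $x\mapsto f(x,u)$ is $M$-Lipschitz for all $u\in U$ and $\|f(x,u)\|\le M$ for all $(x,u)\in C\times U$. (2) $f(x,U)$ is convex for all $x\in\mathbb R^n$, and $U$ is compact. (3) $C\ne\emptyset$; each $\psi_i$ is $\mathcal C^{1,1}$ (Fréchet differentiable with locally Lipschitz derivative); each $C_i$ is compact, with connected boundary if $n>1$, and convex if $n=1$; and there is $\eta>0$ such that, with $\mathcal I^0_x=\{i:\psi_i(x)=0\}$, one has $\|\sum_{i\in\mathcal I^0_c}\lambda_i\nabla\psi_i(c)\|>2\eta$ for every $c\in\mathbb R^n$ with $\mathcal I^0_c\neq\emptyset$ and all $\lambda_i\ge0$ with $\sum_{i\in\mathcal I^0_c}\lambda_i=1$. (4) $g$ is Lipschitz on $C$ with constant $L_g$. Problem $(P)$: minimize $g(x(T))$ over pairs $(x,u)$ with $u\in\mathscr U$, $x\colon[0,T]\to\mathbb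 R^n$ absolutely continuous, and $(D)$: $\dot x(t)\in f(x(t),u(t))-N_C(x(t))$ a.e. $t\in[0,T]$, $x(0)=x_0$. An optimal solution is an admissible pair minimizing $g(x(T))$ among all admissible pairs. Approximation. $M_\psi>0$ is such that $2M_\psi$ is a common Lipschitz constant of $\nabla\psi_1,\dots,\nabla\psi_r$ on the convex hull of $C$. $(\gamma_k)_k$ is a sequence with $\gamma_k>2M/\eta$ for all $k$ and $\gamma_k\to\infty$. Put $\alpha_k=\frac{1}{\gamma_k}\ln\!\big(\frac{\eta\gamma_k}{2M}\big)$, $\sigma_k=\frac{rM_\psi}{2\eta^2}\big(\frac{\ln r}{\gamma_k}+\alpha_k\big)$. If $x_0\in\operatorname{int}C$, set $x_0^k=x_0$ for all $k$. If $x_0\in\operatorname{bdry}C$, set $x_0^k=x_0+\sigma_k\, d_{x_0}/\|d_{x_0}\|$, where $d_{c}=\sum_{j\in\mathcal I^0_{c}}v_j(c)$ and $v_j(c)$ is the projection of $-\nabla\psi_j(c)$ onto $T_C(c)$ (it is known that $d_c\neq0$ for $c\in\operatorname{bdry}C$). $(D_{\gamma_k})$ is the control system $\dot x(t)=f(x(t),u(t))-\sum_{i=1}^r\gamma_k e^{\gamma_k\psi_i(x(t))}\nabla\psi_i(x(t))$ a.e. $t\in[0,T]$, $x(0)=x_0^k$. For a positive integer $N$ and $h=T/N$, $\mathscr U^N$ is the set of piecewise constant controls $u^N$ with $u^N(t)=u^N_j\in U$ for $t\in[(j-1)h,jh)$, $j=1,\dots,N$. Problem $(P_{\gamma_k}^N)$: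 minimize $g(x(T))$ over pairs $(x,u^N)$ with $u^N\in\mathscr U^N$ and $x$ an absolutely continuous solution of $(D_{\gamma_k})$ corresponding to $u^N$. (For each control, the solution of $(D)$, and of $(D_{\gamma_k})$ for $k$ large, is unique; $(P_{\gamma_k}^N)$ has an optimal solution.) *)

theory Defs
  imports "HOL-Analysis.Analysis"
begin

subsection \<open>Notions from real and nonsmooth analysis\<close>

definition grad :: "('a::real_inner \<Rightarrow> real) \<Rightarrow> 'a \<Rightarrow> 'a" where
  "grad h x = (THE D. GDERIV h x :> D)"

definition C11 :: "('a::real_inner \<Rightarrow> real) \<Rightarrow> bool" where
  "C11 h \<longleftrightarrow> (\<forall>x. h differentiable (at x)) \<and>
     (\<forall>x. \<exists>\<delta>>0. \<exists>L. L-lipschitz_on (ball x \<delta>) (grad h))"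

text \<open>Clarke's generalized directional derivative
  \<open>limsup (h (y + t v) - h y) / t\<close> as \<open>y\<close> tends to \<open>x\<close> and \<open>t\<close> decreases to \<open>0\<close>.\<close>

definition clarke_deriv :: "('a::real_normed_vector \<Rightarrow> real) \<Rightarrow> 'a \<Rightarrow> 'a \<Rightarrow> ereal" where
  "clarke_deriv h x v =
     Limsup (nhds x \<times>\<^sub>F at_right 0) (\<lambda>(y, t). ereal ((h (y + t *\<^sub>R v) - h y) / t))"

text \<open>Only meaningful at points \<open>x \<in> S\<close>.\<close>

definition clarke_tangent_cone :: "'a::real_normed_vector set \<Rightarrow> 'a \<Rightarrow> 'a set" where
  "clarke_tangent_cone S x = {v. clarke_deriv (\<lambda>y. infdist y S) x v = 0}"

text \<open>The normal cone is the polar of the tangent cone. It is empty at points outside \<open>S\<close>,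
  so that a differential inclusion involving it forces the trajectory to stay in \<open>S\<close>.\<close>

definition clarke_normal_cone :: "'a::real_inner set \<Rightarrow> 'a \<Rightarrow> 'a set" where
  "clarke_normal_cone S x =
     (if x \<in> S then {\<zeta>. \<forall>v\<in>clarke_tangent_cone S x. \<zeta> \<bullet> v \<le> 0} else {})"

text \<open>Absolute continuity of a function on \<open>[a, b]\<close>: a pair \<open>(s, t) \<in> P\<close> stands for the
  subinterval \<open>[s, t]\<close>. (The library constant \<open>absolutely_continuous\<close> is about measures.)\<close>

definition abs_cont_on :: "real \<Rightarrow> real \<Rightarrow> (real \<Rightarrow> 'a::real_normed_vector) \<Rightarrow> bool" where
  "abs_cont_on a b x \<longleftrightarrow>
     (\<forall>\<epsilon>>0. \<exists>\<delta>>0. \<forall>P. finite P \<longrightarrow>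
        (\<forall>(s, t)\<in>P. a \<le> s \<and> s \<le> t \<and> t \<le> b) \<longrightarrow>
        pairwise (\<lambda>(s, t) (s', t'). {s<..<t} \<inter> {s'<..<t'} = {}) P \<longrightarrow>
        (\<Sum>(s, t)\<in>P. t - s) < \<delta> \<longrightarrow>
        (\<Sum>(s, t)\<in>P. norm (x t - x s)) < \<epsilon>)"


subsection \<open>The constraint set\<close>

definition sublevel :: "('a \<Rightarrow> real) \<Rightarrow> 'a set" where
  "sublevel h = {x. h x \<le> 0}"

definition constr_set :: "nat \<Rightarrow> (nat \<Rightarrow> 'a \<Rightarrow> real) \<Rightarrow> 'a set" where
  "constr_set r \<psi> = (\<Inter>i\<in>{1..r}. sublevel (\<psi> i))"

definition active :: "nat \<Rightarrow> (nat \<Rightarrow> 'a \<Rightarrow> real) \<Rightarrow> 'a \<Rightarrow> nat set" where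
  "active r \<psi> x = {i\<in>{1..r}. \<psi> i x = 0}"


subsection \<open>The control problem over the sweeping process\<close>

definition controls :: "real \<Rightarrow> 'b::euclidean_space set \<Rightarrow> (real \<Rightarrow> 'b) set" where
  "controls T U = {u \<in> borel_measurable (lebesgue_on {0..T}).
     AE t in lebesgue_on {0..T}. u t \<in> U}"

definition solves_D ::
  "real \<Rightarrow> ('a::euclidean_space \<Rightarrow> 'b \<Rightarrow> 'a) \<Rightarrow> 'a set \<Rightarrow> 'a \<Rightarrow> (real \<Rightarrow> 'b) \<Rightarrow> (real \<Rightarrow> 'a) \<Rightarrow> bool" where
  "solves_D T f C x0 u x \<longleftrightarrow> abs_cont_on 0 T x \<and> x 0 = x0 \<and>
     (AE t in lebesgue_on {0..T}. \<exists>\<zeta>\<in>clarke_normal_cone C (x t).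
        (x has_vector_derivative (f (x t) (u t) - \<zeta>)) (at t within {0..T}))"

definition admissible_P ::
  "real \<Rightarrow> ('a::euclidean_space \<Rightarrow> 'b::euclidean_space \<Rightarrow> 'a) \<Rightarrow> 'b set \<Rightarrow> 'a set \<Rightarrow> 'a \<Rightarrow>
   (real \<Rightarrow> 'a) \<Rightarrow> (real \<Rightarrow> 'b) \<Rightarrow> bool" where
  "admissible_P T f U C x0 x u \<longleftrightarrow> u \<in> controls T U \<and> solves_D T f C x0 u x"

definition optimal_P ::
  "real \<Rightarrow> ('a::euclidean_space \<Rightarrow> real) \<Rightarrow> ('a \<Rightarrow> 'b::euclidean_space \<Rightarrow> 'a) \<Rightarrow> 'b set \<Rightarrow> 'a set \<Rightarrow> 'a \<Rightarrow>
   (real \<Rightarrow> 'a) \<Rightarrow> (real \<Rightarrow> 'b) \<Rightarrow> bool" where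
  "optimal_P T g f U C x0 x u \<longleftrightarrow> admissible_P T f U C x0 x u \<and>
     (\<forall>y v. admissible_P T f U C x0 y v \<longrightarrow> g (x T) \<le> g (y T))"


subsection \<open>The approximating problems\<close>

definition alpha :: "real \<Rightarrow> real \<Rightarrow> real \<Rightarrow> real" where
  "alpha M \<eta> \<gamma> = (1 / \<gamma>) * ln (\<eta> * \<gamma> / (2 * M))"

definition sigma :: "nat \<Rightarrow> real \<Rightarrow> real \<Rightarrow> real \<Rightarrow> real \<Rightarrow> real" where
  "sigma r M\<psi> M \<eta> \<gamma> = (real r * M\<psi> / (2 * \<eta>\<^sup>2)) * (ln (real r) / \<gamma> + alpha M \<eta> \<gamma>)"

definition inward_dir :: "nat \<Rightarrow> (nat \<Rightarrow> 'a::euclidean_space \<Rightarrow> real) \<Rightarrow> 'a \<Rightarrow> 'a" where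
  "inward_dir r \<psi> c = (\<Sum>j\<in>active r \<psi> c.
     closest_point (clarke_tangent_cone (constr_set r \<psi>) c) (- grad (\<psi> j) c))"

text \<open>As \<open>x0\<close> lies in the closed set \<open>constr_set r \<psi>\<close>, the second case is
  \<open>x0 \<in> frontier (constr_set r \<psi>)\<close>.\<close>

definition initial_approx ::
  "nat \<Rightarrow> (nat \<Rightarrow> 'a::euclidean_space \<Rightarrow> real) \<Rightarrow> real \<Rightarrow> real \<Rightarrow> real \<Rightarrow> real \<Rightarrow> 'a \<Rightarrow> 'a" where
  "initial_approx r \<psi> M\<psi> M \<eta> \<gamma> x0 =
     (if x0 \<in> interior (constr_set r \<psi>) then x0
      else x0 + sigma r M\<psi> M \<eta> \<gamma> *\<^sub>R (inward_dir r \<psi> x0 /\<^sub>R norm (inward_dir r \<psi> x0)))"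

text \<open>Solutions of the penalized system with parameter \<open>\<gamma>\<close> and initial point \<open>z\<close>.\<close>

definition solves_Dpen ::
  "real \<Rightarrow> ('a::euclidean_space \<Rightarrow> 'b \<Rightarrow> 'a) \<Rightarrow> nat \<Rightarrow> (nat \<Rightarrow> 'a \<Rightarrow> real) \<Rightarrow> real \<Rightarrow> 'a \<Rightarrow>
   (real \<Rightarrow> 'b) \<Rightarrow> (real \<Rightarrow> 'a) \<Rightarrow> bool" where
  "solves_Dpen T f r \<psi> \<gamma> z u x \<longleftrightarrow> abs_cont_on 0 T x \<and> x 0 = z \<and>
     (AE t in lebesgue_on {0..T}.
        (x has_vector_derivative
           (f (x t) (u t) - (\<Sum>i\<in>{1..r}. (\<gamma> * exp (\<gamma> * \<psi> i (x t))) *\<^sub>R grad (\<psi> i) (x t))))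
          (at t within {0..T}))"

text \<open>The value at the terminal time \<open>T\<close> is left free.\<close>

definition pc_controls :: "real \<Rightarrow> 'b set \<Rightarrow> nat \<Rightarrow> (real \<Rightarrow> 'b) set" where
  "pc_controls T U N = {u. \<exists>c. \<forall>j\<in>{1..N}. c j \<in> U \<and>
     (\<forall>t\<in>{(real j - 1) * (T / real N)..<real j * (T / real N)}. u t = c j)}"

definition admissible_PN ::
  "real \<Rightarrow> ('a::euclidean_space \<Rightarrow> 'b \<Rightarrow> 'a) \<Rightarrow> 'b set \<Rightarrow> nat \<Rightarrow> (nat \<Rightarrow> 'a \<Rightarrow> real) \<Rightarrow> real \<Rightarrow> 'a \<Rightarrow>
   nat \<Rightarrow> (real \<Rightarrow> 'a) \<Rightarrow> (real \<Rightarrow> 'b) \<Rightarrow> bool" where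
  "admissible_PN T f U r \<psi> \<gamma> z N x u \<longleftrightarrow> u \<in> pc_controls T U N \<and> solves_Dpen T f r \<psi> \<gamma> z u x"

definition optimal_PN ::
  "real \<Rightarrow> ('a::euclidean_space \<Rightarrow> real) \<Rightarrow> ('a \<Rightarrow> 'b \<Rightarrow> 'a) \<Rightarrow> 'b set \<Rightarrow> nat \<Rightarrow> (nat \<Rightarrow> 'a \<Rightarrow> real) \<Rightarrow>
   real \<Rightarrow> 'a \<Rightarrow> nat \<Rightarrow> (real \<Rightarrow> 'a) \<Rightarrow> (real \<Rightarrow> 'b) \<Rightarrow> bool" where
  "optimal_PN T g f U r \<psi> \<gamma> z N x u \<longleftrightarrow> admissible_PN T f U r \<psi> \<gamma> z N x u \<and>
     (\<forall>y v. admissible_PN T f U r \<psi> \<gamma> z N y v \<longrightarrow> g (x T) \<le> g (y T))"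

end

theory Submission
  imports Defs "HOL-Complex_Analysis.Great_Picard" "HOL-Real_Asymp.Real_Asymp"
begin

text \<open>
  The penalty \<open>\<phi>(x) = (\<Sum>i. exp (\<gamma> * \<psi>\<^sub>i x))\<close> serves as a barrier: along a solution of the penalized
  system started well inside, the uniform lower bound on convex combinations of active gradients
  keeps \<open>\<phi> < 1\<close>, hence the solution in \<open>C\<close>, and the Lyapunov function \<open>ln \<phi> / \<gamma>\<close> bounds
  \<open>\<integral>\<gamma> * \<phi>\<close> independently of \<open>\<gamma>\<close> and of the control. Since \<open>C\<close> is prox-regular (its Clarke normals are
  nonnegative combinations of active gradients), a Gronwall argument then compares penalized and
  sweeping trajectories uniformly in the control, with an error controlled by the \<open>L\<^sup>1\<close> distance
  of the velocities along one trajectory and by terms vanishing as \<open>\<gamma> \<rightarrow> \<infinity>\<close>. An optimal control of the sweeping problem is approximated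
  in this sense by piecewise constant ones, which gives the value estimates. For the convergence,
  Arzela-Ascoli yields a uniform limit of the (equi-Lipschitz) sweeping trajectories; it satisfies
  the sweeping inequality almost everywhere, and a measurable selection provides a control for it.
\<close>

subsection \<open>Absolutely continuous functions\<close>

text \<open>The penalty force \<open>\<gamma> *\<^sub>R G \<gamma> x\<close> is controlled only in
  L^1. Gronwall's lemma is content with that, because \<gamma> * phi enters it as a coefficient with
  bounded integral. A second penalty error, \<gamma> * s * exp (- \<gamma> * s) with s = - \<psi> i
  x, equals 1/e at s = 1 / \<gamma> and so does not vanish uniformly; it is small only against the
  weight 1 + \<gamma> * exp (- \<gamma> * s), which is again bounded in L^1. Normal cones enter
  through a quadratic inequality with constant \<open>M\<psi> / (2 * \<eta>)\<close> instead of
  multipliers, a form stable under limits. The comparison measures the velocity discrepancy along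
  the sweeping trajectory alone, so it serves twice: with equal controls for the two trajectories of
  a discrete optimal control, and with a piecewise constant approximation for the fixed optimal
  trajectory. No constant depends on the control or on the mesh, hence the thresholds for
  \<open>k\<close> and \<open>N\<close> are independent. For the limit no convergence of derivatives
  is used: difference quotients stay in closed convex neighbourhoods of velocity sets that are
  truncated to be bounded.\<close>

lemma abs_cont_onD:
  assumes "abs_cont_on a b x" "e > 0"
  obtains d where "d > 0" "\<And>P. finite P \<Longrightarrow> (\<forall>(s, t)\<in>P. a \<le> s \<and> s \<le> t \<and> t \<le> b) \<Longrightarrow>
        pairwise (\<lambda>(s, t) (s', t'). {s<..<t} \<inter> {s'<..<t'} = {}) P \<Longrightarrow>
        (\<Sum>(s, t)\<in>P. t - s) < d \<Longrightarrow> (\<Sum>(s, t)\<in>P. norm (x t - x s)) < e"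
proof -
  from assms(1)[unfolded abs_cont_on_def, THEN spec, THEN mp, OF assms(2)]
  obtain d where "d > 0" and d: "\<forall>P. finite P \<longrightarrow> (\<forall>(s, t)\<in>P. a \<le> s \<and> s \<le> t \<and> t \<le> b) \<longrightarrow>
        pairwise (\<lambda>(s, t) (s', t'). {s<..<t} \<inter> {s'<..<t'} = {}) P \<longrightarrow>
        (\<Sum>(s, t)\<in>P. t - s) < d \<longrightarrow> (\<Sum>(s, t)\<in>P. norm (x t - x s)) < e" by (elim exE conjE)
  show thesis by (rule that[OF \<open>d > 0\<close> d[THEN spec, THEN mp, THEN mp, THEN mp, THEN mp]])
qed

lemma abs_cont_on_subset:
  assumes "abs_cont_on a b x" "a \<le> c" "d \<le> b"
  shows "abs_cont_on c d x"
  unfolding abs_cont_on_def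
proof (intro allI impI)
  fix e :: real assume "e > 0"
  obtain d' where "d' > 0" and d': "\<And>P. finite P \<Longrightarrow> (\<forall>(s, t)\<in>P. a \<le> s \<and> s \<le> t \<and> t \<le> b) \<Longrightarrow>
        pairwise (\<lambda>(s, t) (s', t'). {s<..<t} \<inter> {s'<..<t'} = {}) P \<Longrightarrow>
        (\<Sum>(s, t)\<in>P. t - s) < d' \<Longrightarrow> (\<Sum>(s, t)\<in>P. norm (x t - x s)) < e"
    by (rule abs_cont_onD[OF assms(1) \<open>e > 0\<close>]) blast
  have sub: "(\<forall>(s, t)\<in>P. a \<le> s \<and> s \<le> t \<and> t \<le> b)" if "(\<forall>(s, t)\<in>P. c \<le> s \<and> s \<le> t \<and> t \<le> d)" for P
    using that assms by fastforce
  show "\<exists>\<delta>>0. \<forall>P. finite P \<longrightarrow> (\<forall>(s, t)\<in>P. c \<le> s \<and> s \<le> t \<and> t \<le> d) \<longrightarrow>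
        pairwise (\<lambda>(s, t) (s', t'). {s<..<t} \<inter> {s'<..<t'} = {}) P \<longrightarrow>
        (\<Sum>(s, t)\<in>P. t - s) < \<delta> \<longrightarrow> (\<Sum>(s, t)\<in>P. norm (x t - x s)) < e"
  proof (intro exI[of _ d'] conjI allI impI)
    fix P :: "(real \<times> real) set"
    assume "finite P" "\<forall>(s, t)\<in>P. c \<le> s \<and> s \<le> t \<and> t \<le> d"
      "pairwise (\<lambda>(s, t) (s', t'). {s<..<t} \<inter> {s'<..<t'} = {}) P" "(\<Sum>(s, t)\<in>P. t - s) < d'"
    then show "(\<Sum>(s, t)\<in>P. norm (x t - x s)) < e" using sub by (intro d')
  qed (fact \<open>d' > 0\<close>)
qed

lemma abs_cont_on_imp_continuous_on:
  assumes "abs_cont_on a b x"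
  shows "continuous_on {a..b} x"
  unfolding continuous_on_iff
proof (intro ballI allI impI)
  fix t and e :: real assume t: "t \<in> {a..b}" and "e > 0"
  obtain d where "d > 0" and d: "\<And>P. finite P \<Longrightarrow> (\<forall>(s, t)\<in>P. a \<le> s \<and> s \<le> t \<and> t \<le> b) \<Longrightarrow>
        pairwise (\<lambda>(s, t) (s', t'). {s<..<t} \<inter> {s'<..<t'} = {}) P \<Longrightarrow>
        (\<Sum>(s, t)\<in>P. t - s) < d \<Longrightarrow> (\<Sum>(s, t)\<in>P. norm (x t - x s)) < e"
    by (rule abs_cont_onD[OF assms \<open>e > 0\<close>]) blast
  have "dist (x s) (x t) < e" if "s \<in> {a..b}" "dist s t < d" for s
  proof (cases "s \<le> t")
    case True
    have "(\<Sum>(s, t)\<in>{(s, t)}. norm (x t - x s)) < e"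
      using that t True by (intro d) (auto simp: pairwise_def dist_real_def)
    then show ?thesis by (simp add: dist_norm norm_minus_commute)
  next
    case False
    have "(\<Sum>(s, t)\<in>{(t, s)}. norm (x t - x s)) < e"
      using that t False by (intro d) (auto simp: pairwise_def dist_real_def)
    then show ?thesis by (simp add: dist_norm norm_minus_commute)
  qed
  then show "\<exists>d>0. \<forall>s\<in>{a..b}. dist s t < d \<longrightarrow> dist (x s) (x t) < e"
    using \<open>d > 0\<close> by blast
qed

text \<open>Lipschitz images, differences and products all have increments dominated by those of at
  most two given functions, so one epsilon-delta argument serves them all. Replacing
  \<open>K\<close> by \<open>\<bar>K\<bar> + 1\<close> keeps the factor positive whatever the sign
  of \<open>K\<close>.\<close>

lemma abs_cont_on_dominated:
  assumes "abs_cont_on a b x1" "abs_cont_on a b x2"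
    and dom: "\<And>s t. a \<le> s \<Longrightarrow> s \<le> t \<Longrightarrow> t \<le> b \<Longrightarrow>
      norm (y t - y s) \<le> K * norm (x1 t - x1 s) + K * norm (x2 t - x2 s)"
  shows "abs_cont_on a b y"
  unfolding abs_cont_on_def
proof (intro allI impI)
  fix e :: real assume "e > 0"
  define e' where "e' = e / (2 * (\<bar>K\<bar> + 1))"
  have "e' > 0" using \<open>e > 0\<close> by (simp add: e'_def)
  obtain d1 where "d1 > 0" and d1: "\<And>P. finite P \<Longrightarrow> (\<forall>(s, t)\<in>P. a \<le> s \<and> s \<le> t \<and> t \<le> b) \<Longrightarrow>
        pairwise (\<lambda>(s, t) (s', t'). {s<..<t} \<inter> {s'<..<t'} = {}) P \<Longrightarrow>
        (\<Sum>(s, t)\<in>P. t - s) < d1 \<Longrightarrow> (\<Sum>(s, t)\<in>P. norm (x1 t - x1 s)) < e'"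
    by (rule abs_cont_onD[OF assms(1) \<open>e' > 0\<close>]) blast
  obtain d2 where "d2 > 0" and d2: "\<And>P. finite P \<Longrightarrow> (\<forall>(s, t)\<in>P. a \<le> s \<and> s \<le> t \<and> t \<le> b) \<Longrightarrow>
        pairwise (\<lambda>(s, t) (s', t'). {s<..<t} \<inter> {s'<..<t'} = {}) P \<Longrightarrow>
        (\<Sum>(s, t)\<in>P. t - s) < d2 \<Longrightarrow> (\<Sum>(s, t)\<in>P. norm (x2 t - x2 s)) < e'"
    by (rule abs_cont_onD[OF assms(2) \<open>e' > 0\<close>]) blast
  have "(\<Sum>(s, t)\<in>P. norm (y t - y s)) < e"
    if P: "finite P" "(\<forall>(s, t)\<in>P. a \<le> s \<and> s \<le> t \<and> t \<le> b)"
      "pairwise (\<lambda>(s, t) (s', t'). {s<..<t} \<inter> {s'<..<t'} = {}) P" "(\<Sum>(s, t)\<in>P. t - s) < min d1 d2" for P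
  proof -
    have "(\<Sum>(s, t)\<in>P. norm (y t - y s)) \<le>
      (\<Sum>(s, t)\<in>P. (\<bar>K\<bar> + 1) * norm (x1 t - x1 s) + (\<bar>K\<bar> + 1) * norm (x2 t - x2 s))"
    proof (rule sum_mono, clarify)
      fix s t assume "(s, t) \<in> P"
      then have "norm (y t - y s) \<le> K * norm (x1 t - x1 s) + K * norm (x2 t - x2 s)"
        using dom P(2) by blast
      also have "\<dots> \<le> (\<bar>K\<bar> + 1) * norm (x1 t - x1 s) + (\<bar>K\<bar> + 1) * norm (x2 t - x2 s)"
        by (intro add_mono mult_right_mono) auto
      finally show "norm (y t - y s) \<le> (\<bar>K\<bar> + 1) * norm (x1 t - x1 s) + (\<bar>K\<bar> + 1) * norm (x2 t - x2 s)" .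
    qed
    also have "\<dots> = (\<bar>K\<bar> + 1) * (\<Sum>(s, t)\<in>P. norm (x1 t - x1 s)) + (\<bar>K\<bar> + 1) * (\<Sum>(s, t)\<in>P. norm (x2 t - x2 s))"
      by (simp add: sum_distrib_left sum.distrib case_prod_unfold)
    also have "\<dots> < (\<bar>K\<bar> + 1) * e' + (\<bar>K\<bar> + 1) * e'"
      using d1[OF P(1-3)] d2[OF P(1-3)] P(4) by (intro add_strict_mono mult_strict_left_mono) auto
    also have "\<dots> = (2 * (\<bar>K\<bar> + 1)) * e'" by (simp add: algebra_simps)
    also have "\<dots> = e" 
    proof -
      have "2 * (\<bar>K\<bar> + 1) > 0" by (simp add: add_nonneg_pos)
      then have "2 * (\<bar>K\<bar> + 1) \<noteq> 0" by (rule less_imp_neq[symmetric])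
      then show ?thesis unfolding e'_def by (metis nonzero_mult_div_cancel_left times_divide_eq_right)
    qed
    finally show ?thesis .
  qed
  then show "\<exists>\<delta>>0. \<forall>P. finite P \<longrightarrow> (\<forall>(s, t)\<in>P. a \<le> s \<and> s \<le> t \<and> t \<le> b) \<longrightarrow>
        pairwise (\<lambda>(s, t) (s', t'). {s<..<t} \<inter> {s'<..<t'} = {}) P \<longrightarrow>
        (\<Sum>(s, t)\<in>P. t - s) < \<delta> \<longrightarrow> (\<Sum>(s, t)\<in>P. norm (y t - y s)) < e"
    using \<open>d1 > 0\<close> \<open>d2 > 0\<close> by (intro exI[of _ "min d1 d2"]) auto
qed

lemma abs_cont_on_compose_lipschitz:
  assumes "abs_cont_on a b x" "L-lipschitz_on (x ` {a..b}) h"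
  shows "abs_cont_on a b (\<lambda>t. h (x t))"
proof (rule abs_cont_on_dominated[OF assms(1,1), of _ "L"])
  fix s t assume "a \<le> s" "s \<le> t" "t \<le> b"
  then have "norm (h (x t) - h (x s)) \<le> L * norm (x t - x s)"
    using lipschitz_on_normD[OF assms(2)] by auto
  moreover have "0 \<le> L * norm (x t - x s)"
    using lipschitz_on_nonneg[OF assms(2)] by auto
  ultimately show "norm (h (x t) - h (x s)) \<le> L * norm (x t - x s) + L * norm (x t - x s)" by linarith
qed

lemma abs_cont_on_id: "abs_cont_on a b (\<lambda>t::real. t)"
  unfolding abs_cont_on_def
proof (intro allI impI)
  fix e :: real assume "e > 0"
  have "(\<Sum>(s, t)\<in>P. norm (t - s)) < e"
    if "\<forall>(s, t)\<in>P. a \<le> s \<and> s \<le> t \<and> t \<le> b" "(\<Sum>(s, t)\<in>P. t - s) < e" for P :: "(real \<times> real) set"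
  proof -
    have "(\<Sum>(s, t)\<in>P. norm (t - s)) = (\<Sum>(s, t)\<in>P. t - s)"
      using that(1) by (intro sum.cong) auto
    then show ?thesis using that by simp
  qed
  then show "\<exists>\<delta>>0. \<forall>P. finite P \<longrightarrow> (\<forall>(s, t)\<in>P. a \<le> s \<and> s \<le> t \<and> t \<le> b) \<longrightarrow>
        pairwise (\<lambda>(s, t) (s', t'). {s<..<t} \<inter> {s'<..<t'} = {}) P \<longrightarrow>
        (\<Sum>(s, t)\<in>P. t - s) < \<delta> \<longrightarrow> (\<Sum>(s, t)\<in>P. norm (t - s)) < e"
    using \<open>e > 0\<close> by (intro exI[of _ e] conjI allI impI)
qed

lemma lipschitz_on_imp_abs_cont_on:
  assumes "L-lipschitz_on {a..b} x"
  shows "abs_cont_on a b x"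
  using abs_cont_on_compose_lipschitz[OF abs_cont_on_id, of L a b x] assms by simp

lemma abs_cont_on_diff:
  assumes "abs_cont_on a b x" "abs_cont_on a b y"
  shows "abs_cont_on a b (\<lambda>t. x t - y t)"
proof (rule abs_cont_on_dominated[OF assms, of _ 1])
  fix s t
  have "x t - y t - (x s - y s) = (x t - x s) - (y t - y s)" by simp
  then show "norm (x t - y t - (x s - y s)) \<le> 1 * norm (x t - x s) + 1 * norm (y t - y s)"
    using norm_triangle_ineq4[of "x t - x s" "y t - y s"] by (metis mult_1)
qed

lemma abs_cont_on_mult:
  fixes x y :: "real \<Rightarrow> real"
  assumes "abs_cont_on a b x" "abs_cont_on a b y"
  shows "abs_cont_on a b (\<lambda>t. x t * y t)"
proof -
  have "bounded (x ` {a..b})" "bounded (y ` {a..b})"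
    using assms by (auto intro!: compact_imp_bounded compact_continuous_image abs_cont_on_imp_continuous_on)
  then obtain A B where AB: "\<forall>z\<in>x ` {a..b}. norm z \<le> A" "\<forall>z\<in>y ` {a..b}. norm z \<le> B"
    unfolding bounded_iff by (elim exE)
  have A: "\<bar>x t\<bar> \<le> A" and B: "\<bar>y t\<bar> \<le> B" if "t \<in> {a..b}" for t
    using AB that by auto
  show ?thesis
  proof (rule abs_cont_on_dominated[OF assms, of _ "max A B"])
    fix s t assume st: "a \<le> s" "s \<le> t" "t \<le> b"
    have "\<bar>x t * y t - x s * y s\<bar> = \<bar>y t * (x t - x s) + x s * (y t - y s)\<bar>" by (simp add: algebra_simps)
    also have "\<dots> \<le> \<bar>y t\<bar> * \<bar>x t - x s\<bar> + \<bar>x s\<bar> * \<bar>y t - y s\<bar>"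
      by (metis abs_mult abs_triangle_ineq)
    also have "\<dots> \<le> max A B * \<bar>x t - x s\<bar> + max A B * \<bar>y t - y s\<bar>"
      using A[of s] B[of t] st by (intro add_mono mult_right_mono) auto
    finally show "norm (x t * y t - x s * y s) \<le> max A B * norm (x t - x s) + max A B * norm (y t - y s)" by simp
  qed
qed

text \<open>A continuous gradient is bounded on a closed ball containing the compact trajectory, and
  a ball is convex, so the mean value inequality makes \<open>h\<close> Lipschitz where it
  matters.\<close>

lemma abs_cont_on_compose_C1:
  fixes x :: "real \<Rightarrow> 'a::euclidean_space" and h :: "'a \<Rightarrow> real"
  assumes "abs_cont_on a b x" and der: "\<And>z. GDERIV h z :> D z" and cont: "continuous_on UNIV D"
  shows "abs_cont_on a b (\<lambda>t. h (x t))"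
proof -
  have "bounded (x ` {a..b})"
    using assms(1) by (intro compact_imp_bounded compact_continuous_image abs_cont_on_imp_continuous_on) auto
  then obtain R where R: "x ` {a..b} \<subseteq> cball 0 R" using bounded_subset_ballD[of "x ` {a..b}" 0] ball_subset_cball by (metis subset_trans)
  have "bounded (D ` cball 0 R)"
    using cont continuous_on_subset by (intro compact_imp_bounded compact_continuous_image) auto
  then obtain L where L: "\<And>z. z \<in> cball 0 R \<Longrightarrow> norm (D z) \<le> L" unfolding bounded_iff by blast
  have "(max L 0)-lipschitz_on (cball 0 R) h"
  proof (rule bounded_derivative_imp_lipschitz[where f' = "\<lambda>z v. v \<bullet> D z"])
    show "(h has_derivative (\<lambda>v. v \<bullet> D z)) (at z within cball 0 R)" for z
      using der[of z] unfolding gderiv_def by (rule has_derivative_at_withinI)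
    show "onorm (\<lambda>v. v \<bullet> D z) \<le> max L 0" if "z \<in> cball 0 R" for z
    proof (rule onorm_le)
      fix v
      have "norm (v \<bullet> D z) \<le> norm v * norm (D z)" using Cauchy_Schwarz_ineq2 by auto
      also have "\<dots> \<le> norm v * max L 0" using L[OF that] by (intro mult_left_mono) auto
      finally show "norm (v \<bullet> D z) \<le> max L 0 * norm v" by (simp add: mult.commute)
    qed
  qed auto
  then show ?thesis
    using abs_cont_on_compose_lipschitz[OF assms(1)] R lipschitz_on_subset by blast
qed

text \<open>The Henstock gauge treats two kinds of tags separately. At a tag outside
  \<open>E\<close> it comes from differentiability. At a tag in \<open>E\<close> it confines the
  interval to an open set \<open>V\<close> of measure below \<open>d\<close>, so that absolute
  continuity makes the total increment over those intervals small.\<close>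

lemma abs_cont_on_has_integral:
  fixes x :: "real \<Rightarrow> 'a::euclidean_space"
  assumes ac: "abs_cont_on a b x" and "a \<le> b" and E: "negligible E"
    and der: "\<And>t. t \<in> {a..b} - E \<Longrightarrow> (x has_vector_derivative D t) (at t within {a..b})"
  shows "(D has_integral x b - x a) {a..b}"
proof (rule has_integral_spike[OF E])
  \<comment> \<open>With the value 0 on \<open>E\<close>, tags in \<open>E\<close> contribute only
    increments of \<open>x\<close> to the Riemann error.\<close>
  define D' where "D' = (\<lambda>t. if t \<in> E then 0 else D t)"
  show "D t = D' t" if "t \<in> {a..b} - E" for t using that by (simp add: D'_def)
  show "(D' has_integral x b - x a) {a..b}"
    unfolding has_integral_real
  proof (intro allI impI)
    fix e :: real assume "e > 0"
    obtain d where "d > 0" and d: "\<And>P. finite P \<Longrightarrow> (\<forall>(s, t)\<in>P. a \<le> s \<and> s \<le> t \<and> t \<le> b) \<Longrightarrow>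
        pairwise (\<lambda>(s, t) (s', t'). {s<..<t} \<inter> {s'<..<t'} = {}) P \<Longrightarrow>
        (\<Sum>(s, t)\<in>P. t - s) < d \<Longrightarrow> (\<Sum>(s, t)\<in>P. norm (x t - x s)) < e / 2"
      by (rule abs_cont_onD[OF ac half_gt_zero[OF \<open>e > 0\<close>]]) blast
    have "E \<in> sets lebesgue" using E negligible_imp_sets by blast
    then obtain V where V: "open V" "E \<subseteq> V" "(V - E) \<in> lmeasurable" "emeasure lebesgue (V - E) < ennreal d"
      using sets_lebesgue_outer_open \<open>d > 0\<close> by blast
    have "measure lebesgue V < d" and Vm: "V \<in> lmeasurable"
    proof -
      have "V = (V - E) \<union> E" using V by blast
      then show "V \<in> lmeasurable" using V(3) E negligible_imp_measurable by (metis fmeasurable.Un)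
      have "measure lebesgue V = measure lebesgue (V - E)"
        using E by (metis measure_Diff_null_set negligible_iff_null_sets \<open>V \<in> lmeasurable\<close> fmeasurableD)
      also have "\<dots> < d" using V(3,4) \<open>d > 0\<close> by (simp add: emeasure_eq_measure2 ennreal_less_iff)
      finally show "measure lebesgue V < d" .
    qed
    \<comment> \<open>The error allowed per unit length; over the whole interval it adds up to less
      than half of \<open>e\<close>.\<close>
    define e' where "e' = e / (2 * (b - a + 1))"
    have "e' > 0" using \<open>e > 0\<close> \<open>a \<le> b\<close> by (simp add: e'_def)
    have "\<exists>r>0. \<forall>s\<in>{a..b}. \<bar>s - t\<bar> < r \<longrightarrow> norm (x s - x t - (s - t) *\<^sub>R D t) \<le> e' * \<bar>s - t\<bar>"
      if "t \<in> {a..b} - E" for t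
      using der[OF that] \<open>e' > 0\<close> unfolding has_vector_derivative_def has_derivative_within_alt by auto
    then obtain r1 where r1: "\<And>t. t \<in> {a..b} - E \<Longrightarrow> r1 t > 0"
      "\<And>t s. t \<in> {a..b} - E \<Longrightarrow> s \<in> {a..b} \<Longrightarrow> \<bar>s - t\<bar> < r1 t \<Longrightarrow> norm (x s - x t - (s - t) *\<^sub>R D t) \<le> e' * \<bar>s - t\<bar>"
      by metis
    have "\<exists>r>0. ball t r \<subseteq> V" if "t \<in> E" for t
      using that V open_contains_ball by blast
    then obtain r2 where r2: "\<And>t. t \<in> E \<Longrightarrow> r2 t > 0" "\<And>t. t \<in> E \<Longrightarrow> ball t (r2 t) \<subseteq> V" by metis
    define \<gamma> where "\<gamma> = (\<lambda>t. if t \<in> E then ball t (r2 t) else if t \<in> {a..b} then ball t (r1 t) else ball t 1)"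
    have "gauge \<gamma>" unfolding gauge_def \<gamma>_def using r1 r2 by auto
    moreover have "norm (sum (\<lambda>(t,k). measure lborel k *\<^sub>R D' t) \<D> - (x b - x a)) < e"
      if p: "\<D> tagged_division_of {a..b}" and fine: "\<gamma> fine \<D>" for \<D>
    proof -
      have fin: "finite \<D>" using p by auto
      have K: "\<exists>c d. k = {c..d} \<and> a \<le> c \<and> c \<le> t \<and> t \<le> d \<and> d \<le> b \<and> k \<subseteq> \<gamma> t" if tk: "(t, k) \<in> \<D>" for t k
      proof -
        obtain c d where "k = cbox c d" using tagged_division_ofD(4)[OF p tk] by blast
        moreover have "t \<in> k" "k \<subseteq> {a..b}" using tagged_division_ofD(2,3)[OF p tk] by auto
        moreover have "k \<subseteq> \<gamma> t" using fine tk by (auto simp: fine_def)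
        ultimately show ?thesis by (intro exI[of _ c] exI[of _ d]) auto
      qed
      \<comment> \<open>Degenerate intervals are discarded: disjoint nonempty interiors are what
        makes the passage from tagged pieces to pairs of endpoints injective.\<close>
      define N where "N = {(t, k) \<in> \<D>. t \<in> E \<and> interior k \<noteq> {}}"
      have "N \<subseteq> \<D>" by (auto simp: N_def)
      have finN: "finite N" using fin \<open>N \<subseteq> \<D>\<close> finite_subset by blast
      define F where "F = (\<lambda>(t::real,k::real set). measure lborel k *\<^sub>R D' t - (x (Sup k) - x (Inf k)))"
      have "sum (\<lambda>(t,k). measure lborel k *\<^sub>R D' t) \<D> - (x b - x a) = sum F \<D>"
        using additive_tagged_division_1[OF \<open>a \<le> b\<close> p, of x] by (simp add: F_def sum_subtractf case_prod_unfold)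
      also have "\<dots> = sum F N + sum F (\<D> - N)"
        using sum.subset_diff[OF \<open>N \<subseteq> \<D>\<close> fin, of F] by simp
      finally have eq: "sum (\<lambda>(t,k). measure lborel k *\<^sub>R D' t) \<D> - (x b - x a) = sum F N + sum F (\<D> - N)" .
      have "norm (sum F (\<D> - N)) \<le> (\<Sum>(t,k)\<in>\<D> - N. e' * measure lborel k)"
      proof (rule sum_norm_le, clarify)
        fix t k assume tk: "(t, k) \<in> \<D>" "(t, k) \<notin> N"
        then obtain c d where k: "k = {c..d}" "a \<le> c" "c \<le> t" "t \<le> d" "d \<le> b" "k \<subseteq> \<gamma> t" using K by blast
        have [simp]: "Sup k = d" "Inf k = c" "measure lborel k = d - c" using k by auto
        show "norm (F (t, k)) \<le> e' * measure lborel k"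
        proof (cases "t \<in> E")
          case True
          then have "c = d" using tk k by (auto simp: N_def)
          then show ?thesis by (simp add: F_def k)
        next
          case False
          then have t: "t \<in> {a..b} - E" using k by auto
          have "c \<in> k" "d \<in> k" using k by auto
          then have "c \<in> ball t (r1 t)" "d \<in> ball t (r1 t)" using k(6) t by (auto simp: \<gamma>_def)
          then have AB: "norm (x d - x t - (d - t) *\<^sub>R D t) \<le> e' * \<bar>d - t\<bar>" "norm (x c - x t - (c - t) *\<^sub>R D t) \<le> e' * \<bar>c - t\<bar>"
            using r1(2)[OF t, of d] r1(2)[OF t, of c] k by (auto simp: dist_norm abs_minus_commute)
          have "norm ((x c - x t - (c - t) *\<^sub>R D t) - (x d - x t - (d - t) *\<^sub>R D t))
              \<le> e' * \<bar>c - t\<bar> + e' * \<bar>d - t\<bar>"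
            by (intro order_trans[OF norm_triangle_ineq4 add_mono[OF AB(2) AB(1)]])
          moreover have "F (t, k) = (x c - x t - (c - t) *\<^sub>R D t) - (x d - x t - (d - t) *\<^sub>R D t)"
            using False by (simp add: F_def D'_def algebra_simps)
          ultimately have "norm (F (t, k)) \<le> e' * \<bar>c - t\<bar> + e' * \<bar>d - t\<bar>" by (simp only:)
          also have "\<dots> = e' * measure lborel k" using k by (simp add: algebra_simps)
          finally show ?thesis .
        qed
      qed
      also have "\<dots> \<le> (\<Sum>(t,k)\<in>\<D>. e' * measure lborel k)"
        using fin \<open>e' > 0\<close> by (intro sum_mono2) auto
      also have "\<dots> = e' * (b - a)"
        using additive_content_tagged_division[of \<D> a b] p \<open>a \<le> b\<close> by (simp add: sum_distrib_left[symmetric] case_prod_unfold)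
      also have "\<dots> < e / 2" using \<open>e > 0\<close> \<open>a \<le> b\<close> by (simp add: e'_def field_simps)
      finally have 1: "norm (sum F (\<D> - N)) < e / 2" .
      define P where "P = (\<lambda>(t::real,k::real set). (Inf k, Sup k)) ` N"
      have dis: "interior k \<inter> interior k' = {}" if "(t,k) \<in> \<D>" "(t',k') \<in> \<D>" "(t,k) \<noteq> (t',k')" for t k t' k'
        using tagged_division_ofD(5)[OF p] that by blast
      have Int: "interior k = {Inf k<..<Sup k}" if "(t,k) \<in> \<D>" for t k
        using K[OF that] by auto
      have inj: "inj_on (\<lambda>(t::real,k::real set). (Inf k, Sup k)) N"
      proof (rule inj_onI, clarify)
        fix t k t' k' assume N: "(t, k) \<in> N" "(t', k') \<in> N" and "Inf k = Inf k'" "Sup k = Sup k'"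
        moreover have "(t, k) \<in> \<D>" "(t', k') \<in> \<D>" using N \<open>N \<subseteq> \<D>\<close> by blast+
        ultimately have "interior k = interior k'" using Int[of t k] Int[of t' k'] by simp
        then show "t = t' \<and> k = k'" using dis[of t k t' k'] N by (auto simp: N_def)
      qed
      have "norm (sum F N) \<le> (\<Sum>(t,k)\<in>N. norm (x (Sup k) - x (Inf k)))"
        by (rule sum_norm_le) (auto simp: F_def N_def D'_def norm_minus_commute)
      also have "\<dots> = (\<Sum>(s,t)\<in>P. norm (x t - x s))"
        unfolding P_def by (subst sum.reindex[OF inj]) (simp add: case_prod_unfold)
      also have "\<dots> < e / 2"
      proof (rule d)
        show "finite P" using finN by (simp add: P_def)
        show "\<forall>(s, t)\<in>P. a \<le> s \<and> s \<le> t \<and> t \<le> b"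
          using K by (fastforce simp: P_def N_def)
        show "pairwise (\<lambda>(s, t) (s', t'). {s<..<t} \<inter> {s'<..<t'} = {}) P"
          unfolding P_def
        proof (rule pairwise_imageI)
          fix z z' assume N: "z \<in> N" "z' \<in> N" "z \<noteq> z'"
          obtain t k t' k' where z: "z = (t, k)" "z' = (t', k')" by (cases z; cases z')
          have D: "(t, k) \<in> \<D>" "(t', k') \<in> \<D>" using N z \<open>N \<subseteq> \<D>\<close> by auto
          have "interior k \<inter> interior k' = {}" using dis[OF D] N z by blast
          then show "(case case z of (t, k) \<Rightarrow> (Inf k, Sup k) of (s, t) \<Rightarrow>
              \<lambda>(s', t'). {s<..<t} \<inter> {s'<..<t'} = {}) (case z' of (t, k) \<Rightarrow> (Inf k, Sup k))"
            using Int[OF D(1)] Int[OF D(2)] by (simp add: z)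
        qed
        have "(\<Sum>(s, t)\<in>P. t - s) = (\<Sum>(t,k)\<in>N. Sup k - Inf k)"
          unfolding P_def by (subst sum.reindex[OF inj]) (simp add: case_prod_unfold)
        also have "\<dots> = (\<Sum>z\<in>N. measure lebesgue (interior (snd z)))"
        proof (rule sum.cong[OF refl], clarify)
          fix t k assume "(t, k) \<in> N"
          then have tk: "(t, k) \<in> \<D>" using \<open>N \<subseteq> \<D>\<close> by blast
          have "interior k = {Inf k<..<Sup k}" using Int[OF tk] .
          moreover have "Inf k \<le> Sup k" using K[OF tk] by auto
          ultimately show "Sup k - Inf k = measure lebesgue (interior (snd (t, k)))" by simp
        qed
        also have "\<dots> = measure lebesgue (\<Union>z\<in>N. interior (snd z))"
        proof (rule measure_finite_Union[symmetric])
          show "finite N" by fact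
          have op: "bounded (interior (snd z))" if "z \<in> N" for z
          proof -
            have "interior (snd z) \<subseteq> {a..b}" using K[of "fst z" "snd z"] that \<open>N \<subseteq> \<D>\<close> interior_subset by fastforce
            then show ?thesis using bounded_subset bounded_closed_interval by blast
          qed
          show "(\<lambda>z. interior (snd z)) ` N \<subseteq> sets lebesgue"
            by (rule image_subsetI) (simp add: borel_open)
          show "disjoint_family_on (\<lambda>z. interior (snd z)) N"
            unfolding disjoint_family_on_def
          proof (intro ballI impI)
            fix z z' assume z: "z \<in> N" "z' \<in> N" "z \<noteq> z'"
            then show "interior (snd z) \<inter> interior (snd z') = {}"
              using dis[of "fst z" "snd z" "fst z'" "snd z'"] \<open>N \<subseteq> \<D>\<close> by auto
          qed
          show "emeasure lebesgue (interior (snd z)) \<noteq> \<infinity>" if "z \<in> N" for z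
            using emeasure_bounded_finite[OF op[OF that]] by auto
        qed
        also have "\<dots> \<le> measure lebesgue V"
        proof (rule measure_mono_fmeasurable[OF _ _ Vm])
          show "(\<Union>z\<in>N. interior (snd z)) \<subseteq> V"
          proof clarify
            fix y t k assume "(t, k) \<in> N" "y \<in> interior (snd (t, k))"
            then have "y \<in> \<gamma> t" "t \<in> E" using K[of t k] interior_subset by (auto simp: N_def)
            then show "y \<in> V" using r2(2)[of t] by (auto simp: \<gamma>_def)
          qed
        qed (simp add: borel_open open_UN)
        finally show "(\<Sum>(s, t)\<in>P. t - s) < d" using \<open>measure lebesgue V < d\<close> by linarith
      qed
      finally have 2: "norm (sum F N) < e / 2" .
      show ?thesis unfolding eq using 1 2 norm_triangle_ineq[of "sum F N" "sum F (\<D> - N)"] by linarith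
    qed
    ultimately show "\<exists>\<gamma>. gauge \<gamma> \<and> (\<forall>\<D>. \<D> tagged_division_of {a..b} \<and> \<gamma> fine \<D> \<longrightarrow>
        norm (sum (\<lambda>(t,k). measure lborel k *\<^sub>R D' t) \<D> - (x b - x a)) < e)"
      by (intro exI[of _ \<gamma>] conjI allI impI) simp_all
  qed
qed

section \<open>Null sets and integrated differential inequalities\<close>

lemma negligible_AE_iff:
  "(AE t in lebesgue_on {a..b::real}. P t) \<longleftrightarrow> negligible {t \<in> {a..b}. \<not> P t}"
proof -
  have "(AE t in lebesgue_on {a..b}. P t) \<longleftrightarrow> (AE t in lebesgue. t \<in> {a..b} \<longrightarrow> P t)"
    by (rule AE_restrict_space_iff) simp
  also have "\<dots> \<longleftrightarrow> (\<exists>N. negligible N \<and> {t. \<not> (t \<in> {a..b} \<longrightarrow> P t)} \<subseteq> N)"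
    by (simp add: eventually_ae_filter_negligible)
  also have "\<dots> \<longleftrightarrow> negligible {t \<in> {a..b}. \<not> P t}"
    using negligible_subset by (metis (no_types, lifting) Collect_cong order_refl)
  finally show ?thesis .
qed

lemma AE_lebesgue_onE:
  assumes "AE t in lebesgue_on {a..b::real}. P t"
  obtains N where "negligible N" "\<And>t. t \<in> {a..b} - N \<Longrightarrow> P t"
  using assms that[of "{t \<in> {a..b}. \<not> P t}"] unfolding negligible_AE_iff by blast

lemma AE_lebesgue_on_Icc_I:
  assumes "negligible N" "\<And>t. t \<in> {a..b} - N \<Longrightarrow> P t"
  shows "AE t in lebesgue_on {a..b::real}. P t"
  unfolding negligible_AE_iff by (rule negligible_subset[OF assms(1)]) (use assms(2) in blast)

text \<open>Measurability of the derivative is not assumed: the fundamental theorem provides its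
  integrability, and only an upper bound on it is compared with \<open>\<beta>\<close>.\<close>

lemma abs_cont_on_le_integral:
  fixes p :: "real \<Rightarrow> real"
  assumes ac: "abs_cont_on a b p" and "a \<le> b" and N: "negligible N"
    and der: "\<And>t. t \<in> {a..b} - N \<Longrightarrow> \<exists>D. (p has_real_derivative D) (at t within {a..b}) \<and> D \<le> \<beta> t"
    and int: "\<beta> integrable_on {a..b}"
  shows "p b - p a \<le> integral {a..b} \<beta>"
proof -
  have "\<forall>t. \<exists>D. t \<in> {a..b} - N \<longrightarrow> (p has_real_derivative D) (at t within {a..b}) \<and> D \<le> \<beta> t"
    using der by blast
  then obtain D0 where D0: "\<And>t. t \<in> {a..b} - N \<Longrightarrow> (p has_real_derivative D0 t) (at t within {a..b}) \<and> D0 t \<le> \<beta> t"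
    by metis
  define D where "D = (\<lambda>t. if t \<in> {a..b} - N then D0 t else \<beta> t)"
  have "(D has_integral p b - p a) {a..b}"
  proof (rule abs_cont_on_has_integral[OF ac \<open>a \<le> b\<close> N])
    fix t assume "t \<in> {a..b} - N"
    then show "(p has_vector_derivative D t) (at t within {a..b})"
      using D0[of t] by (simp add: D_def has_real_derivative_iff_has_vector_derivative)
  qed
  then show ?thesis
    by (rule has_integral_le[OF _ integrable_integral[OF int]]) (use D0 in \<open>auto simp: D_def\<close>)
qed

text \<open>The integrating factor \<open>E\<close> is Lipschitz because a continuous
  \<open>a\<close> is bounded, so its product with \<open>q\<close> is again absolutely continuous.
  \<open>b\<close> is merely integrable since it will contain the L^1 velocity discrepancy of two
  controls.\<close>

lemma gronwall:
  fixes q a b :: "real \<Rightarrow> real"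
  assumes ac: "abs_cont_on 0 T q" and N: "negligible N"
    and q0: "\<And>t. t \<in> {0..T} \<Longrightarrow> q t \<ge> 0"
    and der: "\<And>t. t \<in> {0..T} - N \<Longrightarrow> \<exists>D. (q has_real_derivative D) (at t within {0..T}) \<and> D \<le> a t * q t + b t"
    and a: "continuous_on {0..T} a" "\<And>t. t \<in> {0..T} \<Longrightarrow> a t \<ge> 0"
    and b: "b integrable_on {0..T}" "\<And>t. t \<in> {0..T} \<Longrightarrow> b t \<ge> 0"
    and s: "s \<in> {0..T}"
  shows "q s \<le> exp (integral {0..T} a) * (q 0 + integral {0..T} b)"
proof -
  define A where "A = (\<lambda>t. integral {0..t} a)"
  have aint: "a integrable_on {0..T}" using a(1) by (rule integrable_continuous_interval)
  have A': "(A has_real_derivative a t) (at t within {0..T})" if "t \<in> {0..T}" for t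
    using integral_has_vector_derivative[OF a(1) that] unfolding A_def
    by (simp add: has_real_derivative_iff_has_vector_derivative)
  have A0: "A t \<ge> 0" if "t \<in> {0..T}" for t
    unfolding A_def using that a
    by (intro integral_nonneg integrable_on_subinterval[OF aint]) auto
  have AT: "A t \<le> A T" if "t \<in> {0..T}" for t
    unfolding A_def using that a
    by (intro integral_subset_le integrable_on_subinterval[OF aint]) auto
  define E where "E = (\<lambda>t. exp (- A t))"
  have E': "(E has_real_derivative (- a t * E t)) (at t within {0..T})" if "t \<in> {0..T}" for t
    unfolding E_def by (auto intro!: derivative_eq_intros A'[OF that])
  have E1: "0 < E t" "E t \<le> 1" if "t \<in> {0..T}" for t using A0[OF that] by (auto simp: E_def)
  have "bounded (a ` {0..T})" using a(1) by (intro compact_imp_bounded compact_continuous_image) auto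
  then obtain K where "\<forall>z\<in>a ` {0..T}. norm z \<le> K" unfolding bounded_iff by (elim exE)
  then have K: "\<bar>a t\<bar> \<le> K" if "t \<in> {0..T}" for t using that by auto
  have "(max K 0)-lipschitz_on {0..T} E"
  proof (rule bounded_derivative_imp_lipschitz[where f' = "\<lambda>t h. h * (- a t * E t)"])
    show "(E has_derivative (\<lambda>h. h * (- a t * E t))) (at t within {0..T})" if "t \<in> {0..T}" for t
    proof -
      have "(\<lambda>h. h * (- a t * E t)) = times (- a t * E t)" by (auto simp: fun_eq_iff)
      then show ?thesis using E'[OF that] unfolding has_field_derivative_def by simp
    qed
    show "onorm (\<lambda>h. h * (- a t * E t)) \<le> max K 0" if "t \<in> {0..T}" for t
    proof (rule onorm_le)
      fix h :: real
      have "\<bar>a t * E t\<bar> \<le> max K 0 * 1"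
        unfolding abs_mult using K[OF that] E1[OF that] by (intro mult_mono) auto
      then have "\<bar>h\<bar> * \<bar>a t * E t\<bar> \<le> \<bar>h\<bar> * max K 0" by (intro mult_left_mono) auto
      then show "norm (h * (- a t * E t)) \<le> max K 0 * norm h" by (simp add: abs_mult mult.commute)
    qed
  qed auto
  then have acE: "abs_cont_on 0 T E" by (rule lipschitz_on_imp_abs_cont_on)
  define p where "p = (\<lambda>t. q t * E t)"
  have "abs_cont_on 0 T p" unfolding p_def by (rule abs_cont_on_mult[OF ac acE])
  then have acp: "abs_cont_on 0 s p" by (rule abs_cont_on_subset) (use s in auto)
  have bints: "b integrable_on {0..s}" using b(1) by (rule integrable_on_subinterval) (use s in auto)
  have "p s - p 0 \<le> integral {0..s} b"
  proof (rule abs_cont_on_le_integral[OF acp _ N _ bints])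
    fix t assume t: "t \<in> {0..s} - N"
    then have t': "t \<in> {0..T} - N" "t \<in> {0..T}" using s by auto
    obtain D where D: "(q has_real_derivative D) (at t within {0..T})" "D \<le> a t * q t + b t"
      using der[OF t'(1)] by blast
    have "(p has_real_derivative (D * E t + q t * (- a t * E t))) (at t within {0..T})"
      unfolding p_def by (auto intro!: derivative_eq_intros D(1) E'[OF t'(2)])
    then have "(p has_real_derivative (D * E t + q t * (- a t * E t))) (at t within {0..s})"
      by (rule DERIV_subset) (use s in auto)
    moreover have "D * E t + q t * (- a t * E t) \<le> b t"
    proof -
      have "D * E t + q t * (- a t * E t) = (D - a t * q t) * E t" by (simp add: algebra_simps)
      also have "\<dots> \<le> b t * E t" using D(2) E1[OF t'(2)] by (intro mult_right_mono) auto
      also have "\<dots> \<le> b t * 1" using b(2)[OF t'(2)] E1[OF t'(2)] by (intro mult_left_mono) auto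
      finally show ?thesis by simp
    qed
    ultimately show "\<exists>D. (p has_real_derivative D) (at t within {0..s}) \<and> D \<le> b t" by blast
  qed (use s in auto)
  also have "\<dots> \<le> integral {0..T} b"
    using s b by (intro integral_subset_le bints) auto
  finally have ps: "p s \<le> p 0 + integral {0..T} b" by simp
  have "p 0 = q 0" by (simp add: p_def E_def A_def)
  have "integral {0..T} b \<ge> 0" using b by (intro integral_nonneg) auto
  have "q s = exp (A s) * p s" by (simp add: p_def E_def exp_minus)
  also have "\<dots> \<le> exp (A s) * (q 0 + integral {0..T} b)"
    using ps \<open>p 0 = q 0\<close> by (intro mult_left_mono) auto
  also have "\<dots> \<le> exp (A T) * (q 0 + integral {0..T} b)"
    using AT[OF s] q0[of 0] s \<open>integral {0..T} b \<ge> 0\<close> by (intro mult_right_mono) auto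
  finally show ?thesis by (simp add: A_def)
qed

text \<open>A null set has dense complement in \<open>{0..T}\<close>, so a closed condition that
  holds almost everywhere holds at every time, endpoints included.\<close>

lemma negligible_dense:
  assumes N: "negligible N" and "T > 0" and W: "closed W" "{0..T} - N \<subseteq> W"
  shows "{0..T::real} \<subseteq> W"
proof (rule ccontr)
  assume "\<not> {0..T} \<subseteq> W"
  then obtain t where t: "t \<in> {0..T}" "t \<in> - W" by blast
  have "open (- W)" using W(1) by (simp add: open_Compl)
  then obtain e where e: "e > 0" "ball t e \<subseteq> - W" using t(2) open_contains_ball by blast
  have "open (ball t e \<inter> {0<..<T})" by (intro open_Int) auto
  moreover have "ball t e \<inter> {0<..<T} \<noteq> {}"
  \<comment> \<open>A ball about an endpoint meets \<open>{0<..<T}\<close> on one side only, so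
    \<open>t\<close> is shifted towards the middle by less than the radius.\<close>
  proof (cases "t > T / 2")
    case True
    then have "t - min (e / 2) (T / 4) \<in> ball t e \<inter> {0<..<T}"
      using t(1) e(1) \<open>T > 0\<close> by (auto simp: dist_real_def min_def)
    then show ?thesis by blast
  next
    case False
    then have "t + min (e / 2) (T / 4) \<in> ball t e \<inter> {0<..<T}"
      using t(1) e(1) \<open>T > 0\<close> by (auto simp: dist_real_def min_def)
    then show ?thesis by blast
  qed
  ultimately have "\<not> negligible (ball t e \<inter> {0<..<T})" using open_not_negligible by blast
  moreover have "ball t e \<inter> {0<..<T} \<subseteq> N"
  proof
    fix s assume s: "s \<in> ball t e \<inter> {0<..<T}"
    then have "s \<notin> W" "s \<in> {0..T}" using e(2) by auto
    then show "s \<in> N" using W(2) by blast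
  qed
  then have "negligible (ball t e \<inter> {0<..<T})" by (rule negligible_subset[OF N])
  ultimately show False by simp
qed

text \<open>At s = 1 / \<gamma> the left side equals 1/e, so it does not tend to 0 uniformly in s.
  Comparing it with the weight \<open>1 + \<gamma> * exp (- (\<gamma> * s))\<close>, whose sum over
  the constraints has a bounded integral along penalized trajectories, gains the factor
  \<open>1 / sqrt \<gamma>\<close>.\<close>

lemma penalty_weight_bound:
  fixes \<gamma> s :: real
  assumes "\<gamma> > 0"
  shows "\<gamma> * s * exp (- (\<gamma> * s)) \<le> (1 + \<gamma> * exp (- (\<gamma> * s))) / sqrt \<gamma>"
proof -
  define e where "e = exp (- (\<gamma> * s) / 2)"
  have "e > 0" by (simp add: e_def)
  have e2: "exp (- (\<gamma> * s)) = e * e" by (simp add: e_def exp_add[symmetric])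
  have "\<gamma> * s / 2 \<le> exp (\<gamma> * s / 2)" using exp_ge_add_one_self[of "\<gamma> * s / 2"] by linarith
  then have "(\<gamma> * s / 2) * e \<le> exp (\<gamma> * s / 2) * e" using \<open>e > 0\<close> by (intro mult_right_mono) auto
  also have "\<dots> = 1" by (simp add: e_def exp_add[symmetric])
  finally have "\<gamma> * s * e \<le> 2" by simp
  then have "(\<gamma> * s * e) * e \<le> 2 * e" using \<open>e > 0\<close> by (intro mult_right_mono) auto
  \<comment> \<open>The inequality of arithmetic and geometric means for 1 and
    \<open>sqrt \<gamma> * e\<close>, in squared form.\<close>
  also have "2 * e \<le> (1 + \<gamma> * (e * e)) / sqrt \<gamma>"
  proof -
    have "0 \<le> (1 - sqrt \<gamma> * e)\<^sup>2" by simp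
    also have "\<dots> = 1 + \<gamma> * (e * e) - 2 * e * sqrt \<gamma>"
      using assms by (simp add: power2_eq_square algebra_simps)
    finally show ?thesis using assms by (simp add: le_divide_eq)
  qed
  finally show ?thesis by (simp add: e2 mult.assoc)
qed

subsection \<open>Almost everywhere differentiability of Lipschitz curves\<close>

context
  fixes F :: "real \<Rightarrow> real"
  assumes monoF: "mono F" and contF: "continuous_on UNIV F"
begin

lemma emeasure_interval_measure_cball:
  assumes "r > 0"
  shows "emeasure (interval_measure F) (cball a r) = ennreal (F (a + r) - F (a - r))"
  using assms monoF contF
  by (simp add: cball_eq_atLeastAtMost emeasure_interval_measure_Icc continuous_on_subset monoD)

text \<open>On the line \<open>cball a r\<close> is the interval from \<open>a - r\<close> to
  \<open>a + r\<close>, and the Stieltjes measure of \<open>F\<close> gives it the mass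
  \<open>F (a + r) - F (a - r)\<close>. A slope bound on each ball therefore compares two measures
  on a countable disjoint union.\<close>

lemma emeasure_disjoint_cballs_le:
  assumes C: "countable C" "pairwise (\<lambda>i j. disjnt (cball (fst i) (snd i)) (cball (fst j) (snd j))) C"
    and r: "\<And>a r. (a, r) \<in> C \<Longrightarrow> r > 0" and "p \<ge> 0"
    and slope: "\<And>a r. (a, r) \<in> C \<Longrightarrow> F (a + r) - F (a - r) \<le> p * (2 * r)"
  shows "emeasure (interval_measure F) (\<Union>i\<in>C. cball (fst i) (snd i))
    \<le> ennreal p * emeasure lebesgue (\<Union>i\<in>C. cball (fst i) (snd i))"
proof -
  have dis: "disjoint_family_on (\<lambda>i. cball (fst i) (snd i)) C"
    using C(2) unfolding disjoint_family_on_def pairwise_def disjnt_def by blast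
  have "emeasure (interval_measure F) (\<Union>i\<in>C. cball (fst i) (snd i)) =
      (\<integral>\<^sup>+i. emeasure (interval_measure F) (cball (fst i) (snd i)) \<partial>count_space C)"
    by (rule emeasure_UN_countable[OF _ C(1) dis]) auto
  also have "\<dots> \<le> (\<integral>\<^sup>+i. ennreal p * emeasure lebesgue (cball (fst i) (snd i)) \<partial>count_space C)"
  proof (rule nn_integral_mono)
    fix i assume "i \<in> space (count_space C)"
    then have i: "(fst i, snd i) \<in> C" by simp
    have "emeasure lebesgue (cball (fst i) (snd i)) = ennreal (2 * snd i)"
      using r[OF i] by (simp add: cball_eq_atLeastAtMost)
    then show "emeasure (interval_measure F) (cball (fst i) (snd i)) \<le> ennreal p * emeasure lebesgue (cball (fst i) (snd i))"
      using r[OF i] slope[OF i] \<open>p \<ge> 0\<close>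
      by (simp add: emeasure_interval_measure_cball ennreal_mult[symmetric] ennreal_leI)
  qed
  also have "\<dots> = ennreal p * (\<integral>\<^sup>+i. emeasure lebesgue (cball (fst i) (snd i)) \<partial>count_space C)"
    by (rule nn_integral_cmult) simp
  also have "(\<integral>\<^sup>+i. emeasure lebesgue (cball (fst i) (snd i)) \<partial>count_space C)
      = emeasure lebesgue (\<Union>i\<in>C. cball (fst i) (snd i))"
    by (rule emeasure_UN_countable[OF _ C(1) dis, symmetric]) auto
  finally show ?thesis .
qed

lemma emeasure_disjoint_cballs_ge:
  assumes C: "countable C" "pairwise (\<lambda>i j. disjnt (cball (fst i) (snd i)) (cball (fst j) (snd j))) C"
    and r: "\<And>a r. (a, r) \<in> C \<Longrightarrow> r > 0" and "p \<ge> 0"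
    and slope: "\<And>a r. (a, r) \<in> C \<Longrightarrow> F (a + r) - F (a - r) \<ge> p * (2 * r)"
  shows "emeasure (interval_measure F) (\<Union>i\<in>C. cball (fst i) (snd i))
    \<ge> ennreal p * emeasure lebesgue (\<Union>i\<in>C. cball (fst i) (snd i))"
proof -
  have dis: "disjoint_family_on (\<lambda>i. cball (fst i) (snd i)) C"
    using C(2) unfolding disjoint_family_on_def pairwise_def disjnt_def by blast
  have "ennreal p * emeasure lebesgue (\<Union>i\<in>C. cball (fst i) (snd i))
      = ennreal p * (\<integral>\<^sup>+i. emeasure lebesgue (cball (fst i) (snd i)) \<partial>count_space C)"
    by (subst emeasure_UN_countable[OF _ C(1) dis]) auto
  also have "\<dots> = (\<integral>\<^sup>+i. ennreal p * emeasure lebesgue (cball (fst i) (snd i)) \<partial>count_space C)"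
    by (rule nn_integral_cmult[symmetric]) simp
  also have "\<dots> \<le> (\<integral>\<^sup>+i. emeasure (interval_measure F) (cball (fst i) (snd i)) \<partial>count_space C)"
  proof (rule nn_integral_mono)
    fix i assume "i \<in> space (count_space C)"
    then have i: "(fst i, snd i) \<in> C" by simp
    have "emeasure lebesgue (cball (fst i) (snd i)) = ennreal (2 * snd i)"
      using r[OF i] by (simp add: cball_eq_atLeastAtMost)
    then show "ennreal p * emeasure lebesgue (cball (fst i) (snd i)) \<le> emeasure (interval_measure F) (cball (fst i) (snd i))"
      using r[OF i] slope[OF i] \<open>p \<ge> 0\<close>
      by (simp add: emeasure_interval_measure_cball ennreal_mult[symmetric] ennreal_leI)
  qed
  also have "\<dots> = emeasure (interval_measure F) (\<Union>i\<in>C. cball (fst i) (snd i))"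
    by (rule emeasure_UN_countable[OF _ C(1) dis, symmetric]) auto
  finally show ?thesis .
qed

text \<open>The intervals need only contain \<open>x\<close>. The segment between \<open>x\<close>
  and any nearby point is such an interval, so both one-sided difference quotients are covered, and
  the intervals form a Vitali cover of the set. The strict inequality makes the set Borel.\<close>

definition low_slope :: "real \<Rightarrow> real set" where
  "low_slope p = {x. \<forall>d>0. \<exists>a r. 0 < r \<and> r < d \<and> x \<in> cball a r \<and> F (a + r) - F (a - r) < p * (2 * r)}"

definition high_slope :: "real \<Rightarrow> real set" where
  "high_slope q = {x. \<forall>d>0. \<exists>a r. 0 < r \<and> r < d \<and> x \<in> cball a r \<and> F (a + r) - F (a - r) > q * (2 * r)}"


text \<open>A strict slope condition survives a slight increase of the radius, which lets open balls
  replace closed ones in the description of the slope sets.\<close>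

lemma enlarge_cball:
  fixes H :: "real \<Rightarrow> real"
  assumes "continuous_on UNIV H" "H r > 0" "0 < r" "r < d"
  obtains r' where "r < r'" "r' < d" "H r' > 0"
proof -
  have "\<forall>\<^sub>F s in at r. H s > 0"
    using assms(1,2) by (metis order_tendstoD(1) continuous_on_def UNIV_I)
  then obtain e where "e > 0" and e: "\<And>s. s \<noteq> r \<Longrightarrow> dist s r < e \<Longrightarrow> H s > 0"
    unfolding eventually_at by auto
  define r' where "r' = min (r + e / 2) ((r + d) / 2)"
  have "r < r'" "r' < d" "dist r' r < e"
    using assms \<open>e > 0\<close> by (auto simp: r'_def dist_real_def min_def field_simps)
  then show thesis using e[of r'] that by auto
qed

text \<open>For fixed \<open>d\<close> the condition describes a union of open balls; letting
  \<open>d\<close> run through 1 / (n + 1) exhibits a G-delta set.\<close>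

lemma strict_slope_borel:
  assumes "\<And>a. continuous_on UNIV (H a :: real \<Rightarrow> real)"
  shows "{x::real. \<forall>d>0. \<exists>a r. 0 < r \<and> r < d \<and> x \<in> cball a r \<and> H a r > 0} \<in> sets borel"
proof -
  define S where "S = (\<lambda>d. {x::real. \<exists>a r. 0 < r \<and> r < d \<and> x \<in> cball a r \<and> H a r > 0})"
  have "open (S d)" for d
  proof -
    have "S d = (\<Union>(a, r) \<in> {(a, r). 0 < r \<and> r < d \<and> H a r > 0}. ball a r)"
    proof
      show "S d \<subseteq> (\<Union>(a, r) \<in> {(a, r). 0 < r \<and> r < d \<and> H a r > 0}. ball a r)"
      proof
        fix x assume "x \<in> S d"
        then obtain a r where ar: "0 < r" "r < d" "x \<in> cball a r" "H a r > 0" by (auto simp: S_def)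
        then obtain r' where "r < r'" "r' < d" "H a r' > 0" using enlarge_cball[OF assms[of a], of r d] by blast
        then show "x \<in> (\<Union>(a, r) \<in> {(a, r). 0 < r \<and> r < d \<and> H a r > 0}. ball a r)" using ar by (intro UN_I[of "(a, r')"]) auto
      qed
      show "(\<Union>(a, r) \<in> {(a, r). 0 < r \<and> r < d \<and> H a r > 0}. ball a r) \<subseteq> S d"
      proof clarify
        fix x a r assume "0 < r" "r < d" "H a r > 0" "x \<in> ball a r"
        moreover then have "x \<in> cball a r" by simp
        ultimately show "x \<in> S d" unfolding S_def by blast
      qed
    qed
    then show ?thesis by (auto intro!: open_UN)
  qed
  moreover have "{x::real. \<forall>d>0. \<exists>a r. 0 < r \<and> r < d \<and> x \<in> cball a r \<and> H a r > 0} = (\<Inter>n. S (1 / real (Suc n)))"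
  proof (intro subset_antisym subsetI)
    fix x assume x: "x \<in> (\<Inter>n. S (1 / real (Suc n)))"
    have "\<exists>a r. 0 < r \<and> r < d \<and> x \<in> cball a r \<and> H a r > 0" if dpos: "d > 0" for d
    proof -
      obtain n where "1 / real (Suc n) < d" by (rule nat_approx_posE[OF dpos])
      moreover have "x \<in> S (1 / real (Suc n))" using x by blast
      then obtain a r where "0 < r" "r < 1 / real (Suc n)" "x \<in> cball a r" "H a r > 0" unfolding S_def by blast
      ultimately show ?thesis by (meson less_trans)
    qed
    then show "x \<in> {x::real. \<forall>d>0. \<exists>a r. 0 < r \<and> r < d \<and> x \<in> cball a r \<and> H a r > 0}" by blast
  next
    fix x assume "x \<in> {x::real. \<forall>d>0. \<exists>a r. 0 < r \<and> r < d \<and> x \<in> cball a r \<and> H a r > 0}"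
    then show "x \<in> (\<Inter>n. S (1 / real (Suc n)))" unfolding S_def by (simp del: of_nat_Suc)
  qed
  ultimately show ?thesis by auto
qed

lemma low_slope_borel: "low_slope p \<in> sets borel"
proof -
  have "continuous_on UNIV (\<lambda>r. p * (2 * r) - (F (a + r) - F (a - r)))" for a
    by (intro continuous_intros continuous_on_compose2[OF contF]) auto
  from strict_slope_borel[of "\<lambda>a r. p * (2 * r) - (F (a + r) - F (a - r))", OF this]
  show ?thesis unfolding low_slope_def by (simp del: mem_cball)
qed

lemma high_slope_borel: "high_slope p \<in> sets borel"
proof -
  have "continuous_on UNIV (\<lambda>r. (F (a + r) - F (a - r)) - p * (2 * r))" for a
    by (intro continuous_intros continuous_on_compose2[OF contF]) auto
  from strict_slope_borel[of "\<lambda>a r. (F (a + r) - F (a - r)) - p * (2 * r)", OF this]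
  show ?thesis unfolding high_slope_def by (simp del: mem_cball)
qed

text \<open>Vitali's theorem is applied twice. Intervals of slope below \<open>p\<close> inside a
  thin neighbourhood \<open>V\<close> cover almost all of \<open>E\<close>; intervals of slope above
  \<open>q\<close> inside the first family cover almost all of \<open>E\<close> again. Comparing
  Stieltjes masses gives q |E| \<le> p |V|, which is impossible when |V| is close to |E|.\<close>

lemma negligible_slope_gap:
  assumes "0 \<le> p" "p < q"
  shows "negligible (low_slope p \<inter> high_slope q \<inter> ball 0 R)"
proof (rule ccontr)
  define E where "E = low_slope p \<inter> high_slope q \<inter> ball 0 R"
  assume "\<not> negligible (low_slope p \<inter> high_slope q \<inter> ball 0 R)"
  then have nn: "\<not> negligible E" by (simp add: E_def)
  have Eb: "E \<in> sets borel" unfolding E_def using low_slope_borel high_slope_borel by auto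
  have Em: "E \<in> lmeasurable"
    using Eb by (intro bounded_set_imp_lmeasurable) (auto simp: E_def intro: bounded_subset[OF bounded_ball])
  define m where "m = measure lebesgue E"
  have "m > 0" using nn Em by (metis m_def negligible_iff_measure measure_nonneg less_eq_real_def)
  \<comment> \<open>Small enough for \<open>p * (m + \<epsilon>) < q * m\<close>; the denominator
    contains \<open>p + 1\<close> rather than \<open>p\<close> because \<open>p\<close> may be
    0.\<close>
  define \<epsilon> where "\<epsilon> = (q - p) * m / (2 * (p + 1))"
  have "\<epsilon> > 0" using assms \<open>m > 0\<close> by (simp add: \<epsilon>_def)
  have "p * \<epsilon> \<le> (q - p) * m / 2"
  proof -
    have "p * \<epsilon> = (p / (p + 1)) * ((q - p) * m / 2)" by (simp add: \<epsilon>_def)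
    also have "\<dots> \<le> 1 * ((q - p) * m / 2)" using assms \<open>m > 0\<close> by (intro mult_right_mono) auto
    finally show ?thesis by simp
  qed
  then have gap: "p * (m + \<epsilon>) < q * m"
  proof -
    have "0 < (q - p) * m" using assms \<open>m > 0\<close> by simp
    moreover have "p * (m + \<epsilon>) = p * m + p * \<epsilon>" "q * m = p * m + (q - p) * m" by (simp_all add: algebra_simps)
    ultimately show ?thesis using \<open>p * \<epsilon> \<le> (q - p) * m / 2\<close> by linarith
  qed
  obtain V where V: "open V" "E \<subseteq> V" "V \<in> lmeasurable" "measure lebesgue V < m + \<epsilon>"
  proof -
    have "E \<in> sets lebesgue" using Em by blast
    from sets_lebesgue_outer_open[OF this \<open>\<epsilon> > 0\<close>]
    obtain V where V: "open V" "E \<subseteq> V" "V - E \<in> lmeasurable" "emeasure lebesgue (V - E) < ennreal \<epsilon>" by blast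
    have "measure lebesgue (V - E) < \<epsilon>"
      using V(3,4) \<open>\<epsilon> > 0\<close> by (simp add: emeasure_eq_measure2 ennreal_less_iff)
    moreover have Vm: "V \<in> lmeasurable" using V(2,3) Em by (metis Diff_partition fmeasurable.Un)
    moreover have "measure lebesgue (V - E) = measure lebesgue V - m"
      unfolding m_def by (rule measurable_measure_Diff[OF Vm _ V(2)]) (use Em in blast)
    ultimately show thesis using that[OF V(1,2) Vm] by linarith
  qed
  have cover: "\<exists>i. i \<in> {(a, r). 0 < r \<and> cball a r \<subseteq> W \<and> Q a r} \<and> x \<in> cball (fst i) (snd i) \<and> snd i < d"
    if W: "open W" "x \<in> W" "0 < d" and Q: "\<And>d. d > 0 \<Longrightarrow> \<exists>a r. 0 < r \<and> r < d \<and> x \<in> cball a r \<and> Q a r"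
    for W Q and x d :: real
  proof -
    obtain e where "e > 0" "ball x e \<subseteq> W" using W(1,2) open_contains_ball by blast
    \<comment> \<open>A ball that contains \<open>x\<close> reaches at most twice its radius away
      from \<open>x\<close>, hence the bound \<open>e / 2\<close>.\<close>
    then obtain a r where ar: "0 < r" "r < min d (e / 2)" "x \<in> cball a r" "Q a r"
      using Q[of "min d (e / 2)"] W(3) by auto
    have "cball a r \<subseteq> ball x e"
    proof
      fix y assume "y \<in> cball a r"
      then have "dist x y \<le> 2 * r" using ar(3) dist_triangle[of x y a] by (simp add: dist_commute)
      then show "y \<in> ball x e" using ar(2) by simp
    qed
    then show ?thesis using ar \<open>ball x e \<subseteq> W\<close> by (intro exI[of _ "(a, r)"]) auto
  qed
  define K1 where "K1 = {(a, r). 0 < r \<and> cball a r \<subseteq> V \<and> F (a + r) - F (a - r) < p * (2 * r)}"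
  obtain C1 where C1: "countable C1" "C1 \<subseteq> K1"
     "pairwise (\<lambda>i j. disjnt (cball (fst i) (snd i)) (cball (fst j) (snd j))) C1"
     "negligible (E - (\<Union>i \<in> C1. cball (fst i) (snd i)))"
  proof (rule Vitali_covering_theorem_cballs[of K1 snd E fst])
    show "0 < snd i" if "i \<in> K1" for i using that by (auto simp: K1_def)
    show "\<exists>i. i \<in> K1 \<and> x \<in> cball (fst i) (snd i) \<and> snd i < d" if "x \<in> E" "0 < d" for x d
      unfolding K1_def using that V(1,2) by (intro cover) (auto simp: E_def low_slope_def)
  qed
  \<comment> \<open>Open balls make \<open>W\<close> open, so that the second cover can be taken
    inside it; only countably many spheres, each negligible, are lost.\<close>
  define W where "W = (\<Union>i\<in>C1. ball (fst i) (snd i))"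
  have "negligible (\<Union>i\<in>C1. sphere (fst i) (snd i))"
    using C1(1) by (intro negligible_countable_Union) (auto simp: negligible_sphere)
  moreover have "E - W \<subseteq> (E - (\<Union>i \<in> C1. cball (fst i) (snd i))) \<union> (\<Union>i\<in>C1. sphere (fst i) (snd i))"
  proof
    fix x assume x: "x \<in> E - W"
    then have "\<forall>i\<in>C1. \<not> dist (fst i) x < snd i" by (auto simp: W_def)
    then have "\<forall>i\<in>C1. dist (fst i) x \<le> snd i \<longrightarrow> dist (fst i) x = snd i" by force
    then show "x \<in> (E - (\<Union>i \<in> C1. cball (fst i) (snd i))) \<union> (\<Union>i\<in>C1. sphere (fst i) (snd i))"
      using x by (simp only: mem_cball mem_sphere Un_iff Diff_iff UN_iff) blast
  qed
  ultimately have EW: "negligible (E - W)" using C1(4) by (meson negligible_subset negligible_Un)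
  have "open W" by (auto simp: W_def)
  define K2 where "K2 = {(a, r). 0 < r \<and> cball a r \<subseteq> W \<and> F (a + r) - F (a - r) > q * (2 * r)}"
  obtain C2 where C2: "countable C2" "C2 \<subseteq> K2"
     "pairwise (\<lambda>i j. disjnt (cball (fst i) (snd i)) (cball (fst j) (snd j))) C2"
     "negligible ((E \<inter> W) - (\<Union>i \<in> C2. cball (fst i) (snd i)))"
  proof (rule Vitali_covering_theorem_cballs[of K2 snd "E \<inter> W" fst])
    show "0 < snd i" if "i \<in> K2" for i using that by (auto simp: K2_def)
    show "\<exists>i. i \<in> K2 \<and> x \<in> cball (fst i) (snd i) \<and> snd i < d" if "x \<in> E \<inter> W" "0 < d" for x d
      unfolding K2_def using that \<open>open W\<close> by (intro cover) (auto simp: E_def high_slope_def)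
  qed
  define X1 where "X1 = (\<Union>i \<in> C1. cball (fst i) (snd i))"
  define X2 where "X2 = (\<Union>i \<in> C2. cball (fst i) (snd i))"
  have X1b: "X1 \<in> sets borel" and X2b: "X2 \<in> sets borel" unfolding X1_def X2_def using C1(1) C2(1) by auto
  have "cball (fst i) (snd i) \<subseteq> W" if "i \<in> C2" for i
    using subsetD[OF C2(2) that] by (simp add: K2_def case_prod_unfold)
  then have "X2 \<subseteq> W" unfolding X2_def by (rule UN_least)
  moreover have "W \<subseteq> X1" unfolding W_def X1_def by (intro UN_mono ball_subset_cball subset_refl)
  moreover have "cball (fst i) (snd i) \<subseteq> V" if "i \<in> C1" for i
    using subsetD[OF C1(2) that] by (simp add: K1_def case_prod_unfold)
  then have "X1 \<subseteq> V" unfolding X1_def by (rule UN_least)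
  ultimately have sub: "X2 \<subseteq> X1" "X1 \<subseteq> V" by auto
  have "negligible (E - X2)"
  proof -
    have "E - X2 \<subseteq> (E - W) \<union> ((E \<inter> W) - X2)" by auto
    then show ?thesis using EW C2(4) unfolding X2_def by (meson negligible_subset negligible_Un)
  qed
  have "emeasure lebesgue E \<le> emeasure lebesgue (X2 \<union> (E - X2))"
    using Eb X2b by (intro emeasure_mono) auto
  also have "\<dots> = emeasure lebesgue X2"
    using \<open>negligible (E - X2)\<close> X2b by (intro emeasure_Un_null_set) (auto simp: negligible_iff_null_sets)
  finally have "ennreal q * emeasure lebesgue E \<le> ennreal q * emeasure lebesgue X2" by (rule mult_left_mono) simp
  also have "\<dots> \<le> emeasure (interval_measure F) X2"
    unfolding X2_def
    by (rule emeasure_disjoint_cballs_ge[OF C2(1,3)]) (use C2(2) assms in \<open>auto simp: K2_def\<close>)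
  also have "\<dots> \<le> emeasure (interval_measure F) X1" using sub X1b by (intro emeasure_mono) auto
  also have "\<dots> \<le> ennreal p * emeasure lebesgue X1"
    unfolding X1_def
    by (rule emeasure_disjoint_cballs_le[OF C1(1,3)]) (use C1(2) assms in \<open>auto simp: K1_def less_imp_le\<close>)
  also have "\<dots> \<le> ennreal p * emeasure lebesgue V"
    using sub V(1) by (intro mult_left_mono emeasure_mono) auto
  finally have "ennreal q * ennreal m \<le> ennreal p * ennreal (measure lebesgue V)"
    using Em V(3) by (simp add: emeasure_eq_measure2 m_def)
  then have "q * m \<le> p * measure lebesgue V"
    using assms \<open>m > 0\<close> by (simp add: ennreal_mult[symmetric] ennreal_le_iff)
  also have "\<dots> \<le> p * (m + \<epsilon>)" using V(4) assms by (intro mult_left_mono) auto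
  finally show False using gap by linarith
qed

text \<open>Outside the null set \<open>N\<close>, slopes below \<open>p\<close> cannot recur at all
  small scales together with slopes above some \<open>q > p\<close>. Hence the slopes over small
  intervals containing \<open>x\<close> converge, and the limit is the supremum \<open>D\<close> of
  the levels exceeded at arbitrarily small scales.\<close>

lemma bounded_slope_differentiable_AE:
  assumes L: "\<And>s t. s \<le> t \<Longrightarrow> F t - F s \<le> L * (t - s)"
  shows "\<exists>N. negligible N \<and> (\<forall>x. x \<notin> N \<longrightarrow> (\<exists>D. (F has_real_derivative D) (at x)))"
proof -
  define N where "N = (\<Union>(p, q, R) \<in> {(p, q, R). p \<in> \<rat> \<and> q \<in> \<rat> \<and> R \<in> \<nat> \<and> 0 \<le> p \<and> p < q}.
      low_slope p \<inter> high_slope q \<inter> ball 0 R)"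
  have "countable {(p :: real, q :: real, R :: real). p \<in> \<rat> \<and> q \<in> \<rat> \<and> R \<in> \<nat> \<and> 0 \<le> p \<and> p < q}"
  proof (rule countable_subset)
    show "{(p, q, R). p \<in> \<rat> \<and> q \<in> \<rat> \<and> R \<in> \<nat> \<and> 0 \<le> p \<and> p < q} \<subseteq> (\<rat> :: real set) \<times> (\<rat> :: real set) \<times> (\<nat> :: real set)" by auto
    show "countable ((\<rat> :: real set) \<times> (\<rat> :: real set) \<times> (\<nat> :: real set))"
      using countable_rat by (auto simp: Nats_def)
  qed
  then have "negligible N" unfolding N_def
    by (intro negligible_countable_Union) (auto simp: negligible_slope_gap)
  moreover have "\<exists>D. (F has_real_derivative D) (at x)" if "x \<notin> N" for x
  proof -
    have gap: False if "x \<in> low_slope p" "x \<in> high_slope q" "0 \<le> p" "p < q" for p q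
    proof -
      \<comment> \<open>Rational levels strictly between \<open>p\<close> and \<open>q\<close> bring
        the point into one of the countably many sets that form \<open>N\<close>.\<close>
      obtain p' where p': "p' \<in> \<rat>" "p < p'" "p' < q" using Rats_dense_in_real[OF \<open>p < q\<close>] by blast
      obtain q' where q': "q' \<in> \<rat>" "p' < q'" "q' < q" using Rats_dense_in_real[OF p'(3)] by blast
      obtain R :: nat where "norm x < real R" using reals_Archimedean2 by blast
      have "x \<in> low_slope p'"
        unfolding low_slope_def
      proof (intro CollectI allI impI)
        fix d :: real assume "d > 0"
        then obtain a r where "0 < r" "r < d" "x \<in> cball a r" "F (a + r) - F (a - r) < p * (2 * r)"
          using \<open>x \<in> low_slope p\<close> by (auto simp: low_slope_def)
        moreover from this have "F (a + r) - F (a - r) < p' * (2 * r)"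
          using mult_strict_right_mono[of p p' "2 * r"] p' by linarith
        ultimately show "\<exists>a r. 0 < r \<and> r < d \<and> x \<in> cball a r \<and> F (a + r) - F (a - r) < p' * (2 * r)"
          by blast
      qed
      moreover have "x \<in> high_slope q'"
        unfolding high_slope_def
      proof (intro CollectI allI impI)
        fix d :: real assume "d > 0"
        then obtain a r where "0 < r" "r < d" "x \<in> cball a r" "F (a + r) - F (a - r) > q * (2 * r)"
          using \<open>x \<in> high_slope q\<close> by (auto simp: high_slope_def)
        moreover from this have "F (a + r) - F (a - r) > q' * (2 * r)"
          using mult_strict_right_mono[of q' q "2 * r"] q' by linarith
        ultimately show "\<exists>a r. 0 < r \<and> r < d \<and> x \<in> cball a r \<and> F (a + r) - F (a - r) > q' * (2 * r)"
          by blast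
      qed
      moreover have "0 \<le> p'" using p' \<open>0 \<le> p\<close> by linarith
      ultimately have "x \<in> N" unfolding N_def using p' q' \<open>norm x < real R\<close>
        by (intro UN_I[of "(p', q', real R)"]) auto
      then show False using \<open>x \<notin> N\<close> by blast
    qed
    \<comment> \<open>Inserting 0 keeps the set nonempty when no nonnegative level is exceeded, as
      where \<open>F\<close> is locally constant.\<close>
    define S where "S = insert 0 {q. 0 \<le> q \<and> x \<in> high_slope q}"
    have bdd: "q \<le> max L 0" if q: "q \<in> S" for q
    proof (cases "q = 0")
      case False
      then obtain a r where r: "0 < r" "F (a + r) - F (a - r) > q * (2 * r)"
        using q by (auto simp: S_def high_slope_def dest: spec[of _ 1])
      have "F (a + r) - F (a - r) \<le> L * (2 * r)" using L[of "a - r" "a + r"] r by (simp add: algebra_simps)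
      then have "q * (2 * r) \<le> L * (2 * r)" using r by linarith
      then show ?thesis using r by simp
    qed simp
    then have bdS: "bdd_above S" by (auto simp: bdd_above_def)
    define D where "D = Sup S"
    have "0 \<le> D" unfolding D_def using bdS by (intro cSup_upper) (auto simp: S_def)
    have "(F has_vector_derivative D) (at x)"
      unfolding has_vector_derivative_def has_derivative_within_alt
    proof (intro conjI allI impI)
      show "bounded_linear (\<lambda>h. h *\<^sub>R D)" by (rule bounded_linear_scaleR_left)
      fix e :: real assume "e > 0"
      have "D + e \<notin> S" using bdS \<open>e > 0\<close> cSup_upper[of "D + e" S] by (auto simp: D_def)
      then have "x \<notin> high_slope (D + e)" using \<open>0 \<le> D\<close> \<open>e > 0\<close> by (auto simp: S_def)
      then obtain d1 where "d1 > 0" and d1: "\<And>a r. 0 < r \<Longrightarrow> r < d1 \<Longrightarrow> x \<in> cball a r \<Longrightarrow> F (a + r) - F (a - r) \<le> (D + e) * (2 * r)"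
        unfolding high_slope_def by (fastforce simp: not_less simp del: mem_cball)
      have "\<exists>d2>0. \<forall>a r. 0 < r \<longrightarrow> r < d2 \<longrightarrow> x \<in> cball a r \<longrightarrow> (D - e) * (2 * r) \<le> F (a + r) - F (a - r)"
      \<comment> \<open>A negative lower level is automatic for a nondecreasing \<open>F\<close>;
        the gap property covers only nonnegative levels.\<close>
      proof (cases "D - e < 0")
        case True
        have "(D - e) * (2 * r) \<le> F (a + r) - F (a - r)" if "0 < r" for a r
        proof -
          have "F (a - r) \<le> F (a + r)" using that by (intro monoD[OF monoF]) simp
          moreover have "(D - e) * (2 * r) \<le> 0" using True that by (simp add: mult_nonpos_nonneg)
          ultimately show ?thesis by linarith
        qed
        then show ?thesis by (intro exI[of _ 1]) auto
      next
        case False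
        have "D - e < Sup S" using \<open>e > 0\<close> by (simp add: D_def)
        then obtain q where q: "q \<in> S" "D - e < q" using less_cSupE[of "D - e" S] by (auto simp: S_def)
        then have "x \<in> high_slope q" using False by (auto simp: S_def)
        then have "x \<notin> low_slope (D - e)" using gap[of "D - e" q] False q by auto
        then show ?thesis
          unfolding low_slope_def by (fastforce simp: not_less simp del: mem_cball)
      qed
      then obtain d2 where "d2 > 0" and d2: "\<And>a r. 0 < r \<Longrightarrow> r < d2 \<Longrightarrow> x \<in> cball a r \<Longrightarrow> (D - e) * (2 * r) \<le> F (a + r) - F (a - r)"
        by blast
      have "norm (F y - F x - (y - x) *\<^sub>R D) \<le> e * norm (y - x)" if "norm (y - x) < min d1 d2" for y
      proof (cases "x = y")
        case False
        \<comment> \<open>The ball with this centre and radius is exactly the segment between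
          \<open>x\<close> and \<open>y\<close>.\<close>
        define a r where "a = (x + y) / 2" and "r = \<bar>y - x\<bar> / 2"
        have r: "0 < r" "r < d1" "r < d2" "x \<in> cball a r"
          using that False by (auto simp: a_def r_def dist_real_def abs_if field_simps)
        note b = d1[OF r(1,2,4)] d2[OF r(1,3,4)]
        show ?thesis
        proof (cases "x < y")
          case True
          then have eq: "a + r = y" "a - r = x" "2 * r = y - x" by (auto simp: a_def r_def field_simps)
          have "F y - F x \<le> (D + e) * (y - x)" "(D - e) * (y - x) \<le> F y - F x" using b by (simp_all only: eq)
          then show ?thesis using True by (simp add: abs_le_iff algebra_simps)
        next
          case False
          then have eq: "a + r = x" "a - r = y" "2 * r = x - y" using \<open>x \<noteq> y\<close> by (auto simp: a_def r_def field_simps)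
          have "F x - F y \<le> (D + e) * (x - y)" "(D - e) * (x - y) \<le> F x - F y" using b by (simp_all only: eq)
          then show ?thesis using False by (simp add: abs_le_iff algebra_simps)
        qed
      qed simp
      then show "\<exists>d>0. \<forall>y\<in>UNIV. norm (y - x) < d \<longrightarrow> norm (F y - F x - (y - x) *\<^sub>R D) \<le> e * norm (y - x)"
        using \<open>d1 > 0\<close> \<open>d2 > 0\<close> by (intro exI[of _ "min d1 d2"]) auto
    qed
    then show ?thesis by (auto simp: has_real_derivative_iff_has_vector_derivative)
  qed
  ultimately show ?thesis by blast
qed

end

section \<open>From monotone functions to Lipschitz curves\<close>

lemma lipschitz_real_differentiable_AE:
  fixes f :: "real \<Rightarrow> real"
  assumes "L-lipschitz_on UNIV f"
  shows "\<exists>N. negligible N \<and> (\<forall>x. x \<notin> N \<longrightarrow> (\<exists>D. (f has_real_derivative D) (at x)))"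
proof -
  have "\<bar>f t - f s\<bar> \<le> L * (t - s)" if "s \<le> t" for s t
    using lipschitz_onD[OF assms, of t s] that by (simp add: dist_real_def)
  then have b: "f t - f s \<le> L * (t - s)" "f s - f t \<le> L * (t - s)" if "s \<le> t" for s t
    using that by (fastforce simp: abs_le_iff)+
  \<comment> \<open>Adding \<open>L * t\<close> makes an \<open>L\<close>-Lipschitz function
    nondecreasing, with slopes at most \<open>2 * L\<close>.\<close>
  define F where "F = (\<lambda>t. f t + L * t)"
  have "mono F" unfolding F_def by (rule monoI) (use b in \<open>force simp: algebra_simps\<close>)
  moreover have "continuous_on UNIV F"
    unfolding F_def by (intro continuous_intros lipschitz_on_continuous_on[OF assms])
  moreover have "F t - F s \<le> (2 * L) * (t - s)" if "s \<le> t" for s t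
    unfolding F_def using b(1)[OF that] by (simp add: algebra_simps)
  ultimately obtain N where "negligible N" and N: "\<And>x. x \<notin> N \<Longrightarrow> \<exists>D. (F has_real_derivative D) (at x)"
    using bounded_slope_differentiable_AE[of F "2 * L"] by blast
  have "\<exists>D. (f has_real_derivative D) (at x)" if x: "x \<notin> N" for x
  proof -
    obtain D where "(F has_real_derivative D) (at x)" using N[OF x] by blast
    then have "((\<lambda>t. F t - L * t) has_real_derivative (D - L)) (at x)"
      by (auto intro!: derivative_eq_intros)
    then show ?thesis by (auto simp: F_def)
  qed
  then show ?thesis using \<open>negligible N\<close> by blast
qed

lemma lipschitz_differentiable_AE:
  fixes x :: "real \<Rightarrow> 'a::euclidean_space"
  assumes lip: "L-lipschitz_on {a..b} x" and "a \<le> b"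
  obtains N where "negligible N"
    "\<And>t. t \<in> {a..b} - N \<Longrightarrow> \<exists>D. (x has_vector_derivative D) (at t within {a..b})"
proof -
  \<comment> \<open>Freezing the curve outside \<open>{a..b}\<close> yields a Lipschitz function on
    the whole line, to which the scalar result applies in each coordinate.\<close>
  define y where "y = (\<lambda>t. x (max a (min b t)))"
  have "L \<ge> 0" using lip by (rule lipschitz_on_nonneg)
  have lipy: "L-lipschitz_on UNIV (\<lambda>t. y t \<bullet> i)" if "i \<in> Basis" for i
  proof (rule lipschitz_onI)
    fix s t
    have "dist (y s \<bullet> i) (y t \<bullet> i) \<le> dist (y s) (y t)"
      using that by (metis dist_real_def dist_norm inner_diff_left Basis_le_norm)
    also have "\<dots> \<le> L * dist (max a (min b s)) (max a (min b t))"
      unfolding y_def using \<open>a \<le> b\<close> by (intro lipschitz_onD[OF lip]) auto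
    also have "\<dots> \<le> L * dist s t"
      using \<open>L \<ge> 0\<close> by (intro mult_left_mono) (auto simp: dist_real_def max_def min_def)
    finally show "dist (y s \<bullet> i) (y t \<bullet> i) \<le> L * dist s t" .
  qed fact
  have "\<exists>N. negligible N \<and> (\<forall>t. t \<notin> N \<longrightarrow> (\<exists>D. ((\<lambda>t. y t \<bullet> i) has_real_derivative D) (at t)))"
    if "i \<in> Basis" for i
    by (rule lipschitz_real_differentiable_AE[OF lipy[OF that]])
  then obtain N where N: "\<And>i. i \<in> Basis \<Longrightarrow> negligible (N i)"
    "\<And>i t. i \<in> Basis \<Longrightarrow> t \<notin> N i \<Longrightarrow> \<exists>D. ((\<lambda>t. y t \<bullet> i) has_real_derivative D) (at t)"
    by metis
  show thesis
  proof
    show "negligible (\<Union>i\<in>Basis. N i)" using N(1) by (intro negligible_Union) auto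
    fix t assume t: "t \<in> {a..b} - (\<Union>i\<in>Basis. N i)"
    then have "\<forall>i\<in>Basis. \<exists>D. ((\<lambda>t. y t \<bullet> i) has_real_derivative D) (at t)" using N(2) by blast
    then obtain D where D: "\<And>i. i \<in> Basis \<Longrightarrow> ((\<lambda>t. y t \<bullet> i) has_real_derivative D i) (at t)" by metis
    have "((\<lambda>t. \<Sum>i\<in>Basis. (y t \<bullet> i) *\<^sub>R i) has_vector_derivative (\<Sum>i\<in>Basis. D i *\<^sub>R i)) (at t)"
    proof (rule has_vector_derivative_sum)
      fix i :: 'a assume "i \<in> Basis"
      show "((\<lambda>t. (y t \<bullet> i) *\<^sub>R i) has_vector_derivative D i *\<^sub>R i) (at t)"
        using has_vector_derivative_scaleR[OF D[OF \<open>i \<in> Basis\<close>] has_vector_derivative_const[of i]] by simp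
    qed
    then have "(y has_vector_derivative (\<Sum>i\<in>Basis. D i *\<^sub>R i)) (at t within {a..b})"
      by (simp add: euclidean_representation has_vector_derivative_at_within)
    then have "(x has_vector_derivative (\<Sum>i\<in>Basis. D i *\<^sub>R i)) (at t within {a..b})"
      by (rule has_vector_derivative_transform[rotated 2]) (use t in \<open>auto simp: y_def\<close>)
    then show "\<exists>D. (x has_vector_derivative D) (at t within {a..b})" by blast
  qed
qed

subsection \<open>The constraint set and its Clarke cones\<close>

lemma GDERIV_grad:
  fixes h :: "'a::euclidean_space \<Rightarrow> real"
  assumes "h differentiable (at x)"
  shows "GDERIV h x :> grad h x"
proof -
  obtain h' where h': "(h has_derivative h') (at x)" using assms unfolding differentiable_def by blast
  define D where "D = (\<Sum>b\<in>Basis. h' b *\<^sub>R b)"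
  have lin: "linear h'" using h' has_derivative_linear by blast
  have "h' v = v \<bullet> D" for v
  proof -
    have "h' v = h' (\<Sum>b\<in>Basis. (v \<bullet> b) *\<^sub>R b)" by (simp add: euclidean_representation)
    also have "\<dots> = (\<Sum>b\<in>Basis. (v \<bullet> b) * h' b)" using lin by (simp add: linear_sum linear_scale)
    also have "\<dots> = v \<bullet> D" by (simp add: D_def inner_sum_right mult.commute)
    finally show ?thesis .
  qed
  then have "h' = (\<lambda>v. v \<bullet> D)" by auto
  then have D: "GDERIV h x :> D" using h' by (simp add: gderiv_def)
  have "E = D" if "GDERIV h x :> E" for E
  proof -
    have "(\<lambda>v. v \<bullet> E) = (\<lambda>v. v \<bullet> D)"
      using that D unfolding gderiv_def by (rule has_derivative_unique)
    then have "\<forall>v. v \<bullet> E = v \<bullet> D" by (simp add: fun_eq_iff)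
    then show ?thesis using vector_eq_ldot[of E D] by simp
  qed
  then show ?thesis unfolding grad_def using D by (rule theI[rotated])
qed

lemma C11_continuous_grad:
  assumes "C11 h"
  shows "continuous_on UNIV (grad h)"
proof -
  have "isCont (grad h) x" for x
  proof -
    obtain d L where "d > 0" "L-lipschitz_on (ball x d) (grad h)" using assms unfolding C11_def by blast
    then show ?thesis
      using lipschitz_on_continuous_on[of L "ball x d" "grad h"] continuous_on_eq_continuous_at[OF open_ball, of x d "grad h"]
      by simp
  qed
  then show ?thesis by (simp add: continuous_at_imp_continuous_on)
qed

lemma GDERIV_line:
  assumes "GDERIV h (x + t *\<^sub>R v) :> D"
  shows "((\<lambda>s. h (x + s *\<^sub>R v)) has_real_derivative (v \<bullet> D)) (at t)"
proof -
  have "((\<lambda>s. x + s *\<^sub>R v) has_derivative (\<lambda>s. s *\<^sub>R v)) (at t)"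
    by (auto intro!: derivative_eq_intros)
  then have "((\<lambda>s. h (x + s *\<^sub>R v)) has_derivative (\<lambda>s. (s *\<^sub>R v) \<bullet> D)) (at t)"
    using assms unfolding gderiv_def by (rule has_derivative_compose)
  moreover have "(\<lambda>s. (s *\<^sub>R v) \<bullet> D) = times (v \<bullet> D)" by (auto simp: fun_eq_iff)
  ultimately show ?thesis by (simp only: has_field_derivative_def)
qed

text \<open>Along the segment the derivative differs from its initial value by at most 2 m t |v|^2,
  which integrates to m |v|^2. Instead of integrating, the auxiliary functions \<open>p\<close> and
  \<open>q\<close> absorb this bound and are monotone on the unit interval.\<close>

lemma lipschitz_grad_taylor:
  fixes h :: "'a::euclidean_space \<Rightarrow> real"
  assumes der: "\<And>z. GDERIV h z :> D z" and lip: "(2 * m)-lipschitz_on S D"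
    and S: "convex S" "x \<in> S" "y \<in> S"
  shows "\<bar>h y - h x - D x \<bullet> (y - x)\<bar> \<le> m * (norm (y - x))\<^sup>2"
proof -
  define v where "v = y - x"
  have seg: "x + t *\<^sub>R v \<in> S" if "0 \<le> t" "t \<le> 1" for t
    using convexD_alt[OF S that] by (simp add: v_def algebra_simps)
  have d: "\<bar>v \<bullet> D (x + t *\<^sub>R v) - v \<bullet> D x\<bar> \<le> 2 * m * t * (norm v)\<^sup>2" if t: "0 \<le> t" "t \<le> 1" for t
  proof -
    have "\<bar>v \<bullet> (D (x + t *\<^sub>R v) - D x)\<bar> \<le> norm v * norm (D (x + t *\<^sub>R v) - D x)"
      by (rule Cauchy_Schwarz_ineq2)
    also have "\<dots> \<le> norm v * (2 * m * norm (x + t *\<^sub>R v - x))"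
      using lipschitz_on_normD[OF lip seg[OF t] S(2)] by (intro mult_left_mono) auto
    finally show ?thesis using t by (simp add: inner_diff_right power2_eq_square algebra_simps)
  qed
  have der1: "((\<lambda>t. h (x + t *\<^sub>R v)) has_real_derivative v \<bullet> D (x + t *\<^sub>R v)) (at t)" for t
    by (rule GDERIV_line[OF der])
  define p where "p = (\<lambda>t. h (x + t *\<^sub>R v) - t * (v \<bullet> D x) - m * t\<^sup>2 * (norm v)\<^sup>2)"
  define q where "q = (\<lambda>t. h (x + t *\<^sub>R v) - t * (v \<bullet> D x) + m * t\<^sup>2 * (norm v)\<^sup>2)"
  have "p 1 \<le> p 0"
  proof (rule DERIV_nonpos_imp_nonincreasing[of 0 1 p])
    fix t :: real assume t: "0 \<le> t" "t \<le> 1"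
    have "(p has_real_derivative v \<bullet> D (x + t *\<^sub>R v) - v \<bullet> D x - 2 * m * t * (norm v)\<^sup>2) (at t)"
      unfolding p_def by (auto intro!: derivative_eq_intros der1)
    then show "\<exists>z. (p has_real_derivative z) (at t) \<and> z \<le> 0"
      using d[OF t] by (fastforce simp: abs_le_iff)
  qed simp
  moreover have "q 0 \<le> q 1"
  proof (rule DERIV_nonneg_imp_nondecreasing[of 0 1 q])
    fix t :: real assume t: "0 \<le> t" "t \<le> 1"
    have "(q has_real_derivative v \<bullet> D (x + t *\<^sub>R v) - v \<bullet> D x + 2 * m * t * (norm v)\<^sup>2) (at t)"
      unfolding q_def by (auto intro!: derivative_eq_intros der1)
    then show "\<exists>z. (q has_real_derivative z) (at t) \<and> 0 \<le> z"
      using d[OF t] by (fastforce simp: abs_le_iff)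
  qed simp
  ultimately show ?thesis by (simp add: p_def q_def v_def abs_le_iff inner_commute)
qed

text \<open>The upper limit is never negative at a point of \<open>S\<close>: for
  \<open>y = c\<close> the quotient is a distance divided by \<open>t\<close>. So membership in the
  tangent cone only requires the upper estimate.\<close>

lemma clarke_tangent_coneI:
  assumes c: "c \<in> S"
    and le: "\<And>\<epsilon>. \<epsilon> > (0::real) \<Longrightarrow> \<exists>d>0. \<forall>y t. dist y c < d \<longrightarrow> 0 < t \<longrightarrow> t < d \<longrightarrow>
      infdist (y + t *\<^sub>R v) S \<le> infdist y S + \<epsilon> * t"
  shows "v \<in> clarke_tangent_cone S c"
proof -
  let ?F = "nhds c \<times>\<^sub>F at_right (0::real)"
  let ?q = "\<lambda>(y, t). ereal ((infdist (y + t *\<^sub>R v) S - infdist y S) / t)"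
  have "Limsup ?F ?q \<le> ereal \<epsilon>" if eps: "\<epsilon> > 0" for \<epsilon>
  proof (rule Limsup_bounded)
    obtain d where "d > 0" and d: "\<And>y t. dist y c < d \<Longrightarrow> 0 < t \<Longrightarrow> t < d \<Longrightarrow>
      infdist (y + t *\<^sub>R v) S \<le> infdist y S + \<epsilon> * t" using le[OF eps] by blast
    show "\<forall>\<^sub>F z in ?F. ?q z \<le> ereal \<epsilon>"
      unfolding eventually_prod_filter
    proof (intro exI conjI allI impI)
      show "\<forall>\<^sub>F y in nhds c. dist y c < d" using \<open>d > 0\<close> by (auto simp: eventually_nhds_metric)
      show "\<forall>\<^sub>F t in at_right 0. 0 < t \<and> t < d"
        using \<open>d > 0\<close> by (auto simp: eventually_at_right_field)
      show "?q (y, t) \<le> ereal \<epsilon>" if "dist y c < d" "0 < t \<and> t < d" for y t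
        using d[of y t] that by (simp add: divide_le_eq)
    qed
  qed
  then have "Limsup ?F ?q \<le> 0 + ereal \<epsilon>" if "0 < \<epsilon>" for \<epsilon>
    using that by simp
  then have "Limsup ?F ?q \<le> 0" by (rule ereal_le_epsilon2)
  moreover have "0 \<le> Limsup ?F ?q"
    unfolding Limsup_def
  proof (rule INF_greatest, clarify)
    fix P assume "eventually P ?F"
    then obtain Pf Pg where P: "eventually Pf (nhds c)" "eventually Pg (at_right (0::real))" "\<And>x y. Pf x \<Longrightarrow> Pg y \<Longrightarrow> P (x, y)"
      unfolding eventually_prod_filter by auto
    have "Pf c" using P(1) by (rule eventually_nhds_x_imp_x)
    obtain b where b: "b > 0" "\<And>t. 0 < t \<Longrightarrow> t < b \<Longrightarrow> Pg t" using P(2) unfolding eventually_at_right_field by blast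
    then have "P (c, b / 2)" using P(3) \<open>Pf c\<close> by auto
    moreover have "0 \<le> ?q (c, b / 2)" using c b(1) by (simp add: infdist_nonneg)
    ultimately show "0 \<le> (SUP x\<in>{x. P x}. ?q x)" by (intro SUP_upper2[of "(c, b / 2)"]) auto
  qed
  ultimately show ?thesis unfolding clarke_tangent_cone_def clarke_deriv_def by auto
qed

text \<open>Choosing the base point \<open>y = c\<close> in the upper limit turns a small distance
  to \<open>S\<close> into a nearby point of \<open>S\<close>; Clarke tangents are thus tangent in
  the sequential sense too.\<close>

lemma clarke_tangent_cone_approx:
  fixes v :: "'a::euclidean_space"
  assumes v: "v \<in> clarke_tangent_cone S c" and c: "c \<in> S" and "\<epsilon> > 0" "d > 0"
  obtains t w where "0 < t" "t < d" "norm w \<le> \<epsilon>" "c + t *\<^sub>R (v + w) \<in> S"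
proof -
  let ?F = "nhds c \<times>\<^sub>F at_right (0::real)"
  let ?q = "\<lambda>(y, t). ereal ((infdist (y + t *\<^sub>R v) S - infdist y S) / t)"
  have "Limsup ?F ?q < ereal \<epsilon>" using v \<open>\<epsilon> > 0\<close> by (simp add: clarke_tangent_cone_def clarke_deriv_def)
  then have "\<forall>\<^sub>F z in ?F. ?q z < ereal \<epsilon>" by (rule Limsup_lessD)
  then obtain Pf Pg where P: "eventually Pf (nhds c)" "eventually Pg (at_right (0::real))" "\<And>x y. Pf x \<Longrightarrow> Pg y \<Longrightarrow> ?q (x, y) < ereal \<epsilon>"
    unfolding eventually_prod_filter by auto
  have "Pf c" using P(1) by (rule eventually_nhds_x_imp_x)
  obtain b where b: "b > 0" "\<And>t. 0 < t \<Longrightarrow> t < b \<Longrightarrow> Pg t" using P(2) unfolding eventually_at_right_field by blast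
  define t where "t = min b d / 2"
  have t: "0 < t" "t < d" "t < b" using b \<open>d > 0\<close> by (auto simp: t_def)
  have "?q (c, t) < ereal \<epsilon>" using P(3)[OF \<open>Pf c\<close>] b(2) t by blast
  then have "infdist (c + t *\<^sub>R v) S < \<epsilon> * t" using c t by (simp add: divide_less_eq)
  then obtain y where y: "y \<in> S" "dist (c + t *\<^sub>R v) y < \<epsilon> * t"
  proof -
    have "S \<noteq> {}" using c by blast
    then have "(INF a\<in>S. dist (c + t *\<^sub>R v) a) < \<epsilon> * t"
      using \<open>infdist (c + t *\<^sub>R v) S < \<epsilon> * t\<close> by (simp add: infdist_notempty)
    then show thesis using that \<open>S \<noteq> {}\<close> by (auto simp: cINF_less_iff)
  qed
  define w where "w = (y - (c + t *\<^sub>R v)) /\<^sub>R t"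
  have "norm w \<le> \<epsilon>" using y(2) t by (simp add: w_def dist_norm norm_minus_commute divide_simps less_imp_le mult.commute)
  moreover have "c + t *\<^sub>R (v + w) = y" using t by (simp add: w_def algebra_simps)
  ultimately show thesis using that[of t w] t y by simp
qed

text \<open>For a displacement of order \<open>t\<close> inside \<open>S\<close> the quadratic bound
  is of order t^2, negligible against the linear term. Every proximal normal thus belongs to the
  polar of the Clarke tangent cone.\<close>

lemma proximal_normal_tangent_le:
  fixes \<zeta> :: "'a::euclidean_space"
  assumes prox: "\<And>y. y \<in> S \<Longrightarrow> \<zeta> \<bullet> (y - c) \<le> K * (norm (y - c))\<^sup>2" and "K \<ge> 0"
    and v: "v \<in> clarke_tangent_cone S c" and c: "c \<in> S"
  shows "\<zeta> \<bullet> v \<le> 0"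
proof (rule field_le_epsilon)
  fix e :: real assume "e > 0"
  define \<epsilon> where "\<epsilon> = e / (2 * (norm \<zeta> + 1))"
  have "\<epsilon> > 0" using \<open>e > 0\<close> by (simp add: \<epsilon>_def add_nonneg_pos)
  \<comment> \<open>Makes the quadratic term at most \<open>e / 2\<close>; the choice of \<epsilon>
    bounds the effect of the perturbation \<open>w\<close> by the other half.\<close>
  define d where "d = e / (2 * (K * (norm v + \<epsilon>)\<^sup>2 + 1))"
  have "K * (norm v + \<epsilon>)\<^sup>2 + 1 > 0" using \<open>K \<ge> 0\<close> by (simp add: add_nonneg_pos)
  then have "d > 0" using \<open>e > 0\<close> by (simp add: d_def)
  obtain t w where t: "0 < t" "t < d" "norm w \<le> \<epsilon>" "c + t *\<^sub>R (v + w) \<in> S"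
    using clarke_tangent_cone_approx[OF v c \<open>\<epsilon> > 0\<close> \<open>d > 0\<close>] by blast
  have "\<zeta> \<bullet> (t *\<^sub>R (v + w)) \<le> K * (norm (t *\<^sub>R (v + w)))\<^sup>2"
    using prox[OF t(4)] by (simp only: add_diff_cancel_left')
  then have "t * (\<zeta> \<bullet> (v + w)) \<le> K * (t\<^sup>2 * (norm (v + w))\<^sup>2)"
    by (simp only: inner_scaleR_right norm_scaleR power_mult_distrib power2_abs)
  also have "\<dots> = t * (t * (K * (norm (v + w))\<^sup>2))" by (simp add: power2_eq_square)
  finally have "t * (\<zeta> \<bullet> (v + w)) \<le> t * (t * (K * (norm (v + w))\<^sup>2))" .
  then have "\<zeta> \<bullet> (v + w) \<le> t * (K * (norm (v + w))\<^sup>2)" using t(1) by simp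
  then have 1: "\<zeta> \<bullet> (v + w) \<le> t * (K * (norm (v + w))\<^sup>2)" .
  have "norm (v + w) \<le> norm v + \<epsilon>" using norm_triangle_ineq[of v w] t(3) by linarith
  then have "K * (norm (v + w))\<^sup>2 \<le> K * (norm v + \<epsilon>)\<^sup>2 + 1"
    using \<open>K \<ge> 0\<close> by (smt (verit) mult_left_mono norm_ge_zero power_mono)
  then have "t * (K * (norm (v + w))\<^sup>2) \<le> d * (K * (norm v + \<epsilon>)\<^sup>2 + 1)"
    using t \<open>K \<ge> 0\<close> by (intro mult_mono) auto
  also have "\<dots> = e / 2" using \<open>K * (norm v + \<epsilon>)\<^sup>2 + 1 > 0\<close> by (simp add: d_def field_simps)
  finally have 2: "\<zeta> \<bullet> (v + w) \<le> e / 2" using 1 by linarith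
  have "- (\<zeta> \<bullet> w) \<le> norm \<zeta> * norm w" using Cauchy_Schwarz_ineq2[of \<zeta> w] by (simp add: abs_le_iff)
  also have "\<dots> \<le> (norm \<zeta> + 1) * \<epsilon>" using t(3) by (intro mult_mono) auto
  also have "\<dots> = e / 2" by (simp add: \<epsilon>_def divide_simps add_nonneg_eq_0_iff)
  finally show "\<zeta> \<bullet> v \<le> 0 + e" using 2 by (simp add: inner_add_right)
qed

lemma isCont_tendsto_nhds: "isCont g c \<Longrightarrow> (g \<longlongrightarrow> g c) (nhds c)"
  by (simp add: isCont_def tendsto_at_iff_tendsto_nhds)

text \<open>The combination is the point of the convex hull nearest to the origin: the obtuse-angle
  characterization of the projection of 0 gives the inequality for every generator.\<close>

lemma min_norm_convex_combination:
  fixes g :: "nat \<Rightarrow> 'a::euclidean_space"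
  assumes "finite A" "A \<noteq> {}"
  obtains l where "\<And>i. i \<in> A \<Longrightarrow> 0 \<le> l i" "sum l A = 1"
    "\<And>i. i \<in> A \<Longrightarrow> (norm (\<Sum>j\<in>A. l j *\<^sub>R g j))\<^sup>2 \<le> g i \<bullet> (\<Sum>j\<in>A. l j *\<^sub>R g j)"
proof -
  define S where "S = {\<Sum>j\<in>A. l j *\<^sub>R g j | l. (\<forall>i\<in>A. 0 \<le> l i) \<and> sum l A = 1}"
  have "convex S"
  proof (rule convexI)
    fix x y and u v :: real assume xy: "x \<in> S" "y \<in> S" and uv: "0 \<le> u" "0 \<le> v" "u + v = 1"
    from xy obtain l m where l: "x = (\<Sum>j\<in>A. l j *\<^sub>R g j)" "\<forall>i\<in>A. 0 \<le> l i" "sum l A = 1"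
      and m: "y = (\<Sum>j\<in>A. m j *\<^sub>R g j)" "\<forall>i\<in>A. 0 \<le> m i" "sum m A = 1" by (auto simp: S_def)
    show "u *\<^sub>R x + v *\<^sub>R y \<in> S" unfolding S_def
    proof (intro CollectI exI[of _ "\<lambda>j. u * l j + v * m j"] conjI ballI)
      show "u *\<^sub>R x + v *\<^sub>R y = (\<Sum>j\<in>A. (u * l j + v * m j) *\<^sub>R g j)"
        by (simp add: l m scaleR_sum_right sum.distrib scaleR_add_left)
      show "(\<Sum>j\<in>A. u * l j + v * m j) = 1"
        using l m uv by (simp add: sum.distrib sum_distrib_left[symmetric])
    qed (use l m uv in auto)
  qed
  moreover have "g ` A \<subseteq> S"
  proof clarify
    fix i assume "i \<in> A"
    then show "g i \<in> S" unfolding S_def using assms(1)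
      by (intro CollectI exI[of _ "\<lambda>j. if j = i then 1 else 0"]) (auto simp: if_distrib[of "\<lambda>a. a *\<^sub>R _"] sum.delta cong: if_cong)
  qed
  ultimately have sub: "convex hull (g ` A) \<subseteq> S" by (rule hull_minimal[rotated])
  define H where "H = convex hull (g ` A)"
  define w where "w = closest_point H 0"
  have "compact H" unfolding H_def using assms by (intro finite_imp_compact_convex_hull) simp
  have "convex H" "H \<noteq> {}" unfolding H_def using assms by auto
  then have w: "w \<in> H" unfolding w_def using \<open>compact H\<close> by (intro closest_point_in_set compact_imp_closed)
  then obtain l where l: "w = (\<Sum>j\<in>A. l j *\<^sub>R g j)" "\<forall>i\<in>A. 0 \<le> l i" "sum l A = 1"
    using sub by (auto simp: H_def S_def)
  have "(norm w)\<^sup>2 \<le> g i \<bullet> w" if "i \<in> A" for i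
  proof -
    have "g i \<in> H" using that by (simp add: H_def hull_inc)
    then have "(0 - w) \<bullet> (g i - w) \<le> 0"
      unfolding w_def using \<open>compact H\<close> \<open>convex H\<close> by (intro closest_point_dot) (auto intro: compact_imp_closed)
    then show ?thesis by (simp add: inner_diff_right power2_norm_eq_inner inner_commute)
  qed
  then show thesis using that[of l] l by auto
qed

section \<open>Regularity of the set cut out by the constraints\<close>

locale constraint_system =
  fixes r :: nat and \<psi> :: "nat \<Rightarrow> 'a::euclidean_space \<Rightarrow> real" and C :: "'a set" and \<eta> M\<psi> :: real
  assumes r_pos: "r \<ge> 1"
    and C_eq: "C = constr_set r \<psi>"
    and C_ne: "C \<noteq> {}"
    and psi_C11: "\<And>i. i \<in> {1..r} \<Longrightarrow> C11 (\<psi> i)"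
    and Ci_compact: "\<And>i. i \<in> {1..r} \<Longrightarrow> compact (sublevel (\<psi> i))"
    and eta_pos: "\<eta> > 0"
    and grad_bound: "\<And>c l. active r \<psi> c \<noteq> {} \<Longrightarrow> (\<And>i. i \<in> active r \<psi> c \<Longrightarrow> l i \<ge> 0) \<Longrightarrow>
          (\<Sum>i\<in>active r \<psi> c. l i) = 1 \<Longrightarrow>
          norm (\<Sum>i\<in>active r \<psi> c. l i *\<^sub>R grad (\<psi> i) c) > 2 * \<eta>"
    and Mpsi_pos: "M\<psi> > 0"
    and Mpsi_lip: "\<And>i. i \<in> {1..r} \<Longrightarrow> (2 * M\<psi>)-lipschitz_on (convex hull C) (grad (\<psi> i))"
begin

lemma gderiv_psi: "i \<in> {1..r} \<Longrightarrow> GDERIV (\<psi> i) x :> grad (\<psi> i) x"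
  using psi_C11 by (intro GDERIV_grad) (auto simp: C11_def)

lemma continuous_grad: "i \<in> {1..r} \<Longrightarrow> continuous_on UNIV (grad (\<psi> i))"
  using psi_C11 by (intro C11_continuous_grad)

lemma continuous_psi: "i \<in> {1..r} \<Longrightarrow> continuous_on UNIV (\<psi> i)"
  using gderiv_psi unfolding gderiv_def
  by (meson has_derivative_at_withinI has_derivative_continuous_on)

lemma mem_C_iff: "x \<in> C \<longleftrightarrow> (\<forall>i\<in>{1..r}. \<psi> i x \<le> 0)"
  by (simp add: C_eq constr_set_def sublevel_def)

lemma closed_C: "closed C"
  unfolding C_eq constr_set_def using Ci_compact by (intro closed_INT) (auto intro: compact_imp_closed)

lemma compact_C: "compact C"
proof -
  have "C \<subseteq> sublevel (\<psi> 1)" using r_pos by (auto simp: C_eq constr_set_def)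
  then show ?thesis using Ci_compact[of 1] r_pos closed_C closed_Int_compact[of C "sublevel (\<psi> 1)"]
    by (simp add: Int_absorb2)
qed

lemma finite_active [simp]: "finite (active r \<psi> c)" by (simp add: active_def)

text \<open>The Lipschitz constant of the gradients is taken on the convex hull because the segment
  between two points of \<open>C\<close> may leave \<open>C\<close>.\<close>

lemma psi_taylor:
  assumes "i \<in> {1..r}" "x \<in> C" "y \<in> C"
  shows "\<bar>\<psi> i y - \<psi> i x - grad (\<psi> i) x \<bullet> (y - x)\<bar> \<le> M\<psi> * (norm (y - x))\<^sup>2"
  using assms by (intro lipschitz_grad_taylor[OF gderiv_psi Mpsi_lip]) (auto simp: hull_inc)

text \<open>A bound on all convex combinations yields one direction that decreases every active
  constraint at a definite rate: the negative of the normalized shortest convex combination of the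
  active gradients.\<close>

lemma inward_vector:
  obtains v where "norm v \<le> 1" "\<And>i. i \<in> active r \<psi> c \<Longrightarrow> grad (\<psi> i) c \<bullet> v \<le> - 2 * \<eta>"
proof (cases "active r \<psi> c = {}")
  case True
  then show thesis using that[of 0] by auto
next
  case False
  obtain l where l: "\<And>i. i \<in> active r \<psi> c \<Longrightarrow> 0 \<le> l i" "sum l (active r \<psi> c) = 1"
    "\<And>i. i \<in> active r \<psi> c \<Longrightarrow> (norm (\<Sum>j\<in>active r \<psi> c. l j *\<^sub>R grad (\<psi> j) c))\<^sup>2
        \<le> grad (\<psi> i) c \<bullet> (\<Sum>j\<in>active r \<psi> c. l j *\<^sub>R grad (\<psi> j) c)"
    using min_norm_convex_combination[OF finite_active False, of "\<lambda>j. grad (\<psi> j) c"] by blast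
  define w where "w = (\<Sum>j\<in>active r \<psi> c. l j *\<^sub>R grad (\<psi> j) c)"
  have w: "norm w > 2 * \<eta>" unfolding w_def using l by (intro grad_bound False) auto
  then have "norm w > 0" using eta_pos by linarith
  have "grad (\<psi> i) c \<bullet> (- w /\<^sub>R norm w) \<le> - 2 * \<eta>" if "i \<in> active r \<psi> c" for i
  proof -
    have "(norm w)\<^sup>2 / norm w \<le> (grad (\<psi> i) c \<bullet> w) / norm w"
      using l(3)[OF that] by (intro divide_right_mono) (auto simp: w_def)
    then have "norm w \<le> (grad (\<psi> i) c \<bullet> w) / norm w" using \<open>norm w > 0\<close> by (simp add: power2_eq_square)
    then show ?thesis using w by (simp add: divide_inverse mult.commute)
  qed
  then show thesis using that[of "- w /\<^sub>R norm w"] \<open>norm w > 0\<close> by simp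
qed

text \<open>The step must stay in \<open>C\<close> for all base points \<open>p\<close> near
  \<open>c\<close>, not just for \<open>c\<close> itself, because the base point in the Clarke
  derivative moves.\<close>

lemma strictly_inward_stays:
  assumes c: "c \<in> C" and v: "\<And>i. i \<in> active r \<psi> c \<Longrightarrow> grad (\<psi> i) c \<bullet> v < 0"
  obtains e where "e > 0" "\<And>p t. p \<in> C \<Longrightarrow> dist p c < e \<Longrightarrow> 0 < t \<Longrightarrow> t < e \<Longrightarrow> p + t *\<^sub>R v \<in> C"
proof -
  have "\<forall>i\<in>{1..r}. \<forall>\<^sub>F z in nhds c. (i \<in> active r \<psi> c \<longrightarrow> grad (\<psi> i) z \<bullet> v < 0) \<and> (i \<notin> active r \<psi> c \<longrightarrow> \<psi> i z < 0)"
  proof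
    fix i assume i: "i \<in> {1..r}"
    show "\<forall>\<^sub>F z in nhds c. (i \<in> active r \<psi> c \<longrightarrow> grad (\<psi> i) z \<bullet> v < 0) \<and> (i \<notin> active r \<psi> c \<longrightarrow> \<psi> i z < 0)"
    proof (cases "i \<in> active r \<psi> c")
      case True
      have "isCont (\<lambda>z. grad (\<psi> i) z \<bullet> v) c"
        using continuous_grad[OF i] by (intro continuous_intros) (simp add: continuous_on_eq_continuous_at)
      then have "((\<lambda>z. grad (\<psi> i) z \<bullet> v) \<longlongrightarrow> grad (\<psi> i) c \<bullet> v) (nhds c)" by (rule isCont_tendsto_nhds)
      then have "\<forall>\<^sub>F z in nhds c. grad (\<psi> i) z \<bullet> v < 0" using v[OF True] by (rule order_tendstoD(2))
      then show ?thesis using True by simp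
    next
      case False
      then have "\<psi> i c < 0" using c i by (force simp: mem_C_iff active_def less_le)
      moreover have "(\<psi> i \<longlongrightarrow> \<psi> i c) (nhds c)"
        using continuous_psi[OF i] by (intro isCont_tendsto_nhds) (simp add: continuous_on_eq_continuous_at)
      ultimately have "\<forall>\<^sub>F z in nhds c. \<psi> i z < 0" by (rule order_tendstoD(2)[rotated])
      then show ?thesis using False by simp
    qed
  qed
  then have "\<forall>\<^sub>F z in nhds c. \<forall>i\<in>{1..r}. (i \<in> active r \<psi> c \<longrightarrow> grad (\<psi> i) z \<bullet> v < 0) \<and> (i \<notin> active r \<psi> c \<longrightarrow> \<psi> i z < 0)"
    by (intro eventually_ball_finite) auto
  then obtain e' where "e' > 0" and e': "\<And>z i. dist z c < e' \<Longrightarrow> i \<in> {1..r} \<Longrightarrow>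
      (i \<in> active r \<psi> c \<longrightarrow> grad (\<psi> i) z \<bullet> v < 0) \<and> (i \<notin> active r \<psi> c \<longrightarrow> \<psi> i z < 0)"
    unfolding eventually_nhds_metric by blast
  \<comment> \<open>Shrunk so that the offset of the base point and a step of length at most
    \<open>e * norm v\<close> together fit into the radius \<open>e'\<close>.\<close>
  define e where "e = e' / (1 + norm v)"
  have nv: "1 + norm v > 0" by (simp add: add_pos_nonneg)
  have "e > 0" using \<open>e' > 0\<close> nv by (simp add: e_def)
  have near: "dist (p + s *\<^sub>R v) c < e'" if "dist p c < e" "0 \<le> s" "s < e" for p s
  proof -
    have "dist (p + s *\<^sub>R v) c \<le> dist p c + s * norm v"
      using norm_triangle_ineq[of "p - c" "s *\<^sub>R v"] that by (simp add: dist_norm algebra_simps)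
    also have "\<dots> < e + e * norm v" using that by (intro add_less_le_mono mult_right_mono) auto
    also have "\<dots> = e * (1 + norm v)" by (simp add: algebra_simps)
    also have "\<dots> = e'" using nv by (simp add: e_def)
    finally show ?thesis .
  qed
  have "p + t *\<^sub>R v \<in> C" if p: "p \<in> C" "dist p c < e" "0 < t" "t < e" for p t
    unfolding mem_C_iff
  proof
    fix i assume i: "i \<in> {1..r}"
    show "\<psi> i (p + t *\<^sub>R v) \<le> 0"
    proof (cases "i \<in> active r \<psi> c")
      case True
      have "\<psi> i (p + t *\<^sub>R v) \<le> \<psi> i (p + 0 *\<^sub>R v)"
      proof (rule DERIV_nonpos_imp_nonincreasing[of 0 t "\<lambda>s. \<psi> i (p + s *\<^sub>R v)"])
        fix s assume "0 \<le> s" "s \<le> t"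
        then have "v \<bullet> grad (\<psi> i) (p + s *\<^sub>R v) \<le> 0"
          using e'[OF near[OF p(2)], of s i] p(4) i True by (simp add: inner_commute)
        then show "\<exists>y. ((\<lambda>s. \<psi> i (p + s *\<^sub>R v)) has_real_derivative y) (at s) \<and> y \<le> 0"
          using GDERIV_line[OF gderiv_psi[OF i]] by blast
      qed (use p in auto)
      moreover have "\<psi> i p \<le> 0" using p(1) i mem_C_iff by blast
      ultimately show ?thesis by simp
    next
      case False
      then show ?thesis using e'[OF near[OF p(2)], of t i] p i by simp
    qed
  qed
  then show thesis using that[OF \<open>e > 0\<close>] by blast
qed

text \<open>One inclusion holds because each active gradient is a proximal normal by the Taylor
  estimate. For the other, a small multiple of the common inward vector makes \<open>v\<close>
  strictly inward; a step from a point \<open>y\<close> off \<open>C\<close> is then compared with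
  the perturbed step from the nearest point of \<open>y\<close> in \<open>C\<close>.\<close>

lemma clarke_tangent_cone_eq:
  assumes c: "c \<in> C"
  shows "clarke_tangent_cone C c = {v. \<forall>i\<in>active r \<psi> c. grad (\<psi> i) c \<bullet> v \<le> 0}"
proof (intro subset_antisym subsetI)
  fix v assume v: "v \<in> clarke_tangent_cone C c"
  have "grad (\<psi> i) c \<bullet> v \<le> 0" if i: "i \<in> active r \<psi> c" for i
  proof (rule proximal_normal_tangent_le[OF _ _ v c])
    show "M\<psi> \<ge> 0" using Mpsi_pos by simp
    fix y assume "y \<in> C"
    have i': "i \<in> {1..r}" "\<psi> i c = 0" using i by (auto simp: active_def)
    have "\<bar>\<psi> i y - \<psi> i c - grad (\<psi> i) c \<bullet> (y - c)\<bar> \<le> M\<psi> * (norm (y - c))\<^sup>2"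
      by (rule psi_taylor[OF i'(1) c \<open>y \<in> C\<close>])
    moreover have "\<psi> i y \<le> 0" using \<open>y \<in> C\<close> i' mem_C_iff by blast
    ultimately show "grad (\<psi> i) c \<bullet> (y - c) \<le> M\<psi> * (norm (y - c))\<^sup>2" using i' by (simp add: abs_le_iff)
  qed
  then show "v \<in> {v. \<forall>i\<in>active r \<psi> c. grad (\<psi> i) c \<bullet> v \<le> 0}" by blast
next
  fix v assume v: "v \<in> {v. \<forall>i\<in>active r \<psi> c. grad (\<psi> i) c \<bullet> v \<le> 0}"
  obtain v0 where v0: "norm v0 \<le> 1" "\<And>i. i \<in> active r \<psi> c \<Longrightarrow> grad (\<psi> i) c \<bullet> v0 \<le> - 2 * \<eta>"
    using inward_vector by blast
  show "v \<in> clarke_tangent_cone C c"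
  proof (rule clarke_tangent_coneI[OF c])
    fix \<epsilon> :: real assume "\<epsilon> > 0"
    define w where "w = v + \<epsilon> *\<^sub>R v0"
    have "grad (\<psi> i) c \<bullet> w < 0" if "i \<in> active r \<psi> c" for i
    proof -
      have "\<epsilon> * (grad (\<psi> i) c \<bullet> v0) < 0" using v0(2)[OF that] \<open>\<epsilon> > 0\<close> eta_pos by (intro mult_pos_neg) auto
      moreover have "grad (\<psi> i) c \<bullet> v \<le> 0" using v that by blast
      ultimately show ?thesis by (simp add: w_def inner_add_right)
    qed
    then obtain e where "e > 0" and e: "\<And>p t. p \<in> C \<Longrightarrow> dist p c < e \<Longrightarrow> 0 < t \<Longrightarrow> t < e \<Longrightarrow> p + t *\<^sub>R w \<in> C"
      using strictly_inward_stays[OF c] by blast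
    have "infdist (y + t *\<^sub>R v) C \<le> infdist y C + \<epsilon> * t" if y: "dist y c < e / 2" and t: "0 < t" "t < e / 2" for y t
    proof -
      obtain p where p: "p \<in> C" "infdist y C = dist y p" using infdist_attains_inf[OF closed_C C_ne] by metis
      \<comment> \<open>As \<open>c\<close> is itself a competitor in \<open>C\<close>, the nearest
        point \<open>p\<close> lies within twice the distance from \<open>y\<close> to
        \<open>c\<close> of the point \<open>c\<close>.\<close>
      have "dist y p \<le> dist y c" using infdist_le[OF c, of y] p(2) by simp
      then have "dist p c < e" using dist_triangle[of p c y] y by (simp add: dist_commute)
      then have "p + t *\<^sub>R w \<in> C" using e[OF p(1)] t \<open>e > 0\<close> by simp
      then have "infdist (y + t *\<^sub>R v) C \<le> dist (y + t *\<^sub>R v) (p + t *\<^sub>R w)" by (rule infdist_le)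
      also have "\<dots> = norm ((y - p) - (t * \<epsilon>) *\<^sub>R v0)" by (simp add: dist_norm w_def algebra_simps)
      also have "\<dots> \<le> norm (y - p) + (t * \<epsilon>) * norm v0"
        using norm_triangle_ineq4[of "y - p" "(t * \<epsilon>) *\<^sub>R v0"] t \<open>\<epsilon> > 0\<close> by simp
      also have "\<dots> \<le> norm (y - p) + (t * \<epsilon>) * 1" using v0(1) t \<open>\<epsilon> > 0\<close> by (intro add_left_mono mult_left_mono) auto
      finally show ?thesis using p(2) by (simp add: dist_norm mult.commute)
    qed
    then show "\<exists>d>0. \<forall>y t. dist y c < d \<longrightarrow> 0 < t \<longrightarrow> t < d \<longrightarrow> infdist (y + t *\<^sub>R v) C \<le> infdist y C + \<epsilon> * t"
      using \<open>e > 0\<close> by (intro exI[of _ "e / 2"]) auto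
  qed
qed

text \<open>Quantitative prox-regularity. The chord \<open>y - c\<close> becomes a tangent vector
  after adding \<open>s\<close> times the inward vector, with \<open>s\<close> of second order, and
  testing \<zeta> against it gives the inequality; conversely, proximal normals are Clarke normals.
  In this form the cone is closed under limits in both the point and the normal.\<close>

lemma clarke_normal_cone_iff:
  assumes c: "c \<in> C"
  shows "\<zeta> \<in> clarke_normal_cone C c \<longleftrightarrow> (\<forall>y\<in>C. \<zeta> \<bullet> (y - c) \<le> (M\<psi> / (2 * \<eta>)) * norm \<zeta> * (norm (y - c))\<^sup>2)"
proof
  assume z: "\<zeta> \<in> clarke_normal_cone C c"
  obtain v0 where v0: "norm v0 \<le> 1" "\<And>i. i \<in> active r \<psi> c \<Longrightarrow> grad (\<psi> i) c \<bullet> v0 \<le> - 2 * \<eta>"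
    using inward_vector by blast
  show "\<forall>y\<in>C. \<zeta> \<bullet> (y - c) \<le> (M\<psi> / (2 * \<eta>)) * norm \<zeta> * (norm (y - c))\<^sup>2"
  proof
    fix y assume y: "y \<in> C"
    \<comment> \<open>Just large enough for the rate \<open>2 * \<eta>\<close> of the inward vector
      to cancel the Taylor remainder.\<close>
    define s where "s = M\<psi> * (norm (y - c))\<^sup>2 / (2 * \<eta>)"
    have "s \<ge> 0" using Mpsi_pos eta_pos by (simp add: s_def)
    have "y - c + s *\<^sub>R v0 \<in> clarke_tangent_cone C c"
      unfolding clarke_tangent_cone_eq[OF c]
    proof (intro CollectI ballI)
      fix i assume i: "i \<in> active r \<psi> c"
      then have i': "i \<in> {1..r}" "\<psi> i c = 0" by (auto simp: active_def)
      have "\<bar>\<psi> i y - \<psi> i c - grad (\<psi> i) c \<bullet> (y - c)\<bar> \<le> M\<psi> * (norm (y - c))\<^sup>2"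
        by (rule psi_taylor[OF i'(1) c y])
      moreover have "\<psi> i y \<le> 0" using y i' mem_C_iff by blast
      ultimately have "grad (\<psi> i) c \<bullet> (y - c) \<le> M\<psi> * (norm (y - c))\<^sup>2" using i' by (simp add: abs_le_iff)
      also have "\<dots> = s * (2 * \<eta>)" using eta_pos by (simp add: s_def)
      finally have "grad (\<psi> i) c \<bullet> (y - c) \<le> s * (2 * \<eta>)" .
      moreover have "s * (grad (\<psi> i) c \<bullet> v0) \<le> s * (- 2 * \<eta>)"
        using v0(2)[OF i] \<open>s \<ge> 0\<close> by (rule mult_left_mono)
      ultimately show "grad (\<psi> i) c \<bullet> (y - c + s *\<^sub>R v0) \<le> 0" by (simp add: inner_add_right)
    qed
    then have "\<zeta> \<bullet> (y - c + s *\<^sub>R v0) \<le> 0" using z c by (auto simp: clarke_normal_cone_def)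
    then have "\<zeta> \<bullet> (y - c) \<le> s * (- (\<zeta> \<bullet> v0))" by (simp add: inner_add_right)
    also have "\<dots> \<le> s * (norm \<zeta> * norm v0)"
      using Cauchy_Schwarz_ineq2[of \<zeta> v0] \<open>s \<ge> 0\<close> by (intro mult_left_mono) (auto simp: abs_le_iff)
    also have "\<dots> \<le> s * (norm \<zeta> * 1)" using v0(1) \<open>s \<ge> 0\<close> by (intro mult_left_mono) auto
    also have "\<dots> = (M\<psi> / (2 * \<eta>)) * norm \<zeta> * (norm (y - c))\<^sup>2" by (simp add: s_def)
    finally show "\<zeta> \<bullet> (y - c) \<le> (M\<psi> / (2 * \<eta>)) * norm \<zeta> * (norm (y - c))\<^sup>2" .
  qed
next
  assume "\<forall>y\<in>C. \<zeta> \<bullet> (y - c) \<le> (M\<psi> / (2 * \<eta>)) * norm \<zeta> * (norm (y - c))\<^sup>2"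
  then have "\<zeta> \<bullet> v \<le> 0" if "v \<in> clarke_tangent_cone C c" for v
    using Mpsi_pos eta_pos by (intro proximal_normal_tangent_le[OF _ _ that c, of _ "(M\<psi> / (2 * \<eta>)) * norm \<zeta>"]) auto
  then show "\<zeta> \<in> clarke_normal_cone C c" using c by (auto simp: clarke_normal_cone_def)
qed

text \<open>Near each point of \<open>C\<close> one vector works for all constraints that are almost
  active, and a finite subcover makes the margin \<delta> uniform. Continuity of the gradients costs
  half of the rate \<open>2 * \<eta>\<close>.\<close>

lemma uniform_inward_vector:
  obtains \<delta> where "\<delta> > 0"
    "\<And>y. y \<in> C \<Longrightarrow> \<exists>v. norm v \<le> 1 \<and> (\<forall>i\<in>{1..r}. \<psi> i y \<ge> - \<delta> \<longrightarrow> grad (\<psi> i) y \<bullet> v \<le> - \<eta>)"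
proof -
  have "\<exists>e d v. e > 0 \<and> d > 0 \<and> norm v \<le> 1 \<and> (\<forall>y i. dist y c < e \<longrightarrow> i \<in> {1..r} \<longrightarrow> \<psi> i y \<ge> - d \<longrightarrow> grad (\<psi> i) y \<bullet> v \<le> - \<eta>)"
    if c: "c \<in> C" for c
  proof -
    obtain v where v: "norm v \<le> 1" "\<And>i. i \<in> active r \<psi> c \<Longrightarrow> grad (\<psi> i) c \<bullet> v \<le> - 2 * \<eta>"
      using inward_vector by blast
    have "\<forall>\<^sub>F d in at_right 0. \<forall>i\<in>{1..r}. i \<notin> active r \<psi> c \<longrightarrow> d < - \<psi> i c"
    proof (intro eventually_ball_finite ballI)
      fix i assume i: "i \<in> {1..r}"
      show "\<forall>\<^sub>F d in at_right 0. i \<notin> active r \<psi> c \<longrightarrow> d < - \<psi> i c"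
      proof (cases "i \<in> active r \<psi> c")
        case False
        then have "0 < - \<psi> i c" using c i by (force simp: mem_C_iff active_def less_le)
        then show ?thesis unfolding eventually_at_right_field by (intro exI[of _ "- \<psi> i c"]) simp
      qed auto
    qed auto
    moreover have "\<forall>\<^sub>F d in at_right 0. d > (0::real)" by (rule eventually_at_right_less)
    ultimately have "\<forall>\<^sub>F d in at_right 0. d > 0 \<and> (\<forall>i\<in>{1..r}. i \<notin> active r \<psi> c \<longrightarrow> d < - \<psi> i c)"
      by eventually_elim simp
    then obtain d where d0: "d > 0" and d1: "\<And>i. i \<in> {1..r} \<Longrightarrow> i \<notin> active r \<psi> c \<Longrightarrow> d < - \<psi> i c"
      by (force dest: eventually_happens)
    have d: "d > 0" "\<And>i. i \<in> {1..r} \<Longrightarrow> i \<notin> active r \<psi> c \<Longrightarrow> \<psi> i c < - d"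
      using d0 d1 by force+
    have "\<forall>\<^sub>F z in nhds c. \<forall>i\<in>{1..r}. \<psi> i z \<ge> - d \<longrightarrow> grad (\<psi> i) z \<bullet> v \<le> - \<eta>"
    proof (intro eventually_ball_finite ballI)
      fix i assume i: "i \<in> {1..r}"
      show "\<forall>\<^sub>F z in nhds c. \<psi> i z \<ge> - d \<longrightarrow> grad (\<psi> i) z \<bullet> v \<le> - \<eta>"
      proof (cases "i \<in> active r \<psi> c")
        case True
        have "isCont (\<lambda>z. grad (\<psi> i) z \<bullet> v) c"
          using continuous_grad[OF i] by (intro continuous_intros) (simp add: continuous_on_eq_continuous_at)
        then have "((\<lambda>z. grad (\<psi> i) z \<bullet> v) \<longlongrightarrow> grad (\<psi> i) c \<bullet> v) (nhds c)" by (rule isCont_tendsto_nhds)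
        moreover have "grad (\<psi> i) c \<bullet> v < - \<eta>" using v(2)[OF True] eta_pos by linarith
        ultimately have "\<forall>\<^sub>F z in nhds c. grad (\<psi> i) z \<bullet> v < - \<eta>" by (rule order_tendstoD(2))
        then show ?thesis by eventually_elim simp
      next
        case False
        have "(\<psi> i \<longlongrightarrow> \<psi> i c) (nhds c)"
          using continuous_psi[OF i] by (intro isCont_tendsto_nhds) (simp add: continuous_on_eq_continuous_at)
        then have "\<forall>\<^sub>F z in nhds c. \<psi> i z < - d" using d(2)[OF i False] by (rule order_tendstoD(2))
        then show ?thesis by eventually_elim simp
      qed
    qed auto
    then obtain e where "e > 0" "\<And>z. dist z c < e \<Longrightarrow> \<forall>i\<in>{1..r}. \<psi> i z \<ge> - d \<longrightarrow> grad (\<psi> i) z \<bullet> v \<le> - \<eta>"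
      unfolding eventually_nhds_metric by blast
    then show ?thesis using d(1) v(1) by blast
  qed
  then obtain e d v where edv: "\<And>c. c \<in> C \<Longrightarrow> e c > 0 \<and> d c > 0 \<and> norm (v c) \<le> 1"
    "\<And>c y i. c \<in> C \<Longrightarrow> dist y c < e c \<Longrightarrow> i \<in> {1..r} \<Longrightarrow> \<psi> i y \<ge> - d c \<Longrightarrow> grad (\<psi> i) y \<bullet> v c \<le> - \<eta>"
    by metis
  have "C \<subseteq> (\<Union>c\<in>C. ball c (e c))" using edv(1) by force
  then obtain D where D: "D \<subseteq> C" "finite D" "C \<subseteq> (\<Union>c\<in>D. ball c (e c))"
    using compactE_image[OF compact_C, of C "\<lambda>c. ball c (e c)"] by auto
  have "D \<noteq> {}" using D C_ne by auto
  define \<delta> where "\<delta> = Min (d ` D)"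
  have "\<delta> > 0" unfolding \<delta>_def using D \<open>D \<noteq> {}\<close> edv(1) by (subst Min_gr_iff) auto
  moreover have "\<exists>v. norm v \<le> 1 \<and> (\<forall>i\<in>{1..r}. \<psi> i y \<ge> - \<delta> \<longrightarrow> grad (\<psi> i) y \<bullet> v \<le> - \<eta>)" if "y \<in> C" for y
  proof -
    have "y \<in> (\<Union>c\<in>D. ball c (e c))" using D that by blast
    then obtain c where c: "c \<in> D" "dist y c < e c" by (auto simp: dist_commute)
    have "\<delta> \<le> d c" unfolding \<delta>_def using c D by (intro Min_le) auto
    then show ?thesis using edv(1)[of c] edv(2)[of c y] c D(1) by (intro exI[of _ "v c"] conjI ballI impI) auto
  qed
  ultimately show thesis using that by blast
qed

text \<open>Moving against the inward vector would raise an active constraint above 0 while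
  remaining in the interior. Hence a point with an active constraint falls under the shifted case of
  \<open>initial_approx\<close>.\<close>

lemma psi_neg_interior:
  assumes "c \<in> interior C" "i \<in> {1..r}"
  shows "\<psi> i c < 0"
proof (rule ccontr)
  assume "\<not> \<psi> i c < 0"
  moreover have "c \<in> C" using assms interior_subset by blast
  ultimately have "\<psi> i c = 0" using assms(2) mem_C_iff by force
  then have i: "i \<in> active r \<psi> c" using assms by (simp add: active_def)
  obtain v where v: "norm v \<le> 1" "\<And>i. i \<in> active r \<psi> c \<Longrightarrow> grad (\<psi> i) c \<bullet> v \<le> - 2 * \<eta>"
    using inward_vector by blast
  have "((\<lambda>s. \<psi> i (c + s *\<^sub>R (- v))) has_real_derivative ((- v) \<bullet> grad (\<psi> i) (c + 0 *\<^sub>R (- v)))) (at 0)"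
    by (rule GDERIV_line[OF gderiv_psi[OF assms(2)]])
  moreover have "(- v) \<bullet> grad (\<psi> i) (c + 0 *\<^sub>R (- v)) > 0" using v(2)[OF i] eta_pos by (simp add: inner_commute)
  ultimately obtain d where d: "d > 0" "\<And>h. 0 < h \<Longrightarrow> h < d \<Longrightarrow> \<psi> i (c + 0 *\<^sub>R (- v)) < \<psi> i (c + (0 + h) *\<^sub>R (- v))"
    using DERIV_pos_inc_right by blast
  obtain e where e: "e > 0" "ball c e \<subseteq> C" using assms(1) mem_interior by blast
  define h where "h = min d e / 2"
  have h: "0 < h" "h < d" "h < e" using d(1) e(1) by (auto simp: h_def)
  have "h * norm v \<le> h * 1" using v(1) h by (intro mult_left_mono) auto
  then have "h * norm v < e" using h by linarith
  then have "c + h *\<^sub>R (- v) \<in> ball c e" using h by (simp add: dist_norm)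
  then have "\<psi> i (c + h *\<^sub>R (- v)) \<le> 0" using e(2) assms(2) mem_C_iff by blast
  then show False using d(2)[OF h(1,2)] \<open>\<psi> i c = 0\<close> by simp
qed

text \<open>Projection onto a closed convex cone leaves a residual orthogonal to the projection, so
  a gradient has product - |p|^2 with the projection p of its negative. This p is nonzero, because
  the negative gradient has a positive product with the tangent vector \<open>v0\<close>. The
  remaining projections, being tangent, contribute nothing positive.\<close>

lemma inward_dir_strict:
  assumes c: "c \<in> C" and i: "i \<in> active r \<psi> c"
  shows "grad (\<psi> i) c \<bullet> inward_dir r \<psi> c < 0"
proof -
  define Tc where "Tc = clarke_tangent_cone C c"
  have Teq: "Tc = {v. \<forall>i\<in>active r \<psi> c. grad (\<psi> i) c \<bullet> v \<le> 0}" unfolding Tc_def by (rule clarke_tangent_cone_eq[OF c])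
  also have "\<dots> = (\<Inter>i\<in>active r \<psi> c. {v. grad (\<psi> i) c \<bullet> v \<le> 0})" by auto
  finally have "closed Tc" "convex Tc"
    by (auto intro!: closed_INT convex_INT closed_halfspace_le convex_halfspace_le)
  have "0 \<in> Tc" by (simp add: Teq)
  obtain v0 where v0: "\<And>i. i \<in> active r \<psi> c \<Longrightarrow> grad (\<psi> i) c \<bullet> v0 \<le> - 2 * \<eta>" using inward_vector by blast
  have "v0 \<in> Tc" using v0 eta_pos by (force simp: Teq)
  define p where "p = (\<lambda>j. closest_point Tc (- grad (\<psi> j) c))"
  have pT: "p j \<in> Tc" for j unfolding p_def using \<open>closed Tc\<close> \<open>0 \<in> Tc\<close> by (intro closest_point_in_set) auto
  have dot: "(- grad (\<psi> j) c - p j) \<bullet> (x - p j) \<le> 0" if "x \<in> Tc" for x j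
    unfolding p_def by (rule closest_point_dot[OF \<open>convex Tc\<close> \<open>closed Tc\<close> that])
  \<comment> \<open>\<open>Tc\<close> is a convex cone, so the projection inequality may be tested
    at \<open>p j + z\<close>; this puts the residual into the polar cone.\<close>
  have polar: "(- grad (\<psi> j) c - p j) \<bullet> z \<le> 0" if "z \<in> Tc" for z j
  proof -
    have "p j + z \<in> Tc" using pT[of j] that by (simp add: Teq inner_add_right add_nonpos_nonpos)
    then show ?thesis using dot[of "p j + z" j] by simp
  qed
  have "grad (\<psi> j) c \<bullet> p j = - (norm (p j))\<^sup>2" for j
    using dot[OF \<open>0 \<in> Tc\<close>, of j] polar[OF pT[of j], of j] by (simp add: inner_diff_left power2_norm_eq_inner)
  moreover have "p i \<noteq> 0"
    using polar[OF \<open>v0 \<in> Tc\<close>, of i] v0[OF i] eta_pos by auto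
  ultimately have "grad (\<psi> i) c \<bullet> p i < 0" by simp
  moreover have "grad (\<psi> i) c \<bullet> p j \<le> 0" for j using pT[of j] i by (simp add: Teq)
  ultimately have "(\<Sum>j\<in>active r \<psi> c. grad (\<psi> i) c \<bullet> p j) < (\<Sum>j\<in>active r \<psi> c. 0)"
    using i by (intro sum_strict_mono_ex1) auto
  moreover have "inward_dir r \<psi> c = (\<Sum>j\<in>active r \<psi> c. p j)"
    unfolding inward_dir_def p_def Tc_def C_eq ..
  ultimately show ?thesis by (simp add: inner_sum_right)
qed

end

subsection \<open>Penalized trajectories\<close>

locale sweeping_control = constraint_system r \<psi> C \<eta> M\<psi>
  for r and \<psi> :: "nat \<Rightarrow> 'a::euclidean_space \<Rightarrow> real" and C \<eta> M\<psi> +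
  fixes T M :: real and f :: "'a \<Rightarrow> 'b::euclidean_space \<Rightarrow> 'a" and U :: "'b set"
  assumes T_pos: "T > 0"
    and U_ne: "U \<noteq> {}"
    and f_cont: "continuous_on (C \<times> U) (\<lambda>(x, u). f x u)"
    and M_pos: "M > 0"
    and f_lip: "\<And>u. u \<in> U \<Longrightarrow> M-lipschitz_on C (\<lambda>x. f x u)"
    and f_bound: "\<And>x u. x \<in> C \<Longrightarrow> u \<in> U \<Longrightarrow> norm (f x u) \<le> M"
    and f_convex: "\<And>x. convex (f x ` U)"
    and U_compact: "compact U"
begin

definition phi :: "real \<Rightarrow> 'a \<Rightarrow> real" where
  "phi \<gamma> x = (\<Sum>i\<in>{1..r}. exp (\<gamma> * \<psi> i x))"

text \<open>Normalized so that \<open>\<gamma> *\<^sub>R G \<gamma> x\<close> is at once the penalty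
  drift and the gradient of \<open>phi \<gamma>\<close>: the penalized system is a gradient descent
  for \<open>phi \<gamma>\<close> perturbed by \<open>f\<close>.\<close>

definition G :: "real \<Rightarrow> 'a \<Rightarrow> 'a" where
  "G \<gamma> x = (\<Sum>i\<in>{1..r}. exp (\<gamma> * \<psi> i x) *\<^sub>R grad (\<psi> i) x)"

text \<open>The state equation is only required while \<open>x\<close> lies in \<open>C\<close>: this makes the invariance
  of \<open>C\<close> applicable to solutions of extensions of the vector field from \<open>C\<close>.\<close>

definition pen_sol :: "real \<Rightarrow> (real \<Rightarrow> 'b) \<Rightarrow> (real \<Rightarrow> 'a) \<Rightarrow> bool" where
  "pen_sol \<gamma> u x \<longleftrightarrow> abs_cont_on 0 T x \<and> (\<exists>N. negligible N \<and> (\<forall>t\<in>{0..T} - N. u t \<in> U \<and>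
     (x t \<in> C \<longrightarrow> (x has_vector_derivative (f (x t) (u t) - \<gamma> *\<^sub>R G \<gamma> (x t))) (at t within {0..T}))))"

lemma drift_eq: "(\<Sum>i\<in>{1..r}. (\<gamma> * exp (\<gamma> * \<psi> i x)) *\<^sub>R grad (\<psi> i) x) = \<gamma> *\<^sub>R G \<gamma> x"
  by (simp add: G_def scaleR_sum_right)

lemma phi_pos: "phi \<gamma> x > 0"
  unfolding phi_def using r_pos by (intro sum_pos) auto

lemma exp_le_phi: "i \<in> {1..r} \<Longrightarrow> exp (\<gamma> * \<psi> i x) \<le> phi \<gamma> x"
  unfolding phi_def by (intro member_le_sum) auto

lemma phi_le_1_imp_C:
  assumes "\<gamma> > 0" "phi \<gamma> x \<le> 1"
  shows "x \<in> C"
  unfolding mem_C_iff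
proof
  fix i assume "i \<in> {1..r}"
  then have "exp (\<gamma> * \<psi> i x) \<le> 1" using exp_le_phi[of i \<gamma> x] assms(2) by linarith
  then show "\<psi> i x \<le> 0" using assms(1) by (simp add: mult_le_0_iff)
qed

lemma gderiv_phi: "GDERIV (phi \<gamma>) x :> \<gamma> *\<^sub>R G \<gamma> x"
proof -
  have "((\<lambda>x. exp (\<gamma> * \<psi> i x)) has_derivative (\<lambda>h. h \<bullet> (\<gamma> *\<^sub>R (exp (\<gamma> * \<psi> i x) *\<^sub>R grad (\<psi> i) x)))) (at x)"
    if "i \<in> {1..r}" for i
    using gderiv_psi[OF that, of x] unfolding gderiv_def by (auto intro!: derivative_eq_intros)
  then have "((\<lambda>x. \<Sum>i\<in>{1..r}. exp (\<gamma> * \<psi> i x)) has_derivative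
      (\<lambda>h. \<Sum>i\<in>{1..r}. h \<bullet> (\<gamma> *\<^sub>R (exp (\<gamma> * \<psi> i x) *\<^sub>R grad (\<psi> i) x)))) (at x)"
    by (intro has_derivative_sum)
  then show ?thesis unfolding gderiv_def phi_def[abs_def] G_def
    by (simp only: scaleR_sum_right inner_sum_right)
qed

lemma continuous_phi: "continuous_on UNIV (phi \<gamma>)"
  unfolding phi_def[abs_def] using continuous_psi by (intro continuous_intros)

lemma continuous_G: "continuous_on UNIV (G \<gamma>)"
  unfolding G_def[abs_def] using continuous_psi continuous_grad by (intro continuous_intros)

lemma grad_bounded_on_C:
  obtains L where "L > 0" "\<And>x i. x \<in> C \<Longrightarrow> i \<in> {1..r} \<Longrightarrow> norm (grad (\<psi> i) x) \<le> L"
proof -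
  have "\<exists>K. \<forall>x\<in>C. norm (grad (\<psi> i) x) \<le> K" if "i \<in> {1..r}" for i
  proof -
    have "compact (grad (\<psi> i) ` C)"
      using continuous_grad[OF that] compact_C by (intro compact_continuous_image) (auto intro: continuous_on_subset)
    then have "bounded (grad (\<psi> i) ` C)" by (rule compact_imp_bounded)
    then show ?thesis by (auto simp: bounded_iff)
  qed
  then obtain K where K: "\<And>x i. i \<in> {1..r} \<Longrightarrow> x \<in> C \<Longrightarrow> norm (grad (\<psi> i) x) \<le> K i" by metis
  have "norm (grad (\<psi> i) x) \<le> (\<Sum>i\<in>{1..r}. \<bar>K i\<bar>) + 1" if "x \<in> C" "i \<in> {1..r}" for x i
  proof -
    have "norm (grad (\<psi> i) x) \<le> \<bar>K i\<bar>" using K[OF that(2,1)] by linarith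
    also have "\<dots> \<le> (\<Sum>i\<in>{1..r}. \<bar>K i\<bar>)" using that(2) by (intro member_le_sum) auto
    finally show ?thesis by simp
  qed
  moreover have "(\<Sum>i\<in>{1..r}. \<bar>K i\<bar>) + 1 > 0" by (intro add_nonneg_pos sum_nonneg) auto
  ultimately show thesis using that by blast
qed

section \<open>Gradient bounds, invariance of \<open>C\<close> and integrability of the
  penalty\<close>

lemma norm_G_le:
  assumes "\<And>i. i \<in> {1..r} \<Longrightarrow> norm (grad (\<psi> i) x) \<le> L"
  shows "norm (G \<gamma> x) \<le> L * phi \<gamma> x"
proof -
  have "norm (G \<gamma> x) \<le> (\<Sum>i\<in>{1..r}. exp (\<gamma> * \<psi> i x) * L)"
    unfolding G_def using assms by (intro sum_norm_le) (auto intro!: mult_left_mono)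
  then show ?thesis by (simp add: phi_def sum_distrib_left mult.commute)
qed

text \<open>Almost active constraints all decrease along one inward vector at rate \<eta>. Each of
  the others causes an error of order exp (- \<gamma> * \<delta>), which is o(1 / \<gamma>) and is
  absorbed by half of the main term once \<open>phi\<close> is at least \<open>1 / \<gamma>\<close>.
  Below this threshold \<gamma> * phi is at most 1, which is harmless in the integral bound.\<close>

lemma norm_G_ge:
  obtains \<gamma>0 where "\<gamma>0 > 0"
    "\<And>\<gamma> x. \<gamma> \<ge> \<gamma>0 \<Longrightarrow> x \<in> C \<Longrightarrow> 1 / \<gamma> \<le> phi \<gamma> x \<Longrightarrow> \<eta> / 2 * phi \<gamma> x \<le> norm (G \<gamma> x)"
proof -
  obtain \<delta> where "\<delta> > 0" and \<delta>: "\<And>y. y \<in> C \<Longrightarrow> \<exists>v. norm v \<le> 1 \<and> (\<forall>i\<in>{1..r}. \<psi> i y \<ge> - \<delta> \<longrightarrow> grad (\<psi> i) y \<bullet> v \<le> - \<eta>)"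
    using uniform_inward_vector by blast
  obtain L where "L > 0" and L: "\<And>x i. x \<in> C \<Longrightarrow> i \<in> {1..r} \<Longrightarrow> norm (grad (\<psi> i) x) \<le> L"
    using grad_bounded_on_C by blast
  define R where "R = real r * (\<eta> + L)"
  have pos: "R > 0" using r_pos eta_pos \<open>L > 0\<close> by (simp add: R_def)
  \<comment> \<open>With \<open>\<gamma> * exp (- \<gamma> * \<delta>) < c\<close> the total error
    is at most \<open>\<eta> / 2 * (1 / \<gamma>)\<close>.\<close>
  define c where "c = \<eta> / (2 * R)"
  have "c > 0" using eta_pos pos by (simp add: c_def)
  have "((\<lambda>\<gamma>. \<gamma> * exp (- \<gamma> * \<delta>)) \<longlongrightarrow> 0) at_top" using \<open>\<delta> > 0\<close> by real_asymp
  then have "\<forall>\<^sub>F \<gamma> in at_top. \<gamma> * exp (- \<gamma> * \<delta>) < c" using \<open>c > 0\<close> by (rule order_tendstoD(2))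
  then have "\<forall>\<^sub>F \<gamma> in at_top. \<gamma> > 0 \<and> \<gamma> * exp (- \<gamma> * \<delta>) < c"
    using eventually_gt_at_top[of 0] by eventually_elim simp
  then obtain \<gamma>0 where \<gamma>0: "\<And>\<gamma>. \<gamma> \<ge> \<gamma>0 \<Longrightarrow> \<gamma> > 0 \<and> \<gamma> * exp (- \<gamma> * \<delta>) < c"
    unfolding eventually_at_top_linorder by blast
  have "\<eta> / 2 * phi \<gamma> x \<le> norm (G \<gamma> x)" if g: "\<gamma> \<ge> \<gamma>0" and x: "x \<in> C" and p: "1 / \<gamma> \<le> phi \<gamma> x" for \<gamma> x
  proof -
    have "\<gamma> > 0" and small: "\<gamma> * exp (- \<gamma> * \<delta>) < c" using \<gamma>0[OF g] by auto
    obtain v where v: "norm v \<le> 1" "\<And>i. i \<in> {1..r} \<Longrightarrow> \<psi> i x \<ge> - \<delta> \<Longrightarrow> grad (\<psi> i) x \<bullet> v \<le> - \<eta>"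
      using \<delta>[OF x] by blast
    have trm: "\<eta> * exp (\<gamma> * \<psi> i x) - (\<eta> + L) * exp (- \<gamma> * \<delta>) \<le> - (exp (\<gamma> * \<psi> i x) * (grad (\<psi> i) x \<bullet> v))"
      if i: "i \<in> {1..r}" for i
    proof (cases "\<psi> i x \<ge> - \<delta>")
      case True
      have "exp (\<gamma> * \<psi> i x) * (grad (\<psi> i) x \<bullet> v) \<le> exp (\<gamma> * \<psi> i x) * (- \<eta>)"
        using v(2)[OF i True] by (intro mult_left_mono) auto
      moreover have "0 \<le> (\<eta> + L) * exp (- \<gamma> * \<delta>)" using eta_pos \<open>L > 0\<close> by simp
      ultimately show ?thesis by (simp add: mult.commute)
    next
      case False
      have "norm (grad (\<psi> i) x) * norm v \<le> L * 1" using L[OF x i] v(1) \<open>L > 0\<close> by (intro mult_mono) auto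
      then have "grad (\<psi> i) x \<bullet> v \<le> L" using norm_cauchy_schwarz[of "grad (\<psi> i) x" v] by linarith
      then have "exp (\<gamma> * \<psi> i x) * (grad (\<psi> i) x \<bullet> v) \<le> exp (\<gamma> * \<psi> i x) * L" by (intro mult_left_mono) auto
      moreover have "(\<eta> + L) * exp (\<gamma> * \<psi> i x) \<le> (\<eta> + L) * exp (- \<gamma> * \<delta>)"
      proof -
        have "\<gamma> * \<psi> i x \<le> \<gamma> * (- \<delta>)" using False \<open>\<gamma> > 0\<close> by (intro mult_left_mono) auto
        then show ?thesis using eta_pos \<open>L > 0\<close> by (intro mult_left_mono) auto
      qed
      moreover have "\<eta> * exp (\<gamma> * \<psi> i x) = (\<eta> + L) * exp (\<gamma> * \<psi> i x) - exp (\<gamma> * \<psi> i x) * L"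
        by (simp add: algebra_simps)
      ultimately show ?thesis by linarith
    qed
    have "\<eta> * phi \<gamma> x - real r * ((\<eta> + L) * exp (- \<gamma> * \<delta>)) = (\<Sum>i\<in>{1..r}. \<eta> * exp (\<gamma> * \<psi> i x) - (\<eta> + L) * exp (- \<gamma> * \<delta>))"
      by (simp add: phi_def sum_subtractf sum_distrib_left)
    also have "\<dots> \<le> (\<Sum>i\<in>{1..r}. - (exp (\<gamma> * \<psi> i x) * (grad (\<psi> i) x \<bullet> v)))"
      by (intro sum_mono trm)
    also have "\<dots> = - (G \<gamma> x \<bullet> v)" by (simp add: G_def inner_sum_left sum_negf)
    also have "\<dots> \<le> norm (G \<gamma> x) * norm v" using Cauchy_Schwarz_ineq2[of "G \<gamma> x" v] by linarith
    also have "\<dots> \<le> norm (G \<gamma> x) * 1" using v(1) by (intro mult_left_mono) auto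
    finally have 1: "\<eta> * phi \<gamma> x - real r * ((\<eta> + L) * exp (- \<gamma> * \<delta>)) \<le> norm (G \<gamma> x)" by simp
    have "exp (- \<gamma> * \<delta>) \<le> c / \<gamma>" using small \<open>\<gamma> > 0\<close> by (simp add: le_divide_eq mult.commute)
    then have "R * exp (- \<gamma> * \<delta>) \<le> R * (c / \<gamma>)"
      using pos by (intro mult_left_mono) auto
    also have "\<dots> = \<eta> / 2 * (1 / \<gamma>)" using pos by (simp add: c_def)
    also have "\<dots> \<le> \<eta> / 2 * phi \<gamma> x" using p eta_pos by (intro mult_left_mono) auto
    finally show ?thesis using 1 unfolding R_def by (simp add: algebra_simps)
  qed
  moreover have "\<gamma>0 > 0" using \<gamma>0[of \<gamma>0] by simp
  ultimately show thesis using that by blast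
qed

lemma gderiv_vector_derivative:
  assumes "GDERIV h (x t) :> D" "(x has_vector_derivative v) (at t within S)"
  shows "((\<lambda>t. h (x t)) has_real_derivative (v \<bullet> D)) (at t within S)"
proof -
  have "((\<lambda>t. h (x t)) has_derivative (\<lambda>s. (s *\<^sub>R v) \<bullet> D)) (at t within S)"
    using assms(2)[unfolded has_vector_derivative_def] assms(1)[unfolded gderiv_def]
    by (rule has_derivative_compose)
  moreover have "(\<lambda>s. (s *\<^sub>R v) \<bullet> D) = times (v \<bullet> D)" by (auto simp: fun_eq_iff)
  ultimately show ?thesis by (simp only: has_field_derivative_def)
qed

text \<open>If \<open>phi\<close> reached 1, then between its last time at a level at most
  \<open>m\<close> and the first time at 1 it would exceed 1/2, so that \<gamma> |G| \<ge> \<gamma>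
  \<eta> / 4 \<ge> M and the descent dominates \<open>f\<close>; but then \<open>phi\<close> cannot
  increase.\<close>

lemma phi_invariant:
  obtains \<gamma>0 where "\<gamma>0 > 0"
    "\<And>\<gamma> u x t. \<gamma> \<ge> \<gamma>0 \<Longrightarrow> pen_sol \<gamma> u x \<Longrightarrow> phi \<gamma> (x 0) < 1 \<Longrightarrow> t \<in> {0..T} \<Longrightarrow> phi \<gamma> (x t) < 1"
proof -
  obtain g0 where "g0 > 0" and g0:
    "\<And>\<gamma> x. \<gamma> \<ge> g0 \<Longrightarrow> x \<in> C \<Longrightarrow> 1 / \<gamma> \<le> phi \<gamma> x \<Longrightarrow> \<eta> / 2 * phi \<gamma> x \<le> norm (G \<gamma> x)"
    using norm_G_ge by blast
  \<comment> \<open>The bound 2 gives \<open>1 / \<gamma> \<le> 1 / 2\<close>, which allows the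
    lower bound on \<open>G\<close> wherever \<open>phi\<close> is at least 1/2; the bound
    \<open>4 * M / \<eta>\<close> makes the drift at least \<open>M\<close> there.\<close>
  define \<gamma>0 where "\<gamma>0 = max g0 (max 2 (4 * M / \<eta>))"
  have "phi \<gamma> (x t) < 1" if g: "\<gamma> \<ge> \<gamma>0" and sol: "pen_sol \<gamma> u x" and init: "phi \<gamma> (x 0) < 1" and t: "t \<in> {0..T}" for \<gamma> u x t
  proof (rule ccontr)
    assume neg: "\<not> phi \<gamma> (x t) < 1"
    have g': "\<gamma> \<ge> g0" "\<gamma> \<ge> 2" "\<gamma> \<ge> 4 * M / \<eta>" "\<gamma> > 0" using g by (auto simp: \<gamma>0_def)
    obtain N where ac: "abs_cont_on 0 T x" and N: "negligible N" and der: "\<And>t. t \<in> {0..T} - N \<Longrightarrow> u t \<in> U \<and>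
       (x t \<in> C \<longrightarrow> (x has_vector_derivative (f (x t) (u t) - \<gamma> *\<^sub>R G \<gamma> (x t))) (at t within {0..T}))"
      using sol unfolding pen_sol_def by blast
    define p where "p = (\<lambda>t. phi \<gamma> (x t))"
    have contp: "continuous_on {0..T} p"
      unfolding p_def using abs_cont_on_imp_continuous_on[OF ac]
      by (intro continuous_on_compose2[OF continuous_phi]) auto
    have acp: "abs_cont_on 0 T p"
      unfolding p_def by (rule abs_cont_on_compose_C1[OF ac gderiv_phi]) (intro continuous_intros continuous_G)
    define m where "m = max (1/2) (p 0)"
    have "m < 1" using init by (simp add: m_def p_def)
    have contt: "continuous_on {0..t} p" using contp t by (auto intro: continuous_on_subset)
    \<comment> \<open>Its minimum is the first time at level 1 or above; the set \<open>S2\<close>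
      below gives the last earlier time at a level at most \<open>m\<close>. Both exist by
      compactness.\<close>
    define S1 where "S1 = {0..t} \<inter> p -` {1..}"
    have "compact S1" unfolding S1_def
      using continuous_closed_preimage[OF contt, of "{1..}"] by (auto simp: compact_eq_bounded_closed intro: bounded_subset[OF bounded_closed_interval])
    moreover have "t \<in> S1" using neg t by (auto simp: S1_def p_def)
    ultimately obtain t1 where t1: "t1 \<in> S1" "\<And>s. s \<in> S1 \<Longrightarrow> t1 \<le> s" using compact_attains_inf[of S1] by blast
    have t1': "0 \<le> t1" "t1 \<le> t" "p t1 \<ge> 1" using t1(1) by (auto simp: S1_def)
    have below: "p s < 1" if "0 \<le> s" "s < t1" for s
      using t1(2)[of s] that t1' by (force simp: S1_def)
    have contt1: "continuous_on {0..t1} p" using contt t1' by (auto intro: continuous_on_subset)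
    define S2 where "S2 = {0..t1} \<inter> p -` {..m}"
    have "compact S2" unfolding S2_def
      using continuous_closed_preimage[OF contt1, of "{..m}"] by (auto simp: compact_eq_bounded_closed intro: bounded_subset[OF bounded_closed_interval])
    moreover have "0 \<in> S2" using t1' by (auto simp: S2_def m_def)
    ultimately obtain s0 where s0: "s0 \<in> S2" "\<And>s. s \<in> S2 \<Longrightarrow> s \<le> s0" using compact_attains_sup[of S2] by blast
    have s0': "0 \<le> s0" "s0 \<le> t1" "p s0 \<le> m" using s0(1) by (auto simp: S2_def)
    have above: "p s > m" if "s0 < s" "s \<le> t1" for s
      using s0(2)[of s] that s0' by (force simp: S2_def)
    have "p t1 - p s0 \<le> integral {s0..t1} (\<lambda>_. 0)"
    proof (rule abs_cont_on_le_integral)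
      show "abs_cont_on s0 t1 p" by (rule abs_cont_on_subset[OF acp]) (use s0' t1' t in auto)
      show "negligible (N \<union> {s0, t1})" using N by (intro negligible_Un) auto
      fix s assume s: "s \<in> {s0..t1} - (N \<union> {s0, t1})"
      then have s': "s \<in> {0..T} - N" "s0 < s" "s < t1" using s0' t1' t by auto
      have pm: "p s > m" "p s < 1" using above[of s] below[of s] s' s0' by auto
      \<comment> \<open>Before the exit time the state is in \<open>C\<close>, so the differential
        equation recorded by \<open>pen_sol\<close> is available.\<close>
      then have xC: "x s \<in> C" using phi_le_1_imp_C[OF g'(4), of "x s"] by (simp add: p_def)
      have "(x has_vector_derivative (f (x s) (u s) - \<gamma> *\<^sub>R G \<gamma> (x s))) (at s within {0..T})" and uU: "u s \<in> U"
        using der[OF s'(1)] xC by auto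
      then have "(p has_real_derivative ((f (x s) (u s) - \<gamma> *\<^sub>R G \<gamma> (x s)) \<bullet> (\<gamma> *\<^sub>R G \<gamma> (x s)))) (at s within {0..T})"
        unfolding p_def by (intro gderiv_vector_derivative gderiv_phi)
      then have d: "(p has_real_derivative ((f (x s) (u s) - \<gamma> *\<^sub>R G \<gamma> (x s)) \<bullet> (\<gamma> *\<^sub>R G \<gamma> (x s)))) (at s within {s0..t1})"
        by (rule DERIV_subset) (use s0' t1' t in auto)
      have half: "1 / 2 \<le> phi \<gamma> (x s)" using pm by (simp add: m_def p_def)
      moreover have "1 / \<gamma> \<le> 1 / 2" using g' by (intro divide_left_mono) auto
      ultimately have "\<eta> / 2 * phi \<gamma> (x s) \<le> norm (G \<gamma> (x s))" using g0[OF g'(1) xC] by linarith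
      moreover have "\<eta> / 2 * (1 / 2) \<le> \<eta> / 2 * phi \<gamma> (x s)" using half eta_pos by (intro mult_left_mono) auto
      ultimately have "\<eta> / 4 \<le> norm (G \<gamma> (x s))" by linarith
      then have "\<gamma> * (\<eta> / 4) \<le> \<gamma> * norm (G \<gamma> (x s))" using g'(4) by (intro mult_left_mono) auto
      moreover have "M \<le> \<gamma> * (\<eta> / 4)" using g'(3) eta_pos by (simp add: divide_le_eq field_simps)
      ultimately have "M \<le> \<gamma> * norm (G \<gamma> (x s))" by linarith
      then have MG: "M \<le> norm (\<gamma> *\<^sub>R G \<gamma> (x s))" using g'(4) by simp
      have "f (x s) (u s) \<bullet> (\<gamma> *\<^sub>R G \<gamma> (x s)) \<le> norm (f (x s) (u s)) * norm (\<gamma> *\<^sub>R G \<gamma> (x s))"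
        by (rule norm_cauchy_schwarz)
      also have "\<dots> \<le> M * norm (\<gamma> *\<^sub>R G \<gamma> (x s))" using f_bound[OF xC uU] by (intro mult_right_mono) auto
      also have "\<dots> \<le> norm (\<gamma> *\<^sub>R G \<gamma> (x s)) * norm (\<gamma> *\<^sub>R G \<gamma> (x s))" using MG by (intro mult_right_mono) auto
      also have "\<dots> = (\<gamma> *\<^sub>R G \<gamma> (x s)) \<bullet> (\<gamma> *\<^sub>R G \<gamma> (x s))" by (simp only: power2_norm_eq_inner[symmetric] power2_eq_square)
      finally have "(f (x s) (u s) - \<gamma> *\<^sub>R G \<gamma> (x s)) \<bullet> (\<gamma> *\<^sub>R G \<gamma> (x s)) \<le> 0" by (simp only: inner_diff_left diff_le_0_iff_le)
      then show "\<exists>D. (p has_real_derivative D) (at s within {s0..t1}) \<and> D \<le> 0" using d by blast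
    qed (use s0' in auto)
    then show False using s0' t1' \<open>m < 1\<close> by simp
  qed
  moreover have "\<gamma>0 > 0" using \<open>g0 > 0\<close> by (simp add: \<gamma>0_def)
  ultimately show thesis using that by blast
qed

text \<open>The logarithm is the right scale: the values of ln phi / \<gamma> needed at the two end
  times, a lower bound at \<open>T\<close> and an upper bound at 0, do not depend on \<gamma>, while
  the derivative contains - \<gamma> |G|^2 / phi, which is at most - (\<eta>^2 / 4) \<gamma> phi up
  to a constant. Integration bounds the total penalty.\<close>

lemma penalty_integral_bound:
  obtains \<gamma>0 B where "\<gamma>0 > 0" "B \<ge> 0"
    "\<And>\<gamma> u x t. \<gamma> \<ge> \<gamma>0 \<Longrightarrow> pen_sol \<gamma> u x \<Longrightarrow> phi \<gamma> (x 0) < 1 \<Longrightarrow> t \<in> {0..T} \<Longrightarrow> phi \<gamma> (x t) < 1"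
    "\<And>\<gamma> u x. \<gamma> \<ge> \<gamma>0 \<Longrightarrow> pen_sol \<gamma> u x \<Longrightarrow> phi \<gamma> (x 0) < 1 \<Longrightarrow> integral {0..T} (\<lambda>t. \<gamma> * phi \<gamma> (x t)) \<le> B"
proof -
  obtain g0 where "g0 > 0" and g0:
    "\<And>\<gamma> x. \<gamma> \<ge> g0 \<Longrightarrow> x \<in> C \<Longrightarrow> 1 / \<gamma> \<le> phi \<gamma> x \<Longrightarrow> \<eta> / 2 * phi \<gamma> x \<le> norm (G \<gamma> x)"
    using norm_G_ge by blast
  obtain g1 where "g1 > 0" and g1:
    "\<And>\<gamma> u x t. \<gamma> \<ge> g1 \<Longrightarrow> pen_sol \<gamma> u x \<Longrightarrow> phi \<gamma> (x 0) < 1 \<Longrightarrow> t \<in> {0..T} \<Longrightarrow> phi \<gamma> (x t) < 1"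
    using phi_invariant by blast
  obtain L where "L > 0" and L: "\<And>x i. x \<in> C \<Longrightarrow> i \<in> {1..r} \<Longrightarrow> norm (grad (\<psi> i) x) \<le> L"
    using grad_bounded_on_C by blast
  have one: "1 \<in> {1..r}" using r_pos by simp
  have "compact (\<psi> 1 ` C)"
    using continuous_psi[OF one] compact_C by (intro compact_continuous_image) (auto intro: continuous_on_subset)
  then have "bounded (\<psi> 1 ` C)" by (rule compact_imp_bounded)
  then obtain m0 where "\<forall>z\<in>\<psi> 1 ` C. norm z \<le> m0" unfolding bounded_iff by (elim exE)
  then have m0: "\<bar>\<psi> 1 x\<bar> \<le> m0" if "x \<in> C" for x using that by auto
  have "m0 \<ge> 0" using m0 C_ne by force
  define k where "k = M * L + \<eta>\<^sup>2 / 4"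
  define B where "B = 4 / \<eta>\<^sup>2 * (T * k + m0)"
  have "k \<ge> 0" using M_pos \<open>L > 0\<close> by (simp add: k_def)
  have "B \<ge> 0" using \<open>k \<ge> 0\<close> \<open>m0 \<ge> 0\<close> T_pos by (simp add: B_def)
  define \<gamma>0 where "\<gamma>0 = max g0 g1"
  have "integral {0..T} (\<lambda>t. \<gamma> * phi \<gamma> (x t)) \<le> B"
    if g: "\<gamma> \<ge> \<gamma>0" and sol: "pen_sol \<gamma> u x" and init: "phi \<gamma> (x 0) < 1" for \<gamma> u x
  proof -
    have g': "\<gamma> \<ge> g0" "\<gamma> \<ge> g1" "\<gamma> > 0" using g \<open>g0 > 0\<close> by (auto simp: \<gamma>0_def)
    have inv: "phi \<gamma> (x t) < 1" if "t \<in> {0..T}" for t using g1[OF g'(2) sol init that] .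
    have xC: "x t \<in> C" if "t \<in> {0..T}" for t using phi_le_1_imp_C[OF g'(3)] inv[OF that] by simp
    obtain N where ac: "abs_cont_on 0 T x" and N: "negligible N" and der: "\<And>t. t \<in> {0..T} - N \<Longrightarrow> u t \<in> U \<and>
       (x t \<in> C \<longrightarrow> (x has_vector_derivative (f (x t) (u t) - \<gamma> *\<^sub>R G \<gamma> (x t))) (at t within {0..T}))"
      using sol unfolding pen_sol_def by blast
    define V where "V = (\<lambda>z. ln (phi \<gamma> z) / \<gamma>)"
    have gV: "GDERIV V z :> (1 / phi \<gamma> z) *\<^sub>R G \<gamma> z" for z
    proof -
      have "(phi \<gamma> has_derivative (\<lambda>h. h \<bullet> (\<gamma> *\<^sub>R G \<gamma> z))) (at z)" using gderiv_phi[of \<gamma> z] unfolding gderiv_def .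
      then have "((\<lambda>z. ln (phi \<gamma> z) / \<gamma>) has_derivative (\<lambda>h. (h \<bullet> (\<gamma> *\<^sub>R G \<gamma> z)) / phi \<gamma> z / \<gamma>)) (at z)"
        using phi_pos[of \<gamma> z] g'(3) by (auto intro!: derivative_eq_intros simp: field_simps)
      then show ?thesis unfolding gderiv_def V_def using g'(3) by simp
    qed
    have contG: "continuous_on UNIV (\<lambda>z. (1 / phi \<gamma> z) *\<^sub>R G \<gamma> z)"
      using phi_pos by (intro continuous_intros continuous_phi continuous_G) (auto simp: less_imp_neq[symmetric] order_less_imp_not_eq2)
    have acV: "abs_cont_on 0 T (\<lambda>t. V (x t))" by (rule abs_cont_on_compose_C1[OF ac gV contG])
    have contp: "continuous_on {0..T} (\<lambda>t. phi \<gamma> (x t))"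
      using abs_cont_on_imp_continuous_on[OF ac] by (intro continuous_on_compose2[OF continuous_phi]) auto
    have "V (x T) - V (x 0) \<le> integral {0..T} (\<lambda>t. k - \<eta>\<^sup>2 / 4 * (\<gamma> * phi \<gamma> (x t)))"
    proof (rule abs_cont_on_le_integral[OF acV _ N])
      fix t assume t: "t \<in> {0..T} - N"
      then have xt: "x t \<in> C" and ut: "u t \<in> U" and
        d: "(x has_vector_derivative (f (x t) (u t) - \<gamma> *\<^sub>R G \<gamma> (x t))) (at t within {0..T})"
        using xC der[OF t] by auto
      define p where "p = phi \<gamma> (x t)"
      define w where "w = norm (G \<gamma> (x t))"
      have "p > 0" by (simp add: p_def phi_pos)
      have "w \<le> L * p" unfolding w_def p_def using L[OF xt] by (rule norm_G_le)
      have "((\<lambda>t. V (x t)) has_real_derivative ((f (x t) (u t) - \<gamma> *\<^sub>R G \<gamma> (x t)) \<bullet> ((1 / p) *\<^sub>R G \<gamma> (x t)))) (at t within {0..T})"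
        unfolding p_def by (rule gderiv_vector_derivative[OF gV d])
      moreover have "(f (x t) (u t) - \<gamma> *\<^sub>R G \<gamma> (x t)) \<bullet> ((1 / p) *\<^sub>R G \<gamma> (x t)) \<le> k - \<eta>\<^sup>2 / 4 * (\<gamma> * phi \<gamma> (x t))"
      proof -
        have "f (x t) (u t) \<bullet> G \<gamma> (x t) \<le> norm (f (x t) (u t)) * w" unfolding w_def by (rule norm_cauchy_schwarz)
        also have "\<dots> \<le> M * (L * p)" using f_bound[OF xt ut] \<open>w \<le> L * p\<close> M_pos by (intro mult_mono) (auto simp: w_def)
        finally have 1: "f (x t) (u t) \<bullet> G \<gamma> (x t) / p \<le> M * L" using \<open>p > 0\<close> by (simp add: divide_le_eq mult.assoc)
        have 2: "\<gamma> * (\<eta>\<^sup>2 / 4) * p - \<eta>\<^sup>2 / 4 \<le> \<gamma> * w\<^sup>2 / p"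
        proof (cases "1 / \<gamma> \<le> p")
          case True
          have "\<eta> / 2 * p \<le> w" unfolding w_def p_def by (rule g0[OF g'(1) xt]) (use True in \<open>simp add: p_def\<close>)
          then have "(\<eta> / 2 * p)\<^sup>2 \<le> w\<^sup>2" using eta_pos \<open>p > 0\<close> by (intro power_mono) auto
          then have "\<gamma> * (\<eta> / 2 * p)\<^sup>2 / p \<le> \<gamma> * w\<^sup>2 / p" using \<open>p > 0\<close> g'(3) by (intro divide_right_mono mult_left_mono) auto
          moreover have "\<gamma> * (\<eta> / 2 * p)\<^sup>2 / p = \<gamma> * (\<eta>\<^sup>2 / 4) * p" using \<open>p > 0\<close> by (simp add: power2_eq_square)
          moreover have "0 \<le> \<eta>\<^sup>2 / 4" by simp
          ultimately show ?thesis by linarith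
        next
          case False
          then have "\<gamma> * p \<le> 1" using g'(3) by (simp add: field_simps)
          then have "(\<eta>\<^sup>2 / 4) * (\<gamma> * p) \<le> (\<eta>\<^sup>2 / 4) * 1" by (intro mult_left_mono) auto
          moreover have "0 \<le> \<gamma> * w\<^sup>2 / p" using g'(3) \<open>p > 0\<close> by simp
          ultimately show ?thesis by (simp add: mult_ac)
        qed
        have "(f (x t) (u t) - \<gamma> *\<^sub>R G \<gamma> (x t)) \<bullet> ((1 / p) *\<^sub>R G \<gamma> (x t)) = f (x t) (u t) \<bullet> G \<gamma> (x t) / p - \<gamma> * w\<^sup>2 / p"
          by (simp add: inner_diff_left w_def power2_norm_eq_inner diff_divide_distrib)
        moreover have "\<gamma> * (\<eta>\<^sup>2 / 4) * p = \<eta>\<^sup>2 / 4 * (\<gamma> * p)" by simp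
        ultimately show ?thesis using 1 2 unfolding k_def p_def[symmetric] by linarith
      qed
      ultimately show "\<exists>D. ((\<lambda>t. V (x t)) has_real_derivative D) (at t within {0..T}) \<and> D \<le> k - \<eta>\<^sup>2 / 4 * (\<gamma> * phi \<gamma> (x t))" by blast
    next
      show "(\<lambda>t. k - \<eta>\<^sup>2 / 4 * (\<gamma> * phi \<gamma> (x t))) integrable_on {0..T}"
        using contp by (intro integrable_continuous_interval continuous_intros)
    qed (use T_pos in auto)
    also have "\<dots> = T * k - \<eta>\<^sup>2 / 4 * integral {0..T} (\<lambda>t. \<gamma> * phi \<gamma> (x t))"
    proof -
      have "integral {0..T} (\<lambda>t. k - \<eta>\<^sup>2 / 4 * (\<gamma> * phi \<gamma> (x t)))
          = integral {0..T} (\<lambda>t. k) - integral {0..T} (\<lambda>t. \<eta>\<^sup>2 / 4 * (\<gamma> * phi \<gamma> (x t)))"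
        using contp by (intro integral_diff integrable_continuous_interval continuous_intros)
      then show ?thesis using T_pos by (simp only: integral_mult_right integral_const_real) simp
    qed
    finally have 1: "V (x T) - V (x 0) \<le> T * k - \<eta>\<^sup>2 / 4 * integral {0..T} (\<lambda>t. \<gamma> * phi \<gamma> (x t))" .
    have "ln (phi \<gamma> (x 0)) \<le> 0" using init phi_pos[of \<gamma> "x 0"] by simp
    then have 2: "V (x 0) \<le> 0" using g'(3) by (simp add: V_def divide_nonpos_pos)
    \<comment> \<open>Any single summand of \<open>phi\<close> bounds the logarithm from below; the
      first one exists because \<open>r\<close> is at least 1.\<close>
    have "\<gamma> * \<psi> 1 (x T) \<le> ln (phi \<gamma> (x T))" using exp_le_phi[OF one, of \<gamma> "x T"] phi_pos[of \<gamma> "x T"] by (simp add: ln_ge_iff)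
    then have "\<psi> 1 (x T) \<le> V (x T)" using g'(3) by (simp add: V_def le_divide_eq mult.commute)
    then have 3: "- m0 \<le> V (x T)" using m0[OF xC[of T]] T_pos by auto
    have "\<eta>\<^sup>2 / 4 * integral {0..T} (\<lambda>t. \<gamma> * phi \<gamma> (x t)) \<le> T * k + m0" using 1 2 3 by linarith
    then have "4 / \<eta>\<^sup>2 * (\<eta>\<^sup>2 / 4 * integral {0..T} (\<lambda>t. \<gamma> * phi \<gamma> (x t))) \<le> B"
      unfolding B_def by (intro mult_left_mono) auto
    then show ?thesis using eta_pos by simp
  qed
  moreover have "\<gamma>0 > 0" using \<open>g0 > 0\<close> by (simp add: \<gamma>0_def)
  moreover have "phi \<gamma> (x t) < 1" if "\<gamma> \<ge> \<gamma>0" "pen_sol \<gamma> u x" "phi \<gamma> (x 0) < 1" "t \<in> {0..T}" for \<gamma> u x t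
    using g1[OF _ that(2-4)] that(1) by (simp add: \<gamma>0_def)
  ultimately show thesis using that[of \<gamma>0 B] \<open>B \<ge> 0\<close> by blast
qed

end

subsection \<open>Comparison with sweeping trajectories\<close>

context sweeping_control
begin

text \<open>Staying in \<open>C\<close> makes the normal component orthogonal to the velocity: at an
  interior time of differentiability the proximal inequality forces the derivative of
  \<open>q\<close> to vanish. Thus |\<zeta>|^2 is the product of \<zeta> with \<open>f\<close>, and
  \<zeta> inherits the bound \<open>M\<close>.\<close>

lemma sweeping_solution:
  assumes sol: "solves_D T f C x0 w y" and wU: "AE t in lebesgue_on {0..T}. w t \<in> U"
  obtains N where "negligible N" "\<And>t. t \<in> {0..T} \<Longrightarrow> y t \<in> C"
    "\<And>t. t \<in> {0..T} - N \<Longrightarrow> w t \<in> U \<and> (\<exists>\<zeta>\<in>clarke_normal_cone C (y t). norm \<zeta> \<le> M \<and>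
        (y has_vector_derivative (f (y t) (w t) - \<zeta>)) (at t within {0..T}))"
proof -
  have ac: "abs_cont_on 0 T y" using sol by (simp add: solves_D_def)
  have "AE t in lebesgue_on {0..T}. \<exists>\<zeta>\<in>clarke_normal_cone C (y t).
        (y has_vector_derivative (f (y t) (w t) - \<zeta>)) (at t within {0..T})" using sol by (simp add: solves_D_def)
  then obtain N1 where N1: "negligible N1" "\<And>t. t \<in> {0..T} - N1 \<Longrightarrow> \<exists>\<zeta>\<in>clarke_normal_cone C (y t).
        (y has_vector_derivative (f (y t) (w t) - \<zeta>)) (at t within {0..T})" by (rule AE_lebesgue_onE) blast
  obtain N2 where N2: "negligible N2" "\<And>t. t \<in> {0..T} - N2 \<Longrightarrow> w t \<in> U"
    using wU by (rule AE_lebesgue_onE) blast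
  \<comment> \<open>The endpoints are dropped because the maximum argument needs a two-sided
    derivative.\<close>
  define N where "N = N1 \<union> N2 \<union> {0, T}"
  have N: "negligible N" unfolding N_def using N1 N2 by (intro negligible_Un) auto
  have yC: "y t \<in> C" if "t \<in> {0..T}" for t
  proof -
    have "closed ({0..T} \<inter> y -` C)"
      by (rule continuous_closed_preimage[OF abs_cont_on_imp_continuous_on[OF ac] closed_atLeastAtMost closed_C])
    moreover have "{0..T} - N1 \<subseteq> {0..T} \<inter> y -` C"
    proof
      fix t assume t: "t \<in> {0..T} - N1"
      then have "clarke_normal_cone C (y t) \<noteq> {}" using N1(2)[OF t] by blast
      then have "y t \<in> C" by (simp add: clarke_normal_cone_def split: if_splits)
      then show "t \<in> {0..T} \<inter> y -` C" using t by blast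
    qed
    ultimately show ?thesis using negligible_dense[OF N1(1) T_pos] that by blast
  qed
  show thesis
  proof (rule that[OF N yC])
    fix t assume t: "t \<in> {0..T} - N"
    then have t': "t \<in> {0..T} - N1" "t \<in> {0..T} - N2" "0 < t" "t < T" by (auto simp: N_def)
    obtain \<zeta> where z: "\<zeta> \<in> clarke_normal_cone C (y t)" and d: "(y has_vector_derivative (f (y t) (w t) - \<zeta>)) (at t within {0..T})"
      using N1(2)[OF t'(1)] by blast
    have wt: "w t \<in> U" using N2(2)[OF t'(2)] .
    have yt: "y t \<in> C" using yC t by blast
    have "t \<in> interior {0..T}" using t' by simp
    have d': "(y has_vector_derivative (f (y t) (w t) - \<zeta>)) (at t)" using d unfolding at_within_interior[OF \<open>t \<in> interior {0..T}\<close>] .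
    define K where "K = (M\<psi> / (2 * \<eta>)) * norm \<zeta>"
    \<comment> \<open>The proximal inequality says that \<open>q\<close> is at most its value 0 at
      \<open>t\<close>; the quadratic term has derivative 0 there.\<close>
    define q where "q = (\<lambda>s. \<zeta> \<bullet> (y s - y t) - K * ((y s - y t) \<bullet> (y s - y t)))"
    have "(q has_derivative (\<lambda>h. \<zeta> \<bullet> (h *\<^sub>R (f (y t) (w t) - \<zeta>)))) (at t)"
      unfolding q_def using d'[unfolded has_vector_derivative_def] by (auto intro!: derivative_eq_intros)
    moreover have "(\<lambda>h. \<zeta> \<bullet> (h *\<^sub>R (f (y t) (w t) - \<zeta>))) = times (\<zeta> \<bullet> (f (y t) (w t) - \<zeta>))"
      by (auto simp: fun_eq_iff)
    ultimately have "(q has_real_derivative (\<zeta> \<bullet> (f (y t) (w t) - \<zeta>))) (at t)" by (simp only: has_field_derivative_def)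
    moreover have "q s \<le> q t" if "\<bar>t - s\<bar> < min t (T - t)" for s
    proof -
      have "s \<in> {0..T}" using that by auto
      then have "\<zeta> \<bullet> (y s - y t) \<le> K * (norm (y s - y t))\<^sup>2"
        using z clarke_normal_cone_iff[OF yt, of \<zeta>] yC[of s] by (simp add: K_def)
      then show ?thesis by (simp add: q_def power2_norm_eq_inner)
    qed
    ultimately have "\<zeta> \<bullet> (f (y t) (w t) - \<zeta>) = 0"
      using t' by (intro DERIV_local_max[of q _ t "min t (T - t)"]) auto
    then have "norm \<zeta> * norm \<zeta> = \<zeta> \<bullet> f (y t) (w t)" by (simp add: inner_diff_right power2_norm_eq_inner[symmetric] power2_eq_square)
    also have "\<dots> \<le> norm \<zeta> * norm (f (y t) (w t))" by (rule norm_cauchy_schwarz)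
    also have "\<dots> \<le> norm \<zeta> * M" using f_bound[OF yt wt] by (intro mult_left_mono) auto
    finally have "norm \<zeta> \<le> M" using M_pos by (cases "norm \<zeta> = 0") auto
    then show "w t \<in> U \<and> (\<exists>\<zeta>\<in>clarke_normal_cone C (y t). norm \<zeta> \<le> M \<and>
        (y has_vector_derivative (f (y t) (w t) - \<zeta>)) (at t within {0..T}))" using z d wt by blast
  qed
qed

text \<open>The penalty counterpart of the normal cone inequality. Since \<open>\<psi> i\<close> is
  nonpositive at \<open>y\<close>, its first-order change from \<open>x\<close> towards
  \<open>y\<close> is at most \<open>- \<psi> i x\<close> plus a quadratic term; the exponential
  weight then makes the slack \<open>- \<psi> i x\<close> small against the penalty itself.\<close>

lemma inner_penalty_le:
  assumes "\<gamma> > 0" and x: "x \<in> C" and y: "y \<in> C"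
  shows "(y - x) \<bullet> (\<gamma> *\<^sub>R G \<gamma> x) \<le> (real r + \<gamma> * phi \<gamma> x) / sqrt \<gamma> + M\<psi> * (\<gamma> * phi \<gamma> x) * (norm (y - x))\<^sup>2"
proof -
  define q where "q = (norm (y - x))\<^sup>2"
  have "(y - x) \<bullet> (\<gamma> *\<^sub>R G \<gamma> x) = (\<Sum>i\<in>{1..r}. \<gamma> * exp (\<gamma> * \<psi> i x) * (grad (\<psi> i) x \<bullet> (y - x)))"
    unfolding G_def by (simp add: inner_sum_right sum_distrib_left inner_commute mult.assoc)
  also have "\<dots> \<le> (\<Sum>i\<in>{1..r}. (1 + \<gamma> * exp (\<gamma> * \<psi> i x)) / sqrt \<gamma> + M\<psi> * q * (\<gamma> * exp (\<gamma> * \<psi> i x)))"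
  proof (rule sum_mono)
    fix i assume i: "i \<in> {1..r}"
    have "\<bar>\<psi> i y - \<psi> i x - grad (\<psi> i) x \<bullet> (y - x)\<bar> \<le> M\<psi> * q"
      unfolding q_def by (rule psi_taylor[OF i x y])
    moreover have "\<psi> i y \<le> 0" using y i mem_C_iff by blast
    ultimately have "grad (\<psi> i) x \<bullet> (y - x) \<le> - \<psi> i x + M\<psi> * q" by (simp add: abs_le_iff)
    then have "\<gamma> * exp (\<gamma> * \<psi> i x) * (grad (\<psi> i) x \<bullet> (y - x)) \<le> \<gamma> * exp (\<gamma> * \<psi> i x) * (- \<psi> i x + M\<psi> * q)"
      using assms(1) by (intro mult_left_mono) auto
    also have "\<dots> = \<gamma> * (- \<psi> i x) * exp (- (\<gamma> * (- \<psi> i x))) + M\<psi> * q * (\<gamma> * exp (\<gamma> * \<psi> i x))"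
      by (simp add: algebra_simps)
    also have "\<dots> \<le> (1 + \<gamma> * exp (- (\<gamma> * (- \<psi> i x)))) / sqrt \<gamma> + M\<psi> * q * (\<gamma> * exp (\<gamma> * \<psi> i x))"
      by (intro add_right_mono penalty_weight_bound assms(1))
    finally show "\<gamma> * exp (\<gamma> * \<psi> i x) * (grad (\<psi> i) x \<bullet> (y - x)) \<le> (1 + \<gamma> * exp (\<gamma> * \<psi> i x)) / sqrt \<gamma> + M\<psi> * q * (\<gamma> * exp (\<gamma> * \<psi> i x))"
      by simp
  qed
  also have "\<dots> = (real r + \<gamma> * phi \<gamma> x) / sqrt \<gamma> + M\<psi> * (\<gamma> * phi \<gamma> x) * q"
    by (simp add: sum.distrib sum_divide_distrib[symmetric] phi_def sum_distrib_left mult_ac)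
  finally show ?thesis by (simp add: q_def)
qed

text \<open>Gronwall's lemma for |x - y|^2. The two controls are compared only through the
  velocities at \<open>y\<close>; the Lipschitz bound on \<open>f\<close> carries this over to
  \<open>x\<close>. Apart from the explicit \<open>1 / sqrt \<gamma>\<close> the parameter \<gamma>
  enters only through the bound \<open>B\<close>.\<close>

lemma penalized_sweeping_comparison:
  assumes g: "\<gamma> > 0" and x: "pen_sol \<gamma> u x" and inv: "\<And>t. t \<in> {0..T} \<Longrightarrow> phi \<gamma> (x t) < 1"
    and B: "integral {0..T} (\<lambda>t. \<gamma> * phi \<gamma> (x t)) \<le> B"
    and y: "solves_D T f C x0 w y" "AE t in lebesgue_on {0..T}. w t \<in> U"
    and \<rho>: "\<rho> integrable_on {0..T}" "\<And>t. t \<in> {0..T} \<Longrightarrow> \<rho> t \<ge> 0"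
      "negligible N0" "\<And>t. t \<in> {0..T} - N0 \<Longrightarrow> norm (f (y t) (u t) - f (y t) (w t)) \<le> \<rho> t"
    and d: "\<And>a b. a \<in> C \<Longrightarrow> b \<in> C \<Longrightarrow> norm (a - b) \<le> d"
    and s: "s \<in> {0..T}"
  shows "(norm (x s - y s))\<^sup>2 \<le> exp (T * (2 * M + M * M\<psi> / \<eta>) + 2 * M\<psi> * B) *
      ((norm (x 0 - y 0))\<^sup>2 + (2 * d * integral {0..T} \<rho> + 2 * (real r * T + B) / sqrt \<gamma>))"
proof -
  obtain N1 where acx: "abs_cont_on 0 T x" and N1: "negligible N1" and derx: "\<And>t. t \<in> {0..T} - N1 \<Longrightarrow> u t \<in> U \<and>
       (x t \<in> C \<longrightarrow> (x has_vector_derivative (f (x t) (u t) - \<gamma> *\<^sub>R G \<gamma> (x t))) (at t within {0..T}))"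
    using x unfolding pen_sol_def by blast
  have acy: "abs_cont_on 0 T y" using y by (simp add: solves_D_def)
  obtain N2 where N2: "negligible N2" and yC: "\<And>t. t \<in> {0..T} \<Longrightarrow> y t \<in> C"
    and dery: "\<And>t. t \<in> {0..T} - N2 \<Longrightarrow> w t \<in> U \<and> (\<exists>\<zeta>\<in>clarke_normal_cone C (y t). norm \<zeta> \<le> M \<and>
        (y has_vector_derivative (f (y t) (w t) - \<zeta>)) (at t within {0..T}))"
    using sweeping_solution[OF y] by blast
  have xC: "x t \<in> C" if "t \<in> {0..T}" for t using phi_le_1_imp_C[OF g] inv[OF that] by simp
  have d0: "d \<ge> 0" using d[OF xC[OF s] xC[OF s]] by simp
  define q where "q = (\<lambda>t. (x t - y t) \<bullet> (x t - y t))"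
  have gd: "GDERIV (\<lambda>z. z \<bullet> z) z :> 2 *\<^sub>R z" for z :: 'a
    unfolding gderiv_def by (auto intro!: derivative_eq_intros simp: inner_commute)
  have acq: "abs_cont_on 0 T q"
    unfolding q_def by (rule abs_cont_on_compose_C1[OF abs_cont_on_diff[OF acx acy] gd]) (intro continuous_intros)
  define p where "p = (\<lambda>t. \<gamma> * phi \<gamma> (x t))"
  have contp: "continuous_on {0..T} p" unfolding p_def
    using abs_cont_on_imp_continuous_on[OF acx] by (intro continuous_intros continuous_on_compose2[OF continuous_phi]) auto
  have p0: "p t \<ge> 0" for t using g phi_pos[of \<gamma> "x t"] by (simp add: p_def)
  \<comment> \<open>Differentiating a square doubles each coefficient: \<open>M\<close> is the
    Lipschitz constant of \<open>f\<close>, \<open>M * M\<psi> / (2 * \<eta>)\<close> comes from the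
    normal cone with normals bounded by \<open>M\<close>, and \<open>M\<psi> * p t\<close> from the
    penalty. The integral of the last one is bounded through \<open>B\<close>.\<close>
  define a where "a = (\<lambda>t. (2 * M + M * M\<psi> / \<eta>) + 2 * M\<psi> * p t)"
  \<comment> \<open>The terms that are not quadratic in the distance; \<open>d\<close> bounds the
    distance itself in its product with the velocity discrepancy.\<close>
  define b where "b = (\<lambda>t. 2 * d * \<rho> t + 2 * (real r + p t) / sqrt \<gamma>)"
  have pint: "p integrable_on {0..T}" using contp by (rule integrable_continuous_interval)
  have conta: "continuous_on {0..T} a" unfolding a_def using contp by (intro continuous_intros)
  have intb1: "(\<lambda>t. 2 * d * \<rho> t) integrable_on {0..T}" using integrable_on_cmult_left[OF \<rho>(1), of "2 * d"] by simp
  have intb2: "(\<lambda>t. 2 * (real r + p t) / sqrt \<gamma>) integrable_on {0..T}"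
    using contp g by (intro integrable_continuous_interval continuous_intros) auto
  have "q s \<le> exp (integral {0..T} a) * (q 0 + integral {0..T} b)"
  proof (rule gronwall[OF acq _ _ _ conta _ _ _ s])
    show "negligible (N0 \<union> N1 \<union> N2)" using N1 N2 \<rho>(3) by (intro negligible_Un)
    show "q t \<ge> 0" for t by (simp add: q_def)
    show "a t \<ge> 0" for t using M_pos Mpsi_pos eta_pos p0[of t] by (simp add: a_def)
    show "b integrable_on {0..T}" unfolding b_def by (rule integrable_add[OF intb1 intb2])
    show "b t \<ge> 0" if "t \<in> {0..T}" for t using \<rho>(2)[OF that] d0 p0[of t] g by (simp add: b_def)
    fix t assume t: "t \<in> {0..T} - (N0 \<union> N1 \<union> N2)"
    then have t': "t \<in> {0..T}" "t \<in> {0..T} - N0" "t \<in> {0..T} - N1" "t \<in> {0..T} - N2" by auto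
    have ut: "u t \<in> U" and dx: "(x has_vector_derivative (f (x t) (u t) - \<gamma> *\<^sub>R G \<gamma> (x t))) (at t within {0..T})"
      using derx[OF t'(3)] xC[OF t'(1)] by auto
    obtain \<zeta> where wt: "w t \<in> U" and z: "\<zeta> \<in> clarke_normal_cone C (y t)" "norm \<zeta> \<le> M"
      and dy: "(y has_vector_derivative (f (y t) (w t) - \<zeta>)) (at t within {0..T})" using dery[OF t'(4)] by blast
    define e where "e = x t - y t"
    define D where "D = (f (x t) (u t) - \<gamma> *\<^sub>R G \<gamma> (x t) - (f (y t) (w t) - \<zeta>)) \<bullet> (2 *\<^sub>R e)"
    have "(q has_real_derivative D) (at t within {0..T})"
      unfolding q_def D_def e_def
      by (rule gderiv_vector_derivative[OF gd]) (intro has_vector_derivative_diff dx dy)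
    moreover have "D \<le> a t * q t + b t"
    proof -
      have qe: "q t = (norm e)\<^sup>2" by (simp add: q_def e_def power2_norm_eq_inner)
      have "(f (x t) (u t) - f (y t) (u t)) \<bullet> e \<le> norm (f (x t) (u t) - f (y t) (u t)) * norm e" by (rule norm_cauchy_schwarz)
      also have "\<dots> \<le> (M * norm e) * norm e"
        using lipschitz_on_normD[OF f_lip[OF ut] xC[OF t'(1)] yC[OF t'(1)]] by (intro mult_right_mono) (auto simp: e_def)
      finally have 1: "(f (x t) (u t) - f (y t) (u t)) \<bullet> e \<le> M * q t" by (simp add: qe power2_eq_square mult.assoc)
      have "(f (y t) (u t) - f (y t) (w t)) \<bullet> e \<le> norm (f (y t) (u t) - f (y t) (w t)) * norm e" by (rule norm_cauchy_schwarz)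
      also have "\<dots> \<le> \<rho> t * d" using \<rho>(4)[OF t'(2)] \<rho>(2)[OF t'(1)] d[OF xC[OF t'(1)] yC[OF t'(1)]]
        by (intro mult_mono) (auto simp: e_def)
      finally have 2: "(f (y t) (u t) - f (y t) (w t)) \<bullet> e \<le> d * \<rho> t" by (simp add: mult.commute)
      have "\<zeta> \<bullet> e \<le> (M\<psi> / (2 * \<eta>)) * norm \<zeta> * (norm e)\<^sup>2"
        using z(1) clarke_normal_cone_iff[OF yC[OF t'(1)], of \<zeta>] xC[OF t'(1)] by (simp add: e_def)
      also have "\<dots> \<le> (M\<psi> / (2 * \<eta>)) * M * (norm e)\<^sup>2"
        using z(2) Mpsi_pos eta_pos by (intro mult_right_mono mult_left_mono) auto
      finally have 3: "\<zeta> \<bullet> e \<le> M * M\<psi> / (2 * \<eta>) * q t" by (simp add: qe mult.commute)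
      have "(y t - x t) \<bullet> (\<gamma> *\<^sub>R G \<gamma> (x t)) \<le> (real r + p t) / sqrt \<gamma> + M\<psi> * p t * (norm (y t - x t))\<^sup>2"
        unfolding p_def by (rule inner_penalty_le[OF g xC[OF t'(1)] yC[OF t'(1)]])
      moreover have "norm (y t - x t) = norm e" by (simp add: e_def norm_minus_commute)
      moreover have "(y t - x t) \<bullet> (\<gamma> *\<^sub>R G \<gamma> (x t)) = - ((\<gamma> *\<^sub>R G \<gamma> (x t)) \<bullet> e)"
      proof -
        have "y t - x t = - e" by (simp add: e_def)
        then show ?thesis by (simp add: inner_commute[of e])
      qed
      ultimately have 4: "- ((\<gamma> *\<^sub>R G \<gamma> (x t)) \<bullet> e) \<le> (real r + p t) / sqrt \<gamma> + M\<psi> * p t * q t" by (simp add: qe)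
      \<comment> \<open>Adding and subtracting \<open>f (y t) (u t)\<close> splits the difference of
        the fields into a Lipschitz part and the control discrepancy along \<open>y\<close>.\<close>
      have "D = 2 * ((f (x t) (u t) - f (y t) (u t)) \<bullet> e + (f (y t) (u t) - f (y t) (w t)) \<bullet> e + \<zeta> \<bullet> e + (- ((\<gamma> *\<^sub>R G \<gamma> (x t)) \<bullet> e)))"
        by (simp add: D_def inner_diff_left inner_add_left)
      also have "\<dots> \<le> 2 * (M * q t + d * \<rho> t + M * M\<psi> / (2 * \<eta>) * q t + ((real r + p t) / sqrt \<gamma> + M\<psi> * p t * q t))"
        using 1 2 3 4 by (intro mult_left_mono add_mono) auto
      also have "\<dots> = a t * q t + b t"
        by (simp add: a_def b_def distrib_right distrib_left add_divide_distrib)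
      finally show ?thesis .
    qed
    ultimately show "\<exists>D. (q has_real_derivative D) (at t within {0..T}) \<and> D \<le> a t * q t + b t" by blast
  qed
  also have "integral {0..T} a = T * (2 * M + M * M\<psi> / \<eta>) + 2 * M\<psi> * integral {0..T} p"
  proof -
    have "integral {0..T} a = integral {0..T} (\<lambda>t. 2 * M + M * M\<psi> / \<eta>) + integral {0..T} (\<lambda>t. 2 * M\<psi> * p t)"
      unfolding a_def using contp by (intro integral_add integrable_continuous_interval continuous_intros)
    then show ?thesis using T_pos by (simp only: integral_mult_right integral_const_real) simp
  qed
  also have "integral {0..T} b = 2 * d * integral {0..T} \<rho> + 2 * (real r * T + integral {0..T} p) / sqrt \<gamma>"
  proof -
    have "integral {0..T} b = integral {0..T} (\<lambda>t. 2 * d * \<rho> t) + integral {0..T} (\<lambda>t. 2 * (real r + p t) / sqrt \<gamma>)"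
      unfolding b_def by (rule integral_add[OF intb1 intb2])
    moreover have "integral {0..T} (\<lambda>t. 2 * (real r + p t) / sqrt \<gamma>) = 2 * (real r * T + integral {0..T} p) / sqrt \<gamma>"
    proof -
      have "integral {0..T} (\<lambda>t. real r + p t) = integral {0..T} (\<lambda>t. real r) + integral {0..T} p"
        using contp by (intro integral_add integrable_continuous_interval continuous_intros)
      moreover have "integral {0..T} (\<lambda>t. (2 / sqrt \<gamma>) * (real r + p t)) = (2 / sqrt \<gamma>) * integral {0..T} (\<lambda>t. real r + p t)"
        by (rule integral_mult_right)
      ultimately show ?thesis using T_pos by (simp add: mult.commute)
    qed
    ultimately show ?thesis by (simp only: integral_mult_right)
  qed
  also have "exp (T * (2 * M + M * M\<psi> / \<eta>) + 2 * M\<psi> * integral {0..T} p) *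
      (q 0 + (2 * d * integral {0..T} \<rho> + 2 * (real r * T + integral {0..T} p) / sqrt \<gamma>))
    \<le> exp (T * (2 * M + M * M\<psi> / \<eta>) + 2 * M\<psi> * B) * (q 0 + (2 * d * integral {0..T} \<rho> + 2 * (real r * T + B) / sqrt \<gamma>))"
  proof (rule mult_mono)
    have pB: "integral {0..T} p \<le> B" using B by (simp add: p_def)
    have pi0: "integral {0..T} p \<ge> 0" using p0 by (intro integral_nonneg[OF pint]) auto
    show "exp (T * (2 * M + M * M\<psi> / \<eta>) + 2 * M\<psi> * integral {0..T} p) \<le> exp (T * (2 * M + M * M\<psi> / \<eta>) + 2 * M\<psi> * B)"
      using pB Mpsi_pos by simp
    show "q 0 + (2 * d * integral {0..T} \<rho> + 2 * (real r * T + integral {0..T} p) / sqrt \<gamma>)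
        \<le> q 0 + (2 * d * integral {0..T} \<rho> + 2 * (real r * T + B) / sqrt \<gamma>)"
      using pB g by (intro add_left_mono divide_right_mono) auto
    have "integral {0..T} \<rho> \<ge> 0" using \<rho> by (intro integral_nonneg) auto
    then show "0 \<le> q 0 + (2 * d * integral {0..T} \<rho> + 2 * (real r * T + integral {0..T} p) / sqrt \<gamma>)"
      using d0 pi0 T_pos g by (intro add_nonneg_nonneg divide_nonneg_nonneg mult_nonneg_nonneg) (auto simp: q_def)
  qed auto
  finally show ?thesis by (simp add: q_def power2_norm_eq_inner)
qed

end

subsection \<open>Existence of penalized trajectories\<close>

text \<open>McShane's extension, an infimum of cones of slope \<open>L\<close> erected over the
  graph.\<close>

lemma lipschitz_extension_real:
  fixes g :: "'a::metric_space \<Rightarrow> real"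
  assumes lip: "L-lipschitz_on S g" and "S \<noteq> {}"
  shows "\<exists>h. L-lipschitz_on UNIV h \<and> (\<forall>x\<in>S. h x = g x)"
proof -
  have "L \<ge> 0" using lip by (rule lipschitz_on_nonneg)
  \<comment> \<open>Makes the infimum finite and, at a point of \<open>S\<close>, no smaller than
    the given value.\<close>
  have lower: "g y0 - L * dist x y0 \<le> g y + L * dist x y" if "y0 \<in> S" "y \<in> S" for x y0 y
  proof -
    have "g y0 - g y \<le> L * dist y0 y" using lipschitz_onD[OF lip that] by (simp add: dist_real_def abs_le_iff)
    also have "\<dots> \<le> L * (dist x y0 + dist x y)"
      using dist_triangle3[of y0 y x] \<open>L \<ge> 0\<close> by (intro mult_left_mono) auto
    finally show ?thesis by (simp add: algebra_simps)
  qed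
  obtain y0 where y0: "y0 \<in> S" using \<open>S \<noteq> {}\<close> by blast
  have bdd: "bdd_below ((\<lambda>y. g y + L * dist x y) ` S)" for x
    using lower[OF y0] by (intro bdd_belowI2)
  define h where "h = (\<lambda>x. INF y\<in>S. g y + L * dist x y)"
  have le: "h x \<le> h x' + L * dist x x'" for x x'
  proof -
    have "h x - L * dist x x' \<le> g y + L * dist x' y" if "y \<in> S" for y
    proof -
      have "h x \<le> g y + L * dist x y" unfolding h_def using bdd that by (rule cINF_lower)
      also have "\<dots> \<le> g y + L * (dist x x' + dist x' y)"
        using dist_triangle[of x y x'] \<open>L \<ge> 0\<close> by (intro add_left_mono mult_left_mono)
      finally show ?thesis by (simp add: algebra_simps)
    qed
    then have "h x - L * dist x x' \<le> (INF y\<in>S. g y + L * dist x' y)" using \<open>S \<noteq> {}\<close> by (intro cINF_greatest)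
    then show ?thesis by (simp add: h_def)
  qed
  have "L-lipschitz_on UNIV h"
  proof (rule lipschitz_onI[OF _ \<open>L \<ge> 0\<close>])
    show "dist (h x) (h x') \<le> L * dist x x'" for x x'
      using le[of x x'] le[of x' x] by (simp add: dist_real_def abs_le_iff dist_commute)
  qed
  moreover have "h x = g x" if "x \<in> S" for x
  proof (rule antisym)
    show "h x \<le> g x" unfolding h_def using cINF_lower[OF bdd that, of x] by simp
    show "g x \<le> h x" unfolding h_def using lower[OF that, of _ x] \<open>S \<noteq> {}\<close> by (intro cINF_greatest) auto
  qed
  ultimately show ?thesis by blast
qed

text \<open>The extension is done coordinatewise. The additional factor \<open>DIM('b)\<close> is
  harmless, as the constant serves only the existence of solutions.\<close>

lemma lipschitz_extension:
  fixes g :: "'a::metric_space \<Rightarrow> 'b::euclidean_space"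
  assumes lip: "L-lipschitz_on S g" and "S \<noteq> {}"
  shows "\<exists>h. (real DIM('b) * L)-lipschitz_on UNIV h \<and> (\<forall>x\<in>S. h x = g x)"
proof -
  have "L \<ge> 0" using lip by (rule lipschitz_on_nonneg)
  have "\<exists>h. L-lipschitz_on UNIV h \<and> (\<forall>x\<in>S. h x = g x \<bullet> b)" if b: "b \<in> Basis" for b
  proof (rule lipschitz_extension_real[OF lipschitz_onI[OF _ \<open>L \<ge> 0\<close>] \<open>S \<noteq> {}\<close>])
    fix x y assume "x \<in> S" "y \<in> S"
    then have "norm (g x - g y) \<le> L * dist x y" using lipschitz_onD[OF lip] by (simp add: dist_norm)
    then show "dist (g x \<bullet> b) (g y \<bullet> b) \<le> L * dist x y"
      using Basis_le_norm[OF b, of "g x - g y"] by (simp add: dist_real_def inner_diff_left)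
  qed
  then obtain H where H: "\<And>b. b \<in> Basis \<Longrightarrow> L-lipschitz_on UNIV (H b)" "\<And>b x. b \<in> Basis \<Longrightarrow> x \<in> S \<Longrightarrow> H b x = g x \<bullet> b"
    by metis
  define h where "h = (\<lambda>x. \<Sum>b\<in>Basis. H b x *\<^sub>R b)"
  have "(real DIM('b) * L)-lipschitz_on UNIV h"
  proof (rule lipschitz_onI)
    fix x y
    have "norm (h x - h y) = norm (\<Sum>b\<in>Basis. (H b x - H b y) *\<^sub>R b)"
      by (simp add: h_def sum_subtractf scaleR_diff_left)
    also have "\<dots> \<le> (\<Sum>b\<in>(Basis::'b set). L * dist x y)"
      using lipschitz_onD[OF H(1)] by (intro sum_norm_le) (simp add: dist_real_def)
    finally show "dist (h x) (h y) \<le> (real DIM('b) * L) * dist x y" by (simp add: dist_norm)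
  qed (use \<open>L \<ge> 0\<close> in simp)
  moreover have "h x = g x" if "x \<in> S" for x
    using H(2)[OF _ that] by (simp add: h_def euclidean_representation)
  ultimately show ?thesis by blast
qed

text \<open>The weight exp (2 * L * t) turns successive approximation into a contraction by 1/2 on
  the whole interval, whatever its length. The field need only be integrable along continuous
  curves, which admits jumps of the control in time.\<close>

lemma picard_solution:
  fixes F :: "real \<Rightarrow> 'a::euclidean_space \<Rightarrow> 'a"
  assumes lip: "\<And>t. t \<in> {0..T} \<Longrightarrow> L-lipschitz_on UNIV (F t)" and "T \<ge> 0"
    and int: "\<And>x. continuous_on {0..T} x \<Longrightarrow> (\<lambda>t. F t (x t)) integrable_on {0..T}"
  obtains x where "continuous_on {0..T} x" "\<And>t. t \<in> {0..T} \<Longrightarrow> x t = z + integral {0..t} (\<lambda>s. F s (x s))"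
proof -
  have "L \<ge> 0" using lip[of 0] \<open>T \<ge> 0\<close> lipschitz_on_nonneg by auto
  define X where "X = rec_nat (\<lambda>t::real. z) (\<lambda>n Y t. z + integral {0..t} (\<lambda>s. F s (Y s)))"
  have X0: "X 0 = (\<lambda>t. z)" and XS: "X (Suc n) = (\<lambda>t. z + integral {0..t} (\<lambda>s. F s (X n s)))" for n
    by (simp_all add: X_def)
  have contX: "continuous_on {0..T} (X n)" for n
  proof (induction n)
    case (Suc n)
    show ?case unfolding XS by (intro continuous_intros indefinite_integral_continuous_1 int Suc)
  qed (simp add: X0)
  have intX: "(\<lambda>s. F s (Y s)) integrable_on {0..t}" if "continuous_on {0..T} Y" "t \<in> {0..T}" for Y t
    using int[OF that(1)] by (rule integrable_on_subinterval) (use that in auto)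
  have "bounded ((\<lambda>t. X 1 t - X 0 t) ` {0..T})"
    using contX[of 1] contX[of 0] by (intro compact_imp_bounded compact_continuous_image continuous_intros) auto
  then obtain A where "\<forall>w\<in>(\<lambda>t. X 1 t - X 0 t) ` {0..T}. norm w \<le> A" unfolding bounded_iff by (elim exE)
  then have A: "norm (X 1 t - X 0 t) \<le> A" if "t \<in> {0..T}" for t using that by auto
  have "A \<ge> 0" using A[of 0] \<open>T \<ge> 0\<close> by (smt (verit) atLeastAtMost_iff norm_ge_zero)
  have step: "norm (X (Suc n) t - X n t) \<le> A * (1/2)^n * exp (2 * L * t)" if "t \<in> {0..T}" for n t
    using that
  proof (induction n arbitrary: t)
    case 0
    have "A * 1 \<le> A * exp (2 * L * t)" using \<open>A \<ge> 0\<close> \<open>L \<ge> 0\<close> 0 by (intro mult_left_mono) auto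
    then show ?case using A[OF 0] by simp
  next
    case (Suc n)
    \<comment> \<open>An antiderivative of \<open>L\<close> times the inductive bound; the exponent
      \<open>2 * L\<close> is what produces the new factor 1/2.\<close>
    define p where "p = (\<lambda>s. A * (1/2)^Suc n * exp (2 * L * s))"
    have "((\<lambda>s. L * (A * (1/2)^n * exp (2 * L * s))) has_integral p t - p 0) {0..t}"
    proof (rule fundamental_theorem_of_calculus)
      fix s assume "s \<in> {0..t}"
      show "(p has_vector_derivative L * (A * (1/2)^n * exp (2 * L * s))) (at s within {0..t})"
        unfolding p_def has_real_derivative_iff_has_vector_derivative[symmetric]
        by (auto intro!: derivative_eq_intros)
    qed (use Suc.prems in auto)
    note P = this
    have "X (Suc (Suc n)) t - X (Suc n) t = integral {0..t} (\<lambda>s. F s (X (Suc n) s) - F s (X n s))"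
      using fun_cong[OF XS[of "Suc n"], of t] fun_cong[OF XS[of n], of t]
      by (subst integral_diff[OF intX[OF contX Suc.prems] intX[OF contX Suc.prems]]) simp
    also have "norm \<dots> \<le> integral {0..t} (\<lambda>s. L * (A * (1/2)^n * exp (2 * L * s)))"
    proof (rule integral_norm_bound_integral)
      show "(\<lambda>s. F s (X (Suc n) s) - F s (X n s)) integrable_on {0..t}"
        using intX[OF contX Suc.prems] by (intro integrable_diff)
      show "(\<lambda>s. L * (A * (1/2)^n * exp (2 * L * s))) integrable_on {0..t}" using P by blast
      fix s assume s: "s \<in> {0..t}"
      then have s': "s \<in> {0..T}" using Suc.prems by auto
      have "norm (F s (X (Suc n) s) - F s (X n s)) \<le> L * norm (X (Suc n) s - X n s)"
        using lipschitz_onD[OF lip[OF s']] by (simp add: dist_norm)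
      also have "\<dots> \<le> L * (A * (1/2)^n * exp (2 * L * s))" using Suc.IH[OF s'] \<open>L \<ge> 0\<close> by (rule mult_left_mono)
      finally show "norm (F s (X (Suc n) s) - F s (X n s)) \<le> L * (A * (1/2)^n * exp (2 * L * s))" .
    qed
    also have "\<dots> = p t - p 0" using P by (rule integral_unique)
    also have "\<dots> \<le> p t" using \<open>A \<ge> 0\<close> by (simp add: p_def)
    finally show ?case by (simp add: p_def)
  qed
  define d where "d = (\<lambda>n t. X (Suc n) t - X n t)"
  \<comment> \<open>The limit is written as a telescoping series so that the Weierstrass test gives
    uniform convergence.\<close>
  define x where "x = (\<lambda>t. z + (\<Sum>i. d i t))"
  have "uniform_limit {0..T} (\<lambda>n t. \<Sum>i<n. d i t) (\<lambda>t. \<Sum>i. d i t) sequentially"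
  proof (rule Weierstrass_m_test)
    fix n t assume t: "t \<in> {0..T}"
    have "norm (d n t) \<le> A * (1/2)^n * exp (2 * L * t)" unfolding d_def by (rule step[OF t])
    also have "\<dots> \<le> A * (1/2)^n * exp (2 * L * T)" using \<open>A \<ge> 0\<close> \<open>L \<ge> 0\<close> t by (intro mult_left_mono) (auto intro: mult_left_mono)
    finally show "norm (d n t) \<le> A * (1/2)^n * exp (2 * L * T)" .
  qed (intro summable_mult2 summable_mult summable_geometric, simp)
  then have "uniform_limit {0..T} (\<lambda>n t. z + (\<Sum>i<n. d i t)) x sequentially"
    unfolding x_def by (intro uniform_limit_intros)
  moreover have "z + (\<Sum>i<n. d i t) = X n t" for n t
    unfolding d_def using sum_lessThan_telescope[of "\<lambda>n. X n t" n] by (simp add: X0)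
  ultimately have lim: "uniform_limit {0..T} X x sequentially" by simp
  have contx: "continuous_on {0..T} x"
    by (rule uniform_limit_theorem[OF _ lim]) (auto simp: contX)
  have "x t = z + integral {0..t} (\<lambda>s. F s (x s))" if t: "t \<in> {0..T}" for t
  proof -
    have "(\<lambda>n. X (Suc n) t) \<longlonglongrightarrow> x t" using tendsto_uniform_limitI[OF lim t] by (rule LIMSEQ_Suc)
    moreover have "(\<lambda>n. X (Suc n) t) \<longlonglongrightarrow> z + integral {0..t} (\<lambda>s. F s (x s))"
    proof (rule metric_LIMSEQ_I)
      fix e :: real assume "e > 0"
      define e' where "e' = e / (L * T + 1)"
      have LT: "L * T + 1 > 0" using \<open>L \<ge> 0\<close> \<open>T \<ge> 0\<close> by (simp add: add_nonneg_pos)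
      have "e' > 0" using \<open>e > 0\<close> LT by (simp add: e'_def)
      obtain n0 where n0: "\<And>n s. n \<ge> n0 \<Longrightarrow> s \<in> {0..T} \<Longrightarrow> dist (X n s) (x s) < e'"
        using uniform_limitD[OF lim \<open>e' > 0\<close>] unfolding eventually_sequentially by blast
      have "dist (X (Suc n) t) (z + integral {0..t} (\<lambda>s. F s (x s))) < e" if "n \<ge> n0" for n
      proof -
        have "X (Suc n) t - (z + integral {0..t} (\<lambda>s. F s (x s))) = integral {0..t} (\<lambda>s. F s (X n s) - F s (x s))"
          unfolding XS using intX[OF contX t] intX[OF contx t] by (subst integral_diff) auto
        also have "norm \<dots> \<le> integral {0..t} (\<lambda>s. L * e')"
        proof (rule integral_norm_bound_integral)
          show "(\<lambda>s. F s (X n s) - F s (x s)) integrable_on {0..t}"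
            using intX[OF contX t] intX[OF contx t] by (intro integrable_diff)
          fix s assume s: "s \<in> {0..t}"
          then have s': "s \<in> {0..T}" using t by auto
          have "norm (F s (X n s) - F s (x s)) \<le> L * dist (X n s) (x s)"
            using lipschitz_onD[OF lip[OF s']] by (simp add: dist_norm)
          also have "\<dots> \<le> L * e'" using n0[OF that s'] \<open>L \<ge> 0\<close> by (intro mult_left_mono) auto
          finally show "norm (F s (X n s) - F s (x s)) \<le> L * e'" .
        qed (rule integrable_const_ivl)
        also have "\<dots> = (L * t) * e'" using t by simp
        also have "\<dots> \<le> (L * T) * e'" using t \<open>L \<ge> 0\<close> \<open>e' > 0\<close> by (intro mult_right_mono mult_left_mono) auto
        also have "\<dots> < (L * T + 1) * e'" using \<open>e' > 0\<close> by (simp add: algebra_simps)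
        also have "\<dots> = e" using LT by (simp add: e'_def)
        finally show ?thesis by (simp add: dist_norm)
      qed
      then show "\<exists>n0. \<forall>n\<ge>n0. dist (X (Suc n) t) (z + integral {0..t} (\<lambda>s. F s (x s))) < e" by blast
    qed
    ultimately show ?thesis by (rule LIMSEQ_unique)
  qed
  with contx show thesis using that by blast
qed

section \<open>Grids and measurability of piecewise constant controls\<close>

lemma integrable_on_grid:
  fixes g :: "real \<Rightarrow> 'a::banach"
  assumes "h \<ge> 0" "\<And>j. j \<in> {1..N} \<Longrightarrow> g integrable_on {(real j - 1) * h..real j * h}"
  shows "g integrable_on {0..real N * h}"
  using assms(2)
proof (induction N)
  case (Suc N)
  have "g integrable_on {0..real N * h}" by (rule Suc.IH) (use Suc.prems in auto)
  moreover have "g integrable_on {real N * h..real (Suc N) * h}" using Suc.prems[of "Suc N"] by simp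
  moreover have "0 \<le> real N * h" "real N * h \<le> real (Suc N) * h"
    using \<open>h \<ge> 0\<close> by (auto intro: mult_right_mono)
  ultimately show ?case using Henstock_Kurzweil_Integration.integrable_combine by blast
qed (use integrable_on_refl[of g 0] in simp)

lemma grid_cell:
  fixes h T t :: real
  assumes "h > 0" "real N * h = T" "t \<in> {0..<T}"
  obtains j where "j \<in> {1..N}" "t \<in> {(real j - 1) * h..<real j * h}"
proof -
  define k where "k = nat \<lfloor>t / h\<rfloor>"
  have "t / h \<ge> 0" using assms by simp
  then have k: "real k \<le> t / h" "t / h < real k + 1" unfolding k_def by linarith+
  then have k': "real k * h \<le> t" "t < (real k + 1) * h" using assms(1) by (simp_all add: field_simps)
  then have "real k * h < real N * h" using assms by simp
  then have "k < N" using assms(1) by simp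
  then show thesis using that[of "Suc k"] k' by (auto simp: algebra_simps)
qed

lemma pc_controls_in:
  assumes u: "u \<in> pc_controls T U N" and "N \<ge> 1" "T > 0" and t: "t \<in> {0..<T}"
  shows "u t \<in> U"
proof -
  obtain c where c: "\<And>j. j \<in> {1..N} \<Longrightarrow> c j \<in> U"
    "\<And>j t. j \<in> {1..N} \<Longrightarrow> t \<in> {(real j - 1) * (T / real N)..<real j * (T / real N)} \<Longrightarrow> u t = c j"
    using u unfolding pc_controls_def by blast
  obtain j where "j \<in> {1..N}" "t \<in> {(real j - 1) * (T / real N)..<real j * (T / real N)}"
    using grid_cell[of "T / real N" N T t] assms by auto
  then show ?thesis using c(1) c(2) by metis
qed

lemma pc_controls_AE:
  assumes "u \<in> pc_controls T U N" "N \<ge> 1" "T > 0"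
  shows "AE t in lebesgue_on {0..T}. u t \<in> U"
  using pc_controls_in[OF assms] by (intro AE_lebesgue_on_Icc_I[of "{T}"]) auto

lemma pc_controls_subset_controls:
  fixes u :: "real \<Rightarrow> 'b::euclidean_space"
  assumes u: "u \<in> pc_controls T U N" and N: "N \<ge> 1" and "T > 0"
  shows "u \<in> controls T U"
proof -
  obtain c where c: "\<And>j. j \<in> {1..N} \<Longrightarrow> c j \<in> U"
    "\<And>j t. j \<in> {1..N} \<Longrightarrow> t \<in> {(real j - 1) * (T / real N)..<real j * (T / real N)} \<Longrightarrow> u t = c j"
    using u unfolding pc_controls_def by blast
  define h where "h = T / real N"
  have "h > 0" using N \<open>T > 0\<close> by (simp add: h_def)
  \<comment> \<open>A formula by rounding shows measurability. Cells are numbered from 1, whence the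
    shift, and the free value at \<open>T\<close> is treated apart.\<close>
  define v where "v = (\<lambda>t. if t = T then u T else c (nat \<lfloor>t / h\<rfloor> + 1))"
  have "(\<lambda>t. nat \<lfloor>t / h\<rfloor> + 1) \<in> borel \<rightarrow>\<^sub>M count_space UNIV" by measurable
  then have "(\<lambda>t. c (nat \<lfloor>t / h\<rfloor> + 1)) \<in> borel_measurable borel"
    by (rule measurable_compose) simp
  then have "v \<in> borel_measurable borel" unfolding v_def by (intro measurable_If) auto
  then have "v \<in> borel_measurable (lebesgue_on {0..T})"
    by (intro measurable_restrict_space1 measurable_completion) simp
  moreover have "v t = u t" if "t \<in> {0..T}" for t
  proof (cases "t = T")
    case False
    then have "t \<in> {0..<T}" using that by auto
    moreover have "real N * h = T" using N by (simp add: h_def)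
    ultimately obtain j where j: "j \<in> {1..N}" "t \<in> {(real j - 1) * h..<real j * h}"
      using grid_cell[OF \<open>h > 0\<close>] by blast
    have "real j - 1 \<le> t / h" "t / h < real j" using j(2) \<open>h > 0\<close> by (simp_all add: field_simps)
    then have "\<lfloor>t / h\<rfloor> = int j - 1" by (intro floor_unique) auto
    then have "nat \<lfloor>t / h\<rfloor> + 1 = j" using j(1) by auto
    then show ?thesis using c(2)[OF j(1)] j(2) False by (simp add: v_def h_def)
  qed (simp add: v_def)
  ultimately have "u \<in> borel_measurable (lebesgue_on {0..T})"
    using measurable_cong[of "lebesgue_on {0..T}" v u borel] by simp
  then show ?thesis using pc_controls_AE[OF assms] by (simp add: controls_def)
qed

section \<open>Extension of the penalized field beyond \<open>C\<close>\<close>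

context sweeping_control
begin

lemma gderiv_exp_psi:
  assumes "i \<in> {1..r}"
  shows "GDERIV (\<lambda>x. exp (\<gamma> * \<psi> i x)) x :> \<gamma> *\<^sub>R (exp (\<gamma> * \<psi> i x) *\<^sub>R grad (\<psi> i) x)"
  using gderiv_psi[OF assms, of x] unfolding gderiv_def by (auto intro!: derivative_eq_intros)

text \<open>The exponential factors are Lipschitz on the convex hull by the mean value inequality,
  and on \<open>C\<close> they are at most 1. The constant depends on \<gamma>, but it serves only
  solvability at fixed \<gamma>.\<close>

lemma G_lipschitz_on_C:
  assumes "\<gamma> > 0"
  obtains K where "K-lipschitz_on C (G \<gamma>)"
proof -
  obtain L where "L > 0" and L: "\<And>x i. x \<in> C \<Longrightarrow> i \<in> {1..r} \<Longrightarrow> norm (grad (\<psi> i) x) \<le> L"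
    using grad_bounded_on_C by blast
  have "\<exists>K\<ge>0. \<forall>x\<in>C. \<forall>y\<in>C. \<bar>exp (\<gamma> * \<psi> i x) - exp (\<gamma> * \<psi> i y)\<bar> \<le> K * norm (x - y)" if i: "i \<in> {1..r}" for i
  proof -
    define D where "D = (\<lambda>x. \<gamma> *\<^sub>R (exp (\<gamma> * \<psi> i x) *\<^sub>R grad (\<psi> i) x))"
    have "continuous_on UNIV D" unfolding D_def using continuous_psi[OF i] continuous_grad[OF i] by (intro continuous_intros)
    then have "compact (D ` (convex hull C))"
      using compact_convex_hull[OF compact_C] by (intro compact_continuous_image) (auto intro: continuous_on_subset)
    then have "bounded (D ` (convex hull C))" by (rule compact_imp_bounded)
    then obtain B where "\<forall>w\<in>D ` (convex hull C). norm w \<le> B" unfolding bounded_iff by (elim exE)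
    then have B: "norm (D x) \<le> B" if "x \<in> convex hull C" for x using that by auto
    have "(max B 0)-lipschitz_on (convex hull C) (\<lambda>x. exp (\<gamma> * \<psi> i x))"
    proof (rule bounded_derivative_imp_lipschitz[where f' = "\<lambda>x h. h \<bullet> D x"])
      show "((\<lambda>x. exp (\<gamma> * \<psi> i x)) has_derivative (\<lambda>h. h \<bullet> D x)) (at x within convex hull C)" for x
        using gderiv_exp_psi[OF i, of \<gamma> x] unfolding gderiv_def D_def by (rule has_derivative_at_withinI)
      show "onorm (\<lambda>h. h \<bullet> D x) \<le> max B 0" if "x \<in> convex hull C" for x
      proof (rule onorm_le)
        fix h
        have "norm (h \<bullet> D x) \<le> norm h * norm (D x)" using Cauchy_Schwarz_ineq2 by auto
        also have "\<dots> \<le> norm h * max B 0" using B[OF that] by (intro mult_left_mono) auto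
        finally show "norm (h \<bullet> D x) \<le> max B 0 * norm h" by (simp add: mult.commute)
      qed
    qed auto
    then have "\<bar>exp (\<gamma> * \<psi> i x) - exp (\<gamma> * \<psi> i y)\<bar> \<le> max B 0 * norm (x - y)" if "x \<in> C" "y \<in> C" for x y
      using lipschitz_onD[of "max B 0" "convex hull C" "\<lambda>x. exp (\<gamma> * \<psi> i x)" x y] that
      by (simp add: hull_inc dist_norm dist_real_def)
    then show ?thesis by (intro exI[of _ "max B 0"]) auto
  qed
  then obtain K where K: "\<And>i. i \<in> {1..r} \<Longrightarrow> K i \<ge> 0"
    "\<And>i x y. i \<in> {1..r} \<Longrightarrow> x \<in> C \<Longrightarrow> y \<in> C \<Longrightarrow> \<bar>exp (\<gamma> * \<psi> i x) - exp (\<gamma> * \<psi> i y)\<bar> \<le> K i * norm (x - y)"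
    by metis
  have "(\<Sum>i\<in>{1..r}. 2 * M\<psi> + K i * L)-lipschitz_on C (G \<gamma>)"
  proof (rule lipschitz_onI)
    fix x y assume xy: "x \<in> C" "y \<in> C"
    have "norm (G \<gamma> x - G \<gamma> y) = norm (\<Sum>i\<in>{1..r}. exp (\<gamma> * \<psi> i x) *\<^sub>R grad (\<psi> i) x - exp (\<gamma> * \<psi> i y) *\<^sub>R grad (\<psi> i) y)"
      by (simp add: G_def sum_subtractf)
    also have "\<dots> \<le> (\<Sum>i\<in>{1..r}. (2 * M\<psi> + K i * L) * norm (x - y))"
    proof (rule sum_norm_le)
      fix i assume i: "i \<in> {1..r}"
      have "exp (\<gamma> * \<psi> i x) *\<^sub>R grad (\<psi> i) x - exp (\<gamma> * \<psi> i y) *\<^sub>R grad (\<psi> i) y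
          = exp (\<gamma> * \<psi> i x) *\<^sub>R (grad (\<psi> i) x - grad (\<psi> i) y) + (exp (\<gamma> * \<psi> i x) - exp (\<gamma> * \<psi> i y)) *\<^sub>R grad (\<psi> i) y"
        by (simp add: algebra_simps)
      also have "norm \<dots> \<le> exp (\<gamma> * \<psi> i x) * norm (grad (\<psi> i) x - grad (\<psi> i) y) + \<bar>exp (\<gamma> * \<psi> i x) - exp (\<gamma> * \<psi> i y)\<bar> * norm (grad (\<psi> i) y)"
        by (rule order_trans[OF norm_triangle_ineq]) simp
      also have "\<dots> \<le> 1 * (2 * M\<psi> * norm (x - y)) + K i * norm (x - y) * L"
      proof (intro add_mono mult_mono)
        have "\<psi> i x \<le> 0" using xy i mem_C_iff by blast
        then show "exp (\<gamma> * \<psi> i x) \<le> 1" using assms by (simp add: mult_nonneg_nonpos)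
        show "norm (grad (\<psi> i) x - grad (\<psi> i) y) \<le> 2 * M\<psi> * norm (x - y)"
          using lipschitz_onD[OF Mpsi_lip[OF i], of x y] xy by (simp add: hull_inc dist_norm)
      qed (use K i xy L in auto)
      finally show "norm (exp (\<gamma> * \<psi> i x) *\<^sub>R grad (\<psi> i) x - exp (\<gamma> * \<psi> i y) *\<^sub>R grad (\<psi> i) y) \<le> (2 * M\<psi> + K i * L) * norm (x - y)"
        by (simp add: algebra_simps)
    qed
    finally show "dist (G \<gamma> x) (G \<gamma> y) \<le> (\<Sum>i\<in>{1..r}. 2 * M\<psi> + K i * L) * dist x y"
      by (simp add: dist_norm sum_distrib_right)
  next
    show "0 \<le> (\<Sum>i\<in>{1..r}. 2 * M\<psi> + K i * L)" using K(1) Mpsi_pos \<open>L > 0\<close> by (intro sum_nonneg) auto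
  qed
  then show thesis using that by blast
qed

text \<open>The Lipschitz bounds hold on \<open>C\<close>, so for each control value the whole field
  is extended from \<open>C\<close> to the space and the extended equation is solved. The solution
  satisfies the true equation whenever it lies in \<open>C\<close>, which is what
  \<open>pen_sol\<close> records; invariance later keeps it there for suitable initial
  points.\<close>

lemma penalized_solution_exists:
  assumes g: "\<gamma> > 0" and u: "u \<in> pc_controls T U N" and N: "N \<ge> 1"
  obtains x where "pen_sol \<gamma> u x" "x 0 = z"
proof -
  define h where "h = T / real N"
  have h: "h > 0" "real N * h = T" using N T_pos by (simp_all add: h_def)
  obtain c where c: "\<And>j. j \<in> {1..N} \<Longrightarrow> c j \<in> U"
    "\<And>j t. j \<in> {1..N} \<Longrightarrow> t \<in> {(real j - 1) * h..<real j * h} \<Longrightarrow> u t = c j"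
    using u unfolding pc_controls_def h_def by blast
  obtain K where K: "K-lipschitz_on C (G \<gamma>)" using G_lipschitz_on_C[OF g] by blast
  define L where "L = real DIM('a) * (M + \<bar>\<gamma>\<bar> * K)"
  have "\<exists>E. L-lipschitz_on UNIV E \<and> (\<forall>x\<in>C. E x = f x v - \<gamma> *\<^sub>R G \<gamma> x)" if "v \<in> U" for v
    unfolding L_def using f_lip[OF that] K by (intro lipschitz_extension C_ne lipschitz_intros)
  then obtain E where E: "\<And>v. v \<in> U \<Longrightarrow> L-lipschitz_on UNIV (E v)" "\<And>v x. v \<in> U \<Longrightarrow> x \<in> C \<Longrightarrow> E v x = f x v - \<gamma> *\<^sub>R G \<gamma> x"
    by metis
  obtain v0 where v0: "v0 \<in> U" using U_ne by blast
  \<comment> \<open>At times where the control value is not in \<open>U\<close>, such as possibly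
    \<open>t = T\<close>, a fixed value from \<open>U\<close> keeps the field Lipschitz.\<close>
  define F where "F = (\<lambda>t. if u t \<in> U then E (u t) else E v0)"
  have Flip: "L-lipschitz_on UNIV (F t)" for t using E(1) v0 by (simp add: F_def)
  have Fcell: "F t = E (c j)" if "j \<in> {1..N}" "t \<in> {(real j - 1) * h..<real j * h}" for j t
    using c(1)[OF that(1)] c(2)[OF that] by (simp add: F_def)
  have Econt: "continuous_on S (\<lambda>t. E (c j) (x t))" if "j \<in> {1..N}" "continuous_on S x" for S :: "real set" and x j
    by (rule continuous_on_compose2[OF lipschitz_on_continuous_on[OF E(1)[OF c(1)[OF that(1)]]] that(2)]) simp
  have cells: "{(real j - 1) * h..real j * h} \<subseteq> {0..T}" if "j \<in> {1..N}" for j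
  proof -
    have "real j * h \<le> real N * h" using that h(1) by (intro mult_right_mono) auto
    moreover have "0 \<le> (real j - 1) * h" using that h(1) by (intro mult_nonneg_nonneg) auto
    ultimately show ?thesis using h(2) by auto
  qed
  have Fint: "(\<lambda>t. F t (x t)) integrable_on {0..T}" if x: "continuous_on {0..T} x" for x
  proof -
    have "(\<lambda>t. F t (x t)) integrable_on {(real j - 1) * h..real j * h}" if j: "j \<in> {1..N}" for j
    proof -
      have "(\<lambda>t. E (c j) (x t)) integrable_on {(real j - 1) * h..real j * h}"
        using x cells[OF j] by (intro integrable_continuous_interval Econt[OF j]) (auto intro: continuous_on_subset)
      then show ?thesis
        by (rule integrable_spike_finite[of "{real j * h}", rotated 2]) (use Fcell[OF j] in auto)
    qed
    then show ?thesis using integrable_on_grid[of h N "\<lambda>t. F t (x t)"] h by simp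
  qed
  obtain x where contx: "continuous_on {0..T} x" and x: "\<And>t. t \<in> {0..T} \<Longrightarrow> x t = z + integral {0..t} (\<lambda>s. F s (x s))"
    using picard_solution[of T L F z] Flip Fint T_pos by (metis less_imp_le)
  obtain c0 where c0: "c0 \<in> C" using C_ne by blast
  have "bounded (x ` {0..T})" using contx by (intro compact_imp_bounded compact_continuous_image) auto
  then obtain A where "\<forall>w\<in>x ` {0..T}. norm w \<le> A" unfolding bounded_iff by (elim exE)
  then have A: "norm (x t) \<le> A" if "t \<in> {0..T}" for t using that by auto
  define B where "B = (M + \<gamma> * norm (G \<gamma> c0)) + L * (A + norm c0)"
  have L0: "L \<ge> 0" using Flip lipschitz_on_nonneg by blast
  have FB: "norm (F t (x t)) \<le> B" if "t \<in> {0..T}" for t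
  proof -
    have "\<exists>v. v \<in> U \<and> F t = E v" using v0 by (cases "u t \<in> U") (auto simp: F_def)
    then obtain v where v: "v \<in> U" "F t = E v" by blast
    have "norm (F t (x t)) \<le> norm (F t c0) + norm (F t (x t) - F t c0)" by (rule norm_triangle_sub)
    also have "\<dots> \<le> (M + \<gamma> * norm (G \<gamma> c0)) + L * (A + norm c0)"
    proof (rule add_mono)
      have "norm (F t c0) \<le> norm (f c0 v) + norm (\<gamma> *\<^sub>R G \<gamma> c0)" using norm_triangle_ineq4[of "f c0 v" "\<gamma> *\<^sub>R G \<gamma> c0"] by (simp only: E(2)[OF v(1) c0] v(2))
      then show "norm (F t c0) \<le> M + \<gamma> * norm (G \<gamma> c0)" using f_bound[OF c0 v(1)] g by simp
      have "norm (F t (x t) - F t c0) \<le> L * norm (x t - c0)" using lipschitz_onD[OF Flip] by (simp add: dist_norm)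
      also have "\<dots> \<le> L * (A + norm c0)"
        using norm_triangle_ineq4[of "x t" c0] A[OF that] L0 by (intro mult_left_mono) auto
      finally show "norm (F t (x t) - F t c0) \<le> L * (A + norm c0)" .
    qed
    finally show ?thesis by (simp add: B_def)
  qed
  have "B \<ge> 0" using FB[of 0] T_pos by (smt (verit) atLeastAtMost_iff norm_ge_zero)
  have lipx: "norm (x t - x s) \<le> B * (t - s)" if "0 \<le> s" "s \<le> t" "t \<le> T" for s t
  proof -
    have i: "(\<lambda>s. F s (x s)) integrable_on {0..t}" using Fint[OF contx] by (rule integrable_on_subinterval) (use that in auto)
    have "x t - x s = integral {s..t} (\<lambda>s. F s (x s))"
      using x[of t] x[of s] Henstock_Kurzweil_Integration.integral_combine[OF that(1,2) i] that by (simp add: algebra_simps)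
    also have "norm \<dots> \<le> integral {s..t} (\<lambda>_. B)"
    proof (rule integral_norm_bound_integral)
      show "(\<lambda>s. F s (x s)) integrable_on {s..t}" using i by (rule integrable_on_subinterval) (use that in auto)
    qed (use FB that in auto)
    finally show ?thesis using that by (simp add: mult.commute)
  qed
  have "B-lipschitz_on {0..T} x"
  proof (rule lipschitz_onI[OF _ \<open>B \<ge> 0\<close>])
    fix s t assume "s \<in> {0..T}" "t \<in> {0..T}"
    then show "dist (x s) (x t) \<le> B * dist s t"
      using lipx[of s t] lipx[of t s] by (cases "s \<le> t") (auto simp: dist_norm norm_minus_commute)
  qed
  then have acx: "abs_cont_on 0 T x" by (rule lipschitz_on_imp_abs_cont_on)
  \<comment> \<open>Differentiating the integral equation requires continuity of the integrand,
    which is available away from the switching times.\<close>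
  define grid where "grid = (\<lambda>j. real j * h) ` {0..N}"
  have "negligible grid" unfolding grid_def by (intro negligible_finite) auto
  moreover have "u t \<in> U \<and> (x t \<in> C \<longrightarrow> (x has_vector_derivative f (x t) (u t) - \<gamma> *\<^sub>R G \<gamma> (x t)) (at t within {0..T}))"
    if t: "t \<in> {0..T} - grid" for t
  proof -
    have "T \<in> grid" unfolding grid_def using h(2) by (intro image_eqI[of _ _ N]) auto
    then have "t \<noteq> T" using t by blast
    then have "t \<in> {0..<T}" using t by auto
    then obtain j where j: "j \<in> {1..N}" "t \<in> {(real j - 1) * h..<real j * h}" using grid_cell[OF h(1,2)] by blast
    have "real (j - 1) * h \<in> grid" unfolding grid_def using j(1) by (intro imageI) auto
    moreover have "real (j - 1) = real j - 1" using j(1) by (simp add: of_nat_diff)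
    ultimately have "(real j - 1) * h \<in> grid" by (simp only:)
    then have "t \<noteq> (real j - 1) * h" using t by blast
    moreover have "(real j - 1) * h \<le> t" "t < real j * h" using j(2) by (simp_all only: atLeastLessThan_iff)
    ultimately have t': "(real j - 1) * h < t" "t < real j * h" by (simp_all only: order_less_le) blast+
    show ?thesis
    proof (intro conjI impI)
      show uU: "u t \<in> U" using c(1)[OF j(1)] c(2)[OF j] by simp
      assume xC: "x t \<in> C"
      have tT: "t \<in> {0..T}" using t by blast
      have "continuous (at t within {0..T}) (\<lambda>s. E (c j) (x s))"
        using Econt[OF j(1) contx] tT by (simp add: continuous_on_eq_continuous_within)
      moreover have "\<forall>\<^sub>F s in at t within {0..T}. E (c j) (x s) = F s (x s)"
      proof -
        have "\<forall>\<^sub>F s in at t within {0..T}. s \<in> {(real j - 1) * h<..<real j * h}"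
        proof -
          have "\<forall>\<^sub>F s in nhds t. s \<in> {(real j - 1) * h<..<real j * h}"
            by (rule eventually_nhds_in_open) (use t' in simp_all)
          then show ?thesis unfolding eventually_at_filter by eventually_elim blast
        qed
        then show ?thesis by eventually_elim (use Fcell[OF j(1)] in auto)
      qed
      ultimately have "continuous (at t within {0..T}) (\<lambda>s. F s (x s))"
        unfolding continuous_within using Fcell[OF j] by (auto intro: Lim_transform_eventually)
      then have "((\<lambda>s. integral {0..s} (\<lambda>s. F s (x s))) has_vector_derivative F t (x t)) (at t within {0..T})"
        using integral_has_vector_derivative_continuous_at[OF Fint[OF contx], of t "{}"] tT by simp
      then have "((\<lambda>s. z + integral {0..s} (\<lambda>s. F s (x s))) has_vector_derivative F t (x t)) (at t within {0..T})"
        by (auto intro!: derivative_eq_intros)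
      then have "(x has_vector_derivative F t (x t)) (at t within {0..T})"
        by (rule has_vector_derivative_transform[OF tT, rotated]) (use x in auto)
      moreover have "F t (x t) = f (x t) (u t) - \<gamma> *\<^sub>R G \<gamma> (x t)" using E(2)[OF uU xC] uU by (simp add: F_def)
      ultimately show "(x has_vector_derivative f (x t) (u t) - \<gamma> *\<^sub>R G \<gamma> (x t)) (at t within {0..T})" by simp
    qed
  qed
  ultimately have "pen_sol \<gamma> u x" unfolding pen_sol_def using acx by blast
  moreover have "x 0 = z" using x[of 0] T_pos by simp
  ultimately show thesis using that by blast
qed

lemma solves_Dpen_imp_pen_sol:
  assumes "solves_Dpen T f r \<psi> \<gamma> z u x" "AE t in lebesgue_on {0..T}. u t \<in> U"
  shows "pen_sol \<gamma> u x"
proof -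
  have "AE t in lebesgue_on {0..T}. (x has_vector_derivative (f (x t) (u t) - \<gamma> *\<^sub>R G \<gamma> (x t))) (at t within {0..T})"
    using assms(1) unfolding solves_Dpen_def drift_eq by blast
  then obtain N1 where N1: "negligible N1" "\<And>t. t \<in> {0..T} - N1 \<Longrightarrow> (x has_vector_derivative (f (x t) (u t) - \<gamma> *\<^sub>R G \<gamma> (x t))) (at t within {0..T})"
    by (rule AE_lebesgue_onE) blast
  obtain N2 where N2: "negligible N2" "\<And>t. t \<in> {0..T} - N2 \<Longrightarrow> u t \<in> U"
    using assms(2) by (rule AE_lebesgue_onE) blast
  have "negligible (N1 \<union> N2)" using N1(1) N2(1) by (rule negligible_Un)
  then show ?thesis unfolding pen_sol_def using assms(1) N1(2) N2(2)
    by (intro conjI exI[of _ "N1 \<union> N2"]) (auto simp: solves_Dpen_def)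
qed

lemma pen_sol_imp_solves_Dpen:
  assumes "pen_sol \<gamma> u x" "\<And>t. t \<in> {0..T} \<Longrightarrow> x t \<in> C"
  shows "solves_Dpen T f r \<psi> \<gamma> (x 0) u x"
proof -
  obtain N where N: "negligible N" "\<And>t. t \<in> {0..T} - N \<Longrightarrow> u t \<in> U \<and>
     (x t \<in> C \<longrightarrow> (x has_vector_derivative (f (x t) (u t) - \<gamma> *\<^sub>R G \<gamma> (x t))) (at t within {0..T}))"
    using assms(1) unfolding pen_sol_def by blast
  show ?thesis unfolding solves_Dpen_def drift_eq
    using assms N by (intro conjI AE_lebesgue_on_Icc_I[OF N(1)]) (auto simp: pen_sol_def)
qed

end

subsection \<open>Approximation by piecewise constant controls\<close>

lemma bounded_measurable_integrable_on:
  fixes g :: "real \<Rightarrow> real"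
  assumes "g \<in> borel_measurable (lebesgue_on {a..b})" "AE t in lebesgue_on {a..b}. \<bar>g t\<bar> \<le> B"
  shows "integrable (lebesgue_on {a..b}) g" "g integrable_on {a..b}"
proof -
  have "finite_measure (lebesgue_on {a..b})"
    using lmeasurable_cbox[of a b] by (intro finite_measure_lebesgue_on) simp
  then show *: "integrable (lebesgue_on {a..b}) g"
    by (rule finite_measure.integrable_const_bound[where B = B]) (use assms in auto)
  show "g integrable_on {a..b}" by (rule integrable_on_lebesgue_on[OF *]) simp
qed

text \<open>A measurable function is an almost everywhere limit of continuous ones. Projecting these
  onto the ball of radius \<open>R\<close> keeps them continuous, leaves the limit unchanged and
  supplies the bound for dominated convergence.\<close>

lemma continuous_L1_approximation:
  fixes u :: "real \<Rightarrow> 'b::euclidean_space"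
  assumes u: "u \<in> borel_measurable (lebesgue_on {a..b})" and R: "AE t in lebesgue_on {a..b}. norm (u t) \<le> R" "R \<ge> 0"
    and "\<epsilon> > 0"
  obtains w where "continuous_on UNIV w" "\<And>t. norm (w t) \<le> R" "(\<lambda>t. norm (u t - w t)) integrable_on {a..b}"
    "integral {a..b} (\<lambda>t. norm (u t - w t)) < \<epsilon>"
proof -
  have "u measurable_on {a..b}" using u by (subst measurable_on_iff_borel_measurable) auto
  then obtain N g where N: "negligible N" and g: "\<And>n. continuous_on UNIV (g n)"
    "\<And>x. x \<notin> N \<Longrightarrow> (\<lambda>n. g n x) \<longlonglongrightarrow> (if x \<in> {a..b} then u x else 0)"
    unfolding measurable_on_def by blast
  define w where "w = (\<lambda>n t. closest_point (cball 0 R) (g n t))"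
  have cp: "continuous_on UNIV (closest_point (cball 0 R :: 'b set))"
    using R(2) by (intro continuous_on_closest_point) auto
  have w: "continuous_on UNIV (w n)" for n unfolding w_def
    by (rule continuous_on_compose2[OF cp g(1)]) simp
  have wR: "norm (w n t) \<le> R" for n t
    using closest_point_in_set[of "cball 0 R" "g n t"] R(2) by (simp add: w_def)
  have meas: "(\<lambda>t. norm (u t - w n t)) \<in> borel_measurable (lebesgue_on {a..b})" for n
  proof -
    have "w n \<in> borel_measurable (lebesgue_on {a..b})"
      by (intro continuous_imp_measurable_on_sets_lebesgue continuous_on_subset[OF w]) auto
    note this[measurable] u[measurable]
    show ?thesis by measurable
  qed
  have bnd: "AE t in lebesgue_on {a..b}. norm (norm (u t - w n t)) \<le> 2 * R" for n
    using R(1)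
  proof eventually_elim
    case (elim t)
    then show ?case using norm_triangle_ineq4[of "u t" "w n t"] wR[of n t] by simp
  qed
  have "(\<lambda>n. integral\<^sup>L (lebesgue_on {a..b}) (\<lambda>t. norm (u t - w n t))) \<longlonglongrightarrow> integral\<^sup>L (lebesgue_on {a..b}) (\<lambda>t. 0)"
  proof (rule integral_dominated_convergence[where w = "\<lambda>t. 2 * R"])
    have "AE t in lebesgue_on {a..b}. t \<notin> N" using N by (intro AE_lebesgue_on_Icc_I[of N]) auto
    moreover have "AE t in lebesgue_on {a..b}. t \<in> {a..b}" by (intro AE_lebesgue_on_Icc_I[of "{}"]) auto
    ultimately show "AE t in lebesgue_on {a..b}. (\<lambda>n. norm (u t - w n t)) \<longlonglongrightarrow> 0"
      using R(1)
    proof eventually_elim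
      case (elim t)
      have "isCont (closest_point (cball 0 R)) (u t)" using cp by (simp add: continuous_on_eq_continuous_at)
      moreover have "(\<lambda>n. g n t) \<longlonglongrightarrow> u t" using g(2)[OF elim(1)] elim(2) by simp
      ultimately have "(\<lambda>n. w n t) \<longlonglongrightarrow> closest_point (cball 0 R) (u t)" unfolding w_def by (rule isCont_tendsto_compose)
      then have "(\<lambda>n. w n t) \<longlonglongrightarrow> u t" using elim(3) by (simp add: closest_point_self)
      then have "(\<lambda>n. norm (u t - w n t)) \<longlonglongrightarrow> norm (u t - u t)" by (intro tendsto_intros)
      then show ?case by simp
    qed
  qed (use meas bnd in auto)
  then have "\<forall>\<^sub>F n in sequentially. integral\<^sup>L (lebesgue_on {a..b}) (\<lambda>t. norm (u t - w n t)) < \<epsilon>"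
    using \<open>\<epsilon> > 0\<close> by (intro order_tendstoD(2)) auto
  then obtain n where n: "integral\<^sup>L (lebesgue_on {a..b}) (\<lambda>t. norm (u t - w n t)) < \<epsilon>"
    unfolding eventually_sequentially by blast
  have int: "integrable (lebesgue_on {a..b}) (\<lambda>t. norm (u t - w n t))" "(\<lambda>t. norm (u t - w n t)) integrable_on {a..b}"
    using bounded_measurable_integrable_on[OF meas[of n], of "2 * R"] bnd[of n] by simp_all
  have "integral {a..b} (\<lambda>t. norm (u t - w n t)) < \<epsilon>"
    using n lebesgue_integral_eq_integral[OF int(1)] by simp
  then show thesis using that[OF w wR int(2)] by blast
qed

text \<open>Provides a sample point at which the function essentially does not exceed its mean, off
  a given null set. The slack \<delta> replaces the discussion of equality.\<close>

lemma exists_below_average: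
  fixes \<phi> :: "real \<Rightarrow> real"
  assumes int: "\<phi> integrable_on {a..b}" and "a < b" and N: "negligible N" and "\<delta> > 0"
  obtains t where "t \<in> {a..<b}" "t \<notin> N" "(b - a) * \<phi> t \<le> integral {a..b} \<phi> + \<delta>"
proof (rule ccontr)
  assume no: "\<not> thesis"
  note found = that
  have neg: "(b - a) * \<phi> t > integral {a..b} \<phi> + \<delta>" if "t \<in> {a..<b}" "t \<notin> N" for t
    using no found[OF that] by (meson not_le)
  define m where "m = (integral {a..b} \<phi> + \<delta>) / (b - a)"
  \<comment> \<open>On the null set and at the excluded endpoint the value \<open>m\<close> makes
    the lower bound hold everywhere without changing the integral.\<close>
  define g where "g = (\<lambda>t. if t \<in> insert b N then m else \<phi> t)"
  have N': "negligible (insert b N)" using N by simp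
  have "integral {a..b} g = integral {a..b} \<phi>" by (rule integral_spike[OF N']) (auto simp: g_def)
  moreover have "g integrable_on {a..b}" using int by (rule integrable_spike[OF _ N']) (auto simp: g_def)
  moreover have "m \<le> g t" if "t \<in> {a..b}" for t
  proof (cases "t \<in> insert b N")
    case False
    then have "(b - a) * \<phi> t > integral {a..b} \<phi> + \<delta>" using neg[of t] that by auto
    then show ?thesis using \<open>a < b\<close> False by (simp add: g_def m_def divide_le_eq mult.commute)
  qed (simp add: g_def)
  ultimately have "integral {a..b} (\<lambda>t. m) \<le> integral {a..b} \<phi>"
    using integral_le[of "\<lambda>t. m" "{a..b}" g] by (simp add: integrable_const_ivl)
  then show False using \<open>a < b\<close> \<open>\<delta> > 0\<close> by (simp add: m_def)
qed

lemma grid_index: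
  fixes h t :: real
  assumes "h > 0" "j \<ge> 1" "t \<in> {(real j - 1) * h..<real j * h}"
  shows "nat \<lfloor>t / h\<rfloor> + 1 = j"
proof -
  have "real j - 1 \<le> t / h" "t / h < real j" using assms(1,3) by (simp_all add: field_simps)
  then have "\<lfloor>t / h\<rfloor> = int j - 1" by (intro floor_unique) auto
  then show ?thesis using assms(2) by auto
qed

lemma integral_grid_le:
  fixes g k :: "real \<Rightarrow> real"
  assumes "h \<ge> 0" "g integrable_on {0..real N * h}" "k integrable_on {0..real N * h}"
    and le: "\<And>j. j \<in> {1..N} \<Longrightarrow> integral {(real j - 1) * h..real j * h} g \<le> integral {(real j - 1) * h..real j * h} k"
  shows "integral {0..real N * h} g \<le> integral {0..real N * h} k"
  using assms(2-)
proof (induction N)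
  case (Suc N)
  have ord: "0 \<le> real N * h" "real N * h \<le> real (Suc N) * h" using \<open>h \<ge> 0\<close> by (auto intro: mult_right_mono)
  have sub: "g integrable_on {0..real N * h}" "k integrable_on {0..real N * h}"
    using Suc.prems(1,2) ord by (auto intro: integrable_on_subinterval)
  have "integral {0..real N * h} g \<le> integral {0..real N * h} k" by (rule Suc.IH[OF sub]) (use Suc.prems(3) in auto)
  moreover have "integral {real N * h..real (Suc N) * h} g \<le> integral {real N * h..real (Suc N) * h} k"
    using Suc.prems(3)[of "Suc N"] by simp
  ultimately show ?case
    using Henstock_Kurzweil_Integration.integral_combine[OF ord Suc.prems(1)] Henstock_Kurzweil_Integration.integral_combine[OF ord Suc.prems(2)]
    by linarith
qed simp

text \<open>As \<open>U\<close> need not be convex, cell averages of \<open>u\<close> could leave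
  it. The value on a cell is therefore taken from \<open>u\<close> itself, at a point where the
  deviation from a continuous approximation \<open>w\<close> is, up to a small slack, at most its
  mean.\<close>

lemma pc_controls_L1_dense:
  fixes u :: "real \<Rightarrow> 'b::euclidean_space"
  assumes u: "u \<in> controls T U" and U: "bounded U" and "T > 0" "\<epsilon> > 0"
  obtains N0 where "\<And>N. N \<ge> N0 \<Longrightarrow> N \<ge> 1 \<Longrightarrow> \<exists>v\<in>pc_controls T U N.
    (\<lambda>t. norm (v t - u t)) integrable_on {0..T} \<and> integral {0..T} (\<lambda>t. norm (v t - u t)) \<le> \<epsilon>"
proof -
  obtain R where R: "\<And>x. x \<in> U \<Longrightarrow> norm x \<le> R" "R \<ge> 0" using U unfolding bounded_pos by (metis less_imp_le)
  have um: "u \<in> borel_measurable (lebesgue_on {0..T})" and uU: "AE t in lebesgue_on {0..T}. u t \<in> U"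
    using u by (auto simp: controls_def)
  have uR: "AE t in lebesgue_on {0..T}. norm (u t) \<le> R" using uU by eventually_elim (rule R(1))
  obtain N1 where N1: "negligible N1" "\<And>t. t \<in> {0..T} - N1 \<Longrightarrow> u t \<in> U" using uU by (rule AE_lebesgue_onE) blast
  have "\<epsilon> / 4 > 0" using \<open>\<epsilon> > 0\<close> by simp
  then obtain w where w: "continuous_on UNIV w" "(\<lambda>t. norm (u t - w t)) integrable_on {0..T}"
    "integral {0..T} (\<lambda>t. norm (u t - w t)) < \<epsilon> / 4"
    using continuous_L1_approximation[OF um uR R(2)] by metis
  define \<phi> where "\<phi> = (\<lambda>t. norm (u t - w t))"
  \<comment> \<open>The error budget: \<open>2 * \<phi>\<close> integrates to at most
    \<open>\<epsilon> / 2\<close>, and the constant \<open>2 * e\<close> to exactly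
    \<open>\<epsilon> / 2\<close>.\<close>
  define e where "e = \<epsilon> / (4 * T)"
  have "e > 0" using \<open>\<epsilon> > 0\<close> \<open>T > 0\<close> by (simp add: e_def)
  have "uniformly_continuous_on {0..T} w"
    using w(1) by (intro compact_uniformly_continuous) (auto intro: continuous_on_subset)
  then obtain d where "d > 0" and d: "\<And>s t. s \<in> {0..T} \<Longrightarrow> t \<in> {0..T} \<Longrightarrow> dist s t < d \<Longrightarrow> dist (w s) (w t) < e"
    using \<open>e > 0\<close> unfolding uniformly_continuous_on_def by blast
  obtain N0 where N0: "T / d < real N0" using reals_Archimedean2 by blast
  have "\<exists>v\<in>pc_controls T U N. (\<lambda>t. norm (v t - u t)) integrable_on {0..T} \<and> integral {0..T} (\<lambda>t. norm (v t - u t)) \<le> \<epsilon>"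
    if "N \<ge> N0" "N \<ge> 1" for N
  proof -
    define h where "h = T / real N"
    have h: "h > 0" "real N * h = T" using that \<open>T > 0\<close> by (simp_all add: h_def)
    have "T < real N0 * d" using N0 \<open>d > 0\<close> by (simp add: divide_less_eq)
    also have "\<dots> \<le> real N * d" using that \<open>d > 0\<close> by (intro mult_right_mono) auto
    finally have "h < d" using that by (simp add: h_def divide_less_eq mult.commute)
    have cells: "{(real j - 1) * h..real j * h} \<subseteq> {0..T}" if "j \<in> {1..N}" for j
    proof -
      have "real j * h \<le> real N * h" using that h(1) by (intro mult_right_mono) auto
      moreover have "0 \<le> (real j - 1) * h" using that h(1) by (intro mult_nonneg_nonneg) auto
      ultimately show ?thesis using h(2) by auto
    qed
    have len: "real j * h - (real j - 1) * h = h" for j by (simp add: algebra_simps)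
    have \<phi>int: "\<phi> integrable_on {(real j - 1) * h..real j * h}" if "j \<in> {1..N}" for j
      using w(2) cells[OF that] unfolding \<phi>_def by (rule integrable_on_subinterval)
    \<comment> \<open>Avoiding \<open>N1\<close> puts the sampled value into \<open>U\<close>; the
      slack \<open>h * e\<close> per cell adds up to \<open>e * T\<close>.\<close>
    have "\<exists>t. t \<in> {(real j - 1) * h..<real j * h} \<and> u t \<in> U \<and> h * \<phi> t \<le> integral {(real j - 1) * h..real j * h} \<phi> + h * e"
      if j: "j \<in> {1..N}" for j
    proof -
      have "(real j - 1) * h < real j * h" using h(1) by simp
      then obtain t where t: "t \<in> {(real j - 1) * h..<real j * h}" "t \<notin> N1"
        "(real j * h - (real j - 1) * h) * \<phi> t \<le> integral {(real j - 1) * h..real j * h} \<phi> + h * e"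
        using exists_below_average[OF \<phi>int[OF j] _ N1(1), of "h * e"] h(1) \<open>e > 0\<close> by (metis mult_pos_pos)
      have "t \<in> {0..T} - N1" using t(1,2) cells[OF j] by auto
      then show ?thesis using N1(2) t(1,3) unfolding len by blast
    qed
    then obtain \<tau> where \<tau>: "\<And>j. j \<in> {1..N} \<Longrightarrow> \<tau> j \<in> {(real j - 1) * h..<real j * h}"
      "\<And>j. j \<in> {1..N} \<Longrightarrow> u (\<tau> j) \<in> U" "\<And>j. j \<in> {1..N} \<Longrightarrow> h * \<phi> (\<tau> j) \<le> integral {(real j - 1) * h..real j * h} \<phi> + h * e"
      by metis
    define v where "v = (\<lambda>t. u (\<tau> (nat \<lfloor>t / h\<rfloor> + 1)))"
    have vcell: "v t = u (\<tau> j)" if "j \<in> {1..N}" "t \<in> {(real j - 1) * h..<real j * h}" for j t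
      using grid_index[OF h(1) _ that(2)] that(1) by (simp add: v_def)
    have vpc: "v \<in> pc_controls T U N"
      unfolding pc_controls_def h_def[symmetric] using vcell \<tau>(2) by (intro CollectI exI[of _ "\<lambda>j. u (\<tau> j)"]) auto
    then have "v \<in> controls T U" by (rule pc_controls_subset_controls) (use that \<open>T > 0\<close> in auto)
    then have vm: "v \<in> borel_measurable (lebesgue_on {0..T})" and vU: "AE t in lebesgue_on {0..T}. v t \<in> U"
      by (auto simp: controls_def)
    have int: "(\<lambda>t. norm (v t - u t)) integrable_on {0..T}"
    proof (rule bounded_measurable_integrable_on(2))
      show "(\<lambda>t. norm (v t - u t)) \<in> borel_measurable (lebesgue_on {0..T})"
      proof -
        note um[measurable] vm[measurable]
        show ?thesis by measurable
      qed
      show "AE t in lebesgue_on {0..T}. \<bar>norm (v t - u t)\<bar> \<le> 2 * R"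
        using uU vU
      proof eventually_elim
        case (elim t)
        then show ?case using R(1)[of "u t"] R(1)[of "v t"] norm_triangle_ineq4[of "v t" "u t"] by simp
      qed
    qed
    have kint: "(\<lambda>t. 2 * \<phi> t + 2 * e) integrable_on {0..T}"
      using w(2) unfolding \<phi>_def by (intro integrable_add integrable_on_cmult_left[where c = 2, simplified] integrable_const_ivl)
    have "integral {0..real N * h} (\<lambda>t. norm (v t - u t)) \<le> integral {0..real N * h} (\<lambda>t. 2 * \<phi> t + 2 * e)"
    proof (rule integral_grid_le)
      fix j assume j: "j \<in> {1..N}"
      let ?I = "{(real j - 1) * h..real j * h}"
      have "integral ?I (\<lambda>t. norm (v t - u t)) \<le> integral ?I (\<lambda>t. (\<phi> (\<tau> j) + e) + \<phi> t)"
      proof -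
        define g where "g = (\<lambda>t. if t = real j * h then 0 else norm (v t - u t))"
        have "integral ?I (\<lambda>t. norm (v t - u t)) = integral ?I g"
          by (rule integral_spike[of "{real j * h}"]) (auto simp: g_def)
        also have "\<dots> \<le> integral ?I (\<lambda>t. (\<phi> (\<tau> j) + e) + \<phi> t)"
        proof (rule integral_le)
          have "(\<lambda>t. norm (v t - u t)) integrable_on ?I" using int cells[OF j] by (rule integrable_on_subinterval)
          then show "g integrable_on ?I" by (rule integrable_spike[of _ _ "{real j * h}"]) (auto simp: g_def)
          show "(\<lambda>t. (\<phi> (\<tau> j) + e) + \<phi> t) integrable_on ?I" by (intro integrable_add integrable_const_ivl \<phi>int[OF j])
          fix t assume t: "t \<in> ?I"
          show "g t \<le> (\<phi> (\<tau> j) + e) + \<phi> t"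
          proof (cases "t = real j * h")
            case True
            then show ?thesis using \<open>e > 0\<close> by (simp add: g_def \<phi>_def)
          next
            case False
            then have t': "t \<in> {(real j - 1) * h..<real j * h}" using t by auto
            have "dist (\<tau> j) t < d" using \<tau>(1)[OF j] t' len[of j] \<open>h < d\<close> by (simp add: dist_real_def abs_less_iff)
            moreover have "\<tau> j \<in> {0..T}" "t \<in> {0..T}" using cells[OF j] \<tau>(1)[OF j] t by auto
            ultimately have "dist (w (\<tau> j)) (w t) < e" using d by blast
            moreover have "norm (v t - u t) \<le> norm (u (\<tau> j) - w (\<tau> j)) + dist (w (\<tau> j)) (w t) + norm (u t - w t)"
            proof -
              have "v t - u t = (u (\<tau> j) - w (\<tau> j)) + (w (\<tau> j) - w t) - (u t - w t)" using vcell[OF j t'] by simp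
              then show ?thesis
                using norm_triangle_ineq4[of "(u (\<tau> j) - w (\<tau> j)) + (w (\<tau> j) - w t)" "u t - w t"]
                  norm_triangle_ineq[of "u (\<tau> j) - w (\<tau> j)" "w (\<tau> j) - w t"] by (simp add: dist_norm)
            qed
            ultimately show ?thesis using False by (simp add: g_def \<phi>_def)
          qed
        qed
        finally show ?thesis .
      qed
      also have "\<dots> = h * (\<phi> (\<tau> j) + e) + integral ?I \<phi>"
      proof -
        have "integral ?I (\<lambda>t. (\<phi> (\<tau> j) + e) + \<phi> t) = integral ?I (\<lambda>t. \<phi> (\<tau> j) + e) + integral ?I \<phi>"
          by (rule integral_add[OF integrable_const_ivl \<phi>int[OF j]])
        then show ?thesis using h(1) by (simp add: algebra_simps)
      qed
      also have "\<dots> \<le> 2 * integral ?I \<phi> + 2 * (h * e)" using \<tau>(3)[OF j] by (simp add: algebra_simps)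
      also have "\<dots> = integral ?I (\<lambda>t. 2 * \<phi> t + 2 * e)"
      proof -
        have "integral ?I (\<lambda>t. 2 * \<phi> t + 2 * e) = integral ?I (\<lambda>t. 2 * \<phi> t) + integral ?I (\<lambda>t. 2 * e)"
          by (rule integral_add[OF integrable_on_cmult_left[where c = 2, simplified, OF \<phi>int[OF j]] integrable_const_ivl])
        then show ?thesis using h(1) by (simp add: algebra_simps)
      qed
      finally show "integral ?I (\<lambda>t. norm (v t - u t)) \<le> integral ?I (\<lambda>t. 2 * \<phi> t + 2 * e)" .
    qed (use h int kint in auto)
    also have "\<dots> = 2 * integral {0..T} \<phi> + 2 * e * T"
    proof -
      have "integral {0..T} (\<lambda>t. 2 * \<phi> t + 2 * e) = integral {0..T} (\<lambda>t. 2 * \<phi> t) + integral {0..T} (\<lambda>t. 2 * e)"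
        using w(2) unfolding \<phi>_def by (rule integral_add[OF integrable_on_cmult_left[where c = 2, simplified] integrable_const_ivl])
      then show ?thesis using h \<open>T > 0\<close> by simp
    qed
    also have "\<dots> \<le> \<epsilon>" using w(3) \<open>T > 0\<close> by (simp add: \<phi>_def e_def)
    finally show ?thesis using vpc int h(2) by auto
  qed
  then show thesis using that by blast
qed

context sweeping_control
begin

text \<open>Uniform continuity of \<open>f\<close> on the compact set \<open>C \<times> U\<close>
  yields an affine modulus \<open>e + K * norm (a - b)\<close>, which turns L^1 closeness of
  controls into L^1 closeness of velocities. The majorant \<rho> avoids discussing measurability of
  the velocity discrepancy.\<close>

lemma pc_controls_field_approximation:
  assumes y: "continuous_on {0..T} y" "\<And>t. t \<in> {0..T} \<Longrightarrow> y t \<in> C" and w: "w \<in> controls T U" and "\<epsilon> > 0"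
  obtains N0 where "\<And>N. N \<ge> N0 \<Longrightarrow> N \<ge> 1 \<Longrightarrow> \<exists>v\<in>pc_controls T U N. \<exists>\<rho> Z. \<rho> integrable_on {0..T} \<and>
     (\<forall>t\<in>{0..T}. \<rho> t \<ge> 0) \<and> negligible Z \<and> (\<forall>t\<in>{0..T} - Z. norm (f (y t) (v t) - f (y t) (w t)) \<le> \<rho> t) \<and>
     integral {0..T} \<rho> \<le> \<epsilon>"
proof -
  define e where "e = \<epsilon> / (2 * T)"
  have "e > 0" using \<open>\<epsilon> > 0\<close> T_pos by (simp add: e_def)
  have "uniformly_continuous_on (C \<times> U) (\<lambda>(x, u). f x u)"
    using f_cont by (rule compact_uniformly_continuous) (intro compact_Times compact_C U_compact)
  then obtain d where "d > 0" and d: "\<And>p q. p \<in> C \<times> U \<Longrightarrow> q \<in> C \<times> U \<Longrightarrow> dist p q < d \<Longrightarrow>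
      dist (case p of (x, u) \<Rightarrow> f x u) (case q of (x, u) \<Rightarrow> f x u) < e"
    using \<open>e > 0\<close> unfolding uniformly_continuous_on_def by blast
  \<comment> \<open>For controls at distance \<open>d\<close> or more the trivial bound
    \<open>2 * M\<close>, which equals \<open>K * d\<close>, is covered by the linear term.\<close>
  define K where "K = 2 * M / d"
  have "K > 0" using M_pos \<open>d > 0\<close> by (simp add: K_def)
  have modulus: "norm (f x a - f x b) \<le> e + K * norm (a - b)" if "x \<in> C" "a \<in> U" "b \<in> U" for x a b
  proof (cases "norm (a - b) < d")
    case True
    then have "norm (f x a - f x b) < e" using d[of "(x, a)" "(x, b)"] that by (simp add: dist_Pair_Pair dist_norm)
    then show ?thesis using \<open>K > 0\<close> by (smt (verit) mult_nonneg_nonneg norm_ge_zero)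
  next
    case False
    have "norm (f x a - f x b) \<le> 2 * M" using norm_triangle_ineq4[of "f x a" "f x b"] f_bound[OF that(1,2)] f_bound[OF that(1,3)] by linarith
    also have "\<dots> = K * d" using \<open>d > 0\<close> by (simp add: K_def)
    also have "\<dots> \<le> K * norm (a - b)" using False \<open>K > 0\<close> by (intro mult_left_mono) auto
    finally show ?thesis using \<open>e > 0\<close> by simp
  qed
  have pos: "\<epsilon> / (2 * K) > 0" using \<open>\<epsilon> > 0\<close> \<open>K > 0\<close> by simp
  obtain N0 where N0: "\<And>N. N \<ge> N0 \<Longrightarrow> N \<ge> 1 \<Longrightarrow> \<exists>v\<in>pc_controls T U N.
    (\<lambda>t. norm (v t - w t)) integrable_on {0..T} \<and> integral {0..T} (\<lambda>t. norm (v t - w t)) \<le> \<epsilon> / (2 * K)"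
    by (rule pc_controls_L1_dense[OF w compact_imp_bounded[OF U_compact] T_pos pos]) blast
  have wU: "AE t in lebesgue_on {0..T}. w t \<in> U" using w by (simp add: controls_def)
  show thesis
  proof (rule that[of N0])
    fix N assume N: "N \<ge> N0" "N \<ge> 1"
    obtain v where v: "v \<in> pc_controls T U N" "(\<lambda>t. norm (v t - w t)) integrable_on {0..T}"
      "integral {0..T} (\<lambda>t. norm (v t - w t)) \<le> \<epsilon> / (2 * K)" using N0[OF N] by blast
    obtain Z1 where Z1: "negligible Z1" "\<And>t. t \<in> {0..T} - Z1 \<Longrightarrow> w t \<in> U" using wU by (rule AE_lebesgue_onE) blast
    obtain Z2 where Z2: "negligible Z2" "\<And>t. t \<in> {0..T} - Z2 \<Longrightarrow> v t \<in> U"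
      using pc_controls_AE[OF v(1) N(2) T_pos] by (rule AE_lebesgue_onE) blast
    define \<rho> where "\<rho> = (\<lambda>t. e + K * norm (v t - w t))"
    have i: "(\<lambda>t. K * norm (v t - w t)) integrable_on {0..T}" using integrable_on_cmult_left[OF v(2), of K] by simp
    have "\<rho> integrable_on {0..T}" unfolding \<rho>_def by (intro integrable_add integrable_const_ivl i)
    moreover have "\<forall>t\<in>{0..T}. \<rho> t \<ge> 0" using \<open>e > 0\<close> \<open>K > 0\<close> by (simp add: \<rho>_def)
    moreover have "negligible (Z1 \<union> Z2)" using Z1(1) Z2(1) by (rule negligible_Un)
    moreover have "\<forall>t\<in>{0..T} - (Z1 \<union> Z2). norm (f (y t) (v t) - f (y t) (w t)) \<le> \<rho> t"
      unfolding \<rho>_def using modulus y(2) Z1(2) Z2(2) by blast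
    moreover have "integral {0..T} \<rho> \<le> \<epsilon>"
    proof -
      have "integral {0..T} \<rho> = integral {0..T} (\<lambda>t. e) + integral {0..T} (\<lambda>t. K * norm (v t - w t))"
        unfolding \<rho>_def by (rule integral_add[OF integrable_const_ivl i])
      also have "\<dots> = \<epsilon> / 2 + K * integral {0..T} (\<lambda>t. norm (v t - w t))" using T_pos by (simp add: e_def)
      also have "\<dots> \<le> \<epsilon> / 2 + K * (\<epsilon> / (2 * K))" using v(3) \<open>K > 0\<close> by (intro add_left_mono mult_left_mono) auto
      also have "\<dots> = \<epsilon>" using \<open>K > 0\<close> by simp
      finally show ?thesis .
    qed
    ultimately show "\<exists>v\<in>pc_controls T U N. \<exists>\<rho> Z. \<rho> integrable_on {0..T} \<and>
     (\<forall>t\<in>{0..T}. \<rho> t \<ge> 0) \<and> negligible Z \<and> (\<forall>t\<in>{0..T} - Z. norm (f (y t) (v t) - f (y t) (w t)) \<le> \<rho> t) \<and>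
     integral {0..T} \<rho> \<le> \<epsilon>" using v(1) by blast
  qed
qed

end

subsection \<open>Limits of sweeping trajectories\<close>

text \<open>If the mean slope lay outside \<open>K\<close>, a strictly separating linear functional
  would bound all derivatives from one side and, after integration, the mean slope as well.\<close>

lemma mean_value_closed_convex:
  fixes y :: "real \<Rightarrow> 'a::euclidean_space"
  assumes ac: "abs_cont_on a b y" and "a < b" and K: "closed K" "convex K" and N: "negligible N"
    and der: "\<And>t. t \<in> {a..b} - N \<Longrightarrow> \<exists>D\<in>K. (y has_vector_derivative D) (at t within {a..b})"
  shows "(y b - y a) /\<^sub>R (b - a) \<in> K"
proof (rule ccontr)
  assume "(y b - y a) /\<^sub>R (b - a) \<notin> K"
  then obtain v \<beta> where v: "v \<bullet> ((y b - y a) /\<^sub>R (b - a)) < \<beta>" "\<And>x. x \<in> K \<Longrightarrow> v \<bullet> x > \<beta>"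
    using separating_hyperplane_closed_point[OF K(2,1)] by blast
  have gd: "GDERIV (\<lambda>z. - (v \<bullet> z)) z :> - v" for z
    unfolding gderiv_def by (auto intro!: derivative_eq_intros simp: inner_commute)
  have "abs_cont_on a b (\<lambda>t. - (v \<bullet> y t))"
    by (rule abs_cont_on_compose_C1[OF ac gd]) (intro continuous_intros)
  then have "- (v \<bullet> y b) - - (v \<bullet> y a) \<le> integral {a..b} (\<lambda>_. - \<beta>)"
  proof (rule abs_cont_on_le_integral[OF _ _ N])
    fix t assume t: "t \<in> {a..b} - N"
    then obtain D where D: "D \<in> K" "(y has_vector_derivative D) (at t within {a..b})" using der by blast
    have "((\<lambda>t. - (v \<bullet> y t)) has_vector_derivative - (v \<bullet> D)) (at t within {a..b})"
      using D(2) by (auto intro!: derivative_eq_intros has_vector_derivative_minus bounded_linear.has_vector_derivative[OF bounded_linear_inner_right])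
    then have "((\<lambda>t. - (v \<bullet> y t)) has_real_derivative - (v \<bullet> D)) (at t within {a..b})"
      by (simp add: has_real_derivative_iff_has_vector_derivative)
    moreover have "- (v \<bullet> D) \<le> - \<beta>" using v(2)[OF D(1)] by simp
    ultimately show "\<exists>D. ((\<lambda>t. - (v \<bullet> y t)) has_real_derivative D) (at t within {a..b}) \<and> D \<le> - \<beta>" by blast
  qed (use \<open>a < b\<close> in auto)
  then have "\<beta> * (b - a) \<le> v \<bullet> (y b - y a)" using \<open>a < b\<close> by (simp add: inner_diff_right algebra_simps)
  then have "\<beta> \<le> (v \<bullet> (y b - y a)) / (b - a)" using \<open>a < b\<close> by (simp add: le_divide_eq)
  then have "\<beta> \<le> v \<bullet> ((y b - y a) /\<^sub>R (b - a))" by (simp add: divide_inverse mult.commute)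
  then show False using v(1) by simp
qed

text \<open>The selection theorem of Kuratowski and Ryll-Nardzewski, for compact values.\<close>

lemma measurable_selection:
  fixes \<Gamma> :: "'c \<Rightarrow> 'b::euclidean_space set"
  assumes ne: "\<And>t. t \<in> space S \<Longrightarrow> \<Gamma> t \<noteq> {}" and cmp: "\<And>t. t \<in> space S \<Longrightarrow> compact (\<Gamma> t)"
    and meas: "\<And>K. compact K \<Longrightarrow> {t \<in> space S. \<Gamma> t \<inter> K \<noteq> {}} \<in> sets S"
  obtains u where "u \<in> borel_measurable S" "\<And>t. t \<in> space S \<Longrightarrow> u t \<in> \<Gamma> t"
proof -
  obtain D :: "'b set" where D: "countable D" "\<And>X. open X \<Longrightarrow> X \<noteq> {} \<Longrightarrow> \<exists>d\<in>D. d \<in> X"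
    using countable_dense_exists by metis
  have "D \<noteq> {}" using D(2)[of UNIV] by auto
  define q where "q = from_nat_into D"
  have q: "range q = D" unfolding q_def by (rule range_from_nat_into[OF \<open>D \<noteq> {}\<close> D(1)])
  \<comment> \<open>The least index makes the choice measurable: its level sets are built from
    finitely many sets of points whose values hit a given ball.\<close>
  define pick where "pick = (\<lambda>n A. LEAST k. A \<inter> cball (q k) ((1/2)^n) \<noteq> {})"
  \<comment> \<open>Successive intersection with ever smaller balls; compactness keeps a common
    point, and the radii force it to be unique.\<close>
  define \<Delta> where "\<Delta> = rec_nat \<Gamma> (\<lambda>n A t. A t \<inter> cball (q (pick n (A t))) ((1/2)^n))"
  have \<Delta>0: "\<Delta> 0 = \<Gamma>" and \<Delta>S: "\<Delta> (Suc n) = (\<lambda>t. \<Delta> n t \<inter> cball (q (pick n (\<Delta> n t))) ((1/2)^n))" for n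
    by (simp_all add: \<Delta>_def)
  have pick: "A \<inter> cball (q (pick n A)) ((1/2)^n) \<noteq> {}" if A: "A \<noteq> {}" for A n
  proof -
    obtain p where "p \<in> A" using A by blast
    have "p \<in> ball p ((1/2)^n)" by simp
    then have "ball p ((1/2)^n) \<noteq> {}" by blast
    then obtain d where "d \<in> D" "d \<in> ball p ((1/2)^n)" using D(2)[OF open_ball] by blast
    moreover then obtain k where "d = q k" using q by blast
    ultimately have "q k \<in> ball p ((1/2)^n)" by simp
    then have "p \<in> cball (q k) ((1/2)^n)" by (simp only: mem_ball mem_cball dist_commute less_imp_le)
    then have "A \<inter> cball (q k) ((1/2)^n) \<noteq> {}" using \<open>p \<in> A\<close> by blast
    then show ?thesis unfolding pick_def by (rule LeastI)
  qed
  have \<Delta>ne: "\<Delta> n t \<noteq> {}" if "t \<in> space S" for n t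
  proof (induction n)
    case (Suc n)
    then show ?case unfolding \<Delta>S using pick by blast
  qed (simp add: \<Delta>0 ne[OF that])
  have \<Delta>c: "compact (\<Delta> n t)" if "t \<in> space S" for n t
    by (induction n) (auto simp: \<Delta>0 \<Delta>S cmp[OF that] intro: compact_Int_closed)
  have pickmeas0: "{t \<in> space S. pick n (\<Delta> n t) = k} \<in> sets S"
    if m: "\<And>K. compact K \<Longrightarrow> {t \<in> space S. \<Delta> n t \<inter> K \<noteq> {}} \<in> sets S" for n k
  proof -
    let ?P = "\<lambda>k. {t \<in> space S. \<Delta> n t \<inter> cball (q k) ((1/2)^n) \<noteq> {}}"
    have P: "?P k \<in> sets S" for k by (rule m) simp
    have "{t \<in> space S. pick n (\<Delta> n t) = k} = ?P k - (\<Union>i<k. ?P i)"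
    proof (intro subset_antisym subsetI)
      fix t assume "t \<in> {t \<in> space S. pick n (\<Delta> n t) = k}"
      then have t: "t \<in> space S" "pick n (\<Delta> n t) = k" by auto
      have "\<Delta> n t \<inter> cball (q k) ((1/2)^n) \<noteq> {}" using pick[OF \<Delta>ne[OF t(1)], of n n] t(2) by simp
      moreover have "\<Delta> n t \<inter> cball (q i) ((1/2)^n) = {}" if "i < k" for i
        using not_less_Least[of i "\<lambda>k. \<Delta> n t \<inter> cball (q k) ((1/2)^n) \<noteq> {}"] that t(2) unfolding pick_def by blast
      ultimately show "t \<in> ?P k - (\<Union>i<k. ?P i)" using t(1) by blast
    next
      fix t assume t: "t \<in> ?P k - (\<Union>i<k. ?P i)"
      have "pick n (\<Delta> n t) = k" unfolding pick_def
      proof (rule Least_equality)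
        show "\<Delta> n t \<inter> cball (q k) ((1/2)^n) \<noteq> {}" using t by blast
        fix i assume i: "\<Delta> n t \<inter> cball (q i) ((1/2)^n) \<noteq> {}"
        have "t \<in> ?P i" using t i by blast
        moreover have "t \<notin> (\<Union>i<k. ?P i)" using t by (rule DiffE)
        ultimately have "\<not> i < k" by blast
        then show "k \<le> i" by simp
      qed
      then show "t \<in> {t \<in> space S. pick n (\<Delta> n t) = k}" using t by blast
    qed
    moreover have "(\<Union>i<k. ?P i) \<in> sets S" using P by (intro sets.finite_UN) simp_all
    ultimately show ?thesis using sets.Diff[OF P] by simp
  qed
  have \<Delta>meas: "{t \<in> space S. \<Delta> n t \<inter> K \<noteq> {}} \<in> sets S" if "compact K" for n K
    using that
  proof (induction n arbitrary: K)
    case 0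
    then show ?case using meas by (simp add: \<Delta>0)
  next
    case (Suc n)
    have "{t \<in> space S. \<Delta> (Suc n) t \<inter> K \<noteq> {}} =
      (\<Union>k. {t \<in> space S. pick n (\<Delta> n t) = k} \<inter> {t \<in> space S. \<Delta> n t \<inter> (cball (q k) ((1/2)^n) \<inter> K) \<noteq> {}})"
      unfolding \<Delta>S by (simp only: Int_assoc) blast
    moreover have "{t \<in> space S. pick n (\<Delta> n t) = k} \<in> sets S" for k by (rule pickmeas0[OF Suc.IH])
    moreover have "{t \<in> space S. \<Delta> n t \<inter> (cball (q k) ((1/2)^n) \<inter> K) \<noteq> {}} \<in> sets S" for k
      by (rule Suc.IH) (intro closed_Int_compact Suc.prems closed_cball)
    ultimately show ?case by auto
  qed
  define u where "u = (\<lambda>t. SOME p. p \<in> (\<Inter>n. \<Delta> n t))"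
  have u: "u t \<in> \<Delta> n t" if t: "t \<in> space S" for t n
  proof -
    have "(\<Inter>n. \<Delta> n t) \<noteq> {}"
    proof (rule compact_nest)
      show "compact (\<Delta> n t)" "\<Delta> n t \<noteq> {}" for n using \<Delta>c[OF t] \<Delta>ne[OF t] by auto
      show "\<Delta> n t \<subseteq> \<Delta> m t" if "m \<le> n" for m n
        using that by (induction rule: dec_induct) (auto simp: \<Delta>S)
    qed
    then have "\<exists>p. p \<in> (\<Inter>n. \<Delta> n t)" by blast
    then have "u t \<in> (\<Inter>n. \<Delta> n t)" unfolding u_def by (rule someI_ex)
    then show ?thesis by blast
  qed
  have "u \<in> borel_measurable S"
  proof (rule borel_measurable_LIMSEQ_metric)
    fix n
    have "(\<lambda>t. pick n (\<Delta> n t)) \<in> measurable S (count_space UNIV)"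
    proof (subst measurable_count_space_eq_countable)
      show "(\<lambda>t. pick n (\<Delta> n t)) \<in> space S \<rightarrow> UNIV \<and> (\<forall>a\<in>UNIV. (\<lambda>t. pick n (\<Delta> n t)) -` {a} \<inter> space S \<in> sets S)"
      proof (intro conjI ballI)
        fix k
        have "(\<lambda>t. pick n (\<Delta> n t)) -` {k} \<inter> space S = {t \<in> space S. pick n (\<Delta> n t) = k}" by blast
        then show "(\<lambda>t. pick n (\<Delta> n t)) -` {k} \<inter> space S \<in> sets S" using pickmeas0[OF \<Delta>meas] by simp
      qed simp
    qed simp
    then show "(\<lambda>t. q (pick n (\<Delta> n t))) \<in> borel_measurable S" by (rule measurable_compose) simp
  next
    fix t assume t: "t \<in> space S"
    show "(\<lambda>n. q (pick n (\<Delta> n t))) \<longlonglongrightarrow> u t"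
    proof (rule metric_LIMSEQ_I)
      fix e :: real assume "e > 0"
      then obtain n0 where n0: "(1/2)^n0 < e" using real_arch_pow_inv[of e "1/2"] by auto
      have "dist (q (pick n (\<Delta> n t))) (u t) < e" if "n \<ge> n0" for n
      proof -
        have "u t \<in> cball (q (pick n (\<Delta> n t))) ((1/2)^n)" using u[OF t, of "Suc n"] by (simp add: \<Delta>S)
        then have "dist (q (pick n (\<Delta> n t))) (u t) \<le> (1/2)^n" by simp
        also have "\<dots> \<le> (1/2)^n0" using that by (intro power_decreasing) auto
        finally show ?thesis using n0 by linarith
      qed
      then show "\<exists>n0. \<forall>n\<ge>n0. dist (q (pick n (\<Delta> n t))) (u t) < e" by blast
    qed
  qed
  moreover have "u t \<in> \<Gamma> t" if "t \<in> space S" for t using u[OF that, of 0] by (simp add: \<Delta>0)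
  ultimately show thesis using that by blast
qed

section \<open>Velocity sets and their stability under uniform limits\<close>

context sweeping_control
begin

text \<open>Truncating the normal component at norm \<open>M\<close> makes the velocity sets bounded
  without losing any trajectory, by the bound on normals in \<open>sweeping_solution\<close>. The
  control set is a parameter because the selection argument needs the graph for compact parts of
  \<open>U\<close>.\<close>

definition velocity_graph :: "'b set \<Rightarrow> ('a \<times> 'a) set" where
  "velocity_graph K = {(x, d). x \<in> C \<and> (\<exists>u\<in>K. f x u - d \<in> clarke_normal_cone C x \<and> norm (f x u - d) \<le> M)}"

text \<open>Controls converge along a subsequence by compactness of \<open>K\<close>. Both sides of
  the inequality in \<open>clarke_normal_cone_iff\<close> are continuous in the point and the
  normal, so it survives the limit.\<close>

lemma closed_velocity_graph:
  assumes K: "compact K" "K \<subseteq> U"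
  shows "closed (velocity_graph K)"
  unfolding closed_sequential_limits
proof (intro allI impI, elim conjE)
  fix p l assume p: "\<forall>n. p n \<in> velocity_graph K" and lim: "p \<longlonglongrightarrow> l"
  obtain x d where l: "l = (x, d)" by (cases l)
  define X where "X = (\<lambda>n. fst (p n))"
  define E where "E = (\<lambda>n. snd (p n))"
  have XE: "X n \<in> C \<and> (\<exists>u\<in>K. f (X n) u - E n \<in> clarke_normal_cone C (X n) \<and> norm (f (X n) u - E n) \<le> M)" for n
  proof -
    have "(X n, E n) \<in> velocity_graph K" using p by (simp add: X_def E_def)
    then show ?thesis by (simp add: velocity_graph_def)
  qed
  then obtain u where u: "\<And>n. u n \<in> K" "\<And>n. f (X n) (u n) - E n \<in> clarke_normal_cone C (X n)" "\<And>n. norm (f (X n) (u n) - E n) \<le> M"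
    by metis
  have XC: "X n \<in> C" for n using XE by blast
  have X: "X \<longlonglongrightarrow> x" and E: "E \<longlonglongrightarrow> d"
    using tendsto_fst[OF lim] tendsto_snd[OF lim] by (simp_all add: X_def E_def l)
  have xC: "x \<in> C" using closed_sequentially[OF closed_C _ X] XC by blast
  obtain v s where v: "v \<in> K" "strict_mono s" "(u \<circ> s) \<longlonglongrightarrow> v"
    using K(1) u(1) unfolding compact_def by metis
  have Xs: "(\<lambda>n. X (s n)) \<longlonglongrightarrow> x" and Es: "(\<lambda>n. E (s n)) \<longlonglongrightarrow> d" and us: "(\<lambda>n. u (s n)) \<longlonglongrightarrow> v"
    using LIMSEQ_subseq_LIMSEQ[OF X v(2)] LIMSEQ_subseq_LIMSEQ[OF E v(2)] v(3) by (simp_all add: o_def)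
  have "(\<lambda>n. (\<lambda>(x, u). f x u) (X (s n), u (s n))) \<longlonglongrightarrow> (\<lambda>(x, u). f x u) (x, v)"
  proof (rule continuous_on_tendsto_compose[OF f_cont tendsto_Pair[OF Xs us]])
    show "(x, v) \<in> C \<times> U" using xC v(1) K(2) by blast
    have "(X (s n), u (s n)) \<in> C \<times> U" for n using XC u(1) K(2) by blast
    then show "\<forall>\<^sub>F n in sequentially. (X (s n), u (s n)) \<in> C \<times> U" by simp
  qed
  then have F: "(\<lambda>n. f (X (s n)) (u (s n))) \<longlonglongrightarrow> f x v" by simp
  define Z where "Z = (\<lambda>n. f (X (s n)) (u (s n)) - E (s n))"
  have Z: "Z \<longlonglongrightarrow> f x v - d" unfolding Z_def by (intro tendsto_diff F Es)
  have "f x v - d \<in> clarke_normal_cone C x"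
    unfolding clarke_normal_cone_iff[OF xC]
  proof
    fix y assume y: "y \<in> C"
    have "(\<lambda>n. Z n \<bullet> (y - X (s n))) \<longlonglongrightarrow> (f x v - d) \<bullet> (y - x)" by (intro tendsto_intros Z Xs)
    moreover have "(\<lambda>n. M\<psi> / (2 * \<eta>) * norm (Z n) * (norm (y - X (s n)))\<^sup>2) \<longlonglongrightarrow> M\<psi> / (2 * \<eta>) * norm (f x v - d) * (norm (y - x))\<^sup>2"
      by (intro tendsto_intros Z Xs)
    moreover have "Z n \<bullet> (y - X (s n)) \<le> M\<psi> / (2 * \<eta>) * norm (Z n) * (norm (y - X (s n)))\<^sup>2" for n
      using u(2)[of "s n"] clarke_normal_cone_iff[OF XC[of "s n"], of "Z n"] y by (simp add: Z_def)
    ultimately show "(f x v - d) \<bullet> (y - x) \<le> M\<psi> / (2 * \<eta>) * norm (f x v - d) * (norm (y - x))\<^sup>2"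
      by (intro LIMSEQ_le[of "\<lambda>n. Z n \<bullet> (y - X (s n))"]) blast+
  qed
  moreover have "norm (f x v - d) \<le> M"
    by (rule Lim_bounded[OF tendsto_norm[OF Z]]) (use u(3) in \<open>auto simp: Z_def\<close>)
  ultimately show "l \<in> velocity_graph K" using xC v(1) by (auto simp: velocity_graph_def l)
qed

lemma velocity_bounded:
  assumes "(x, d) \<in> velocity_graph U"
  shows "norm d \<le> 2 * M"
proof -
  obtain u where u: "x \<in> C" "u \<in> U" "norm (f x u - d) \<le> M" using assms by (auto simp: velocity_graph_def)
  have "norm d \<le> norm (f x u) + norm (f x u - d)" using norm_triangle_ineq4[of "f x u" "f x u - d"] by simp
  then show ?thesis using u(3) f_bound[OF u(1,2)] by linarith
qed

text \<open>Convexity of the image of \<open>U\<close> under \<open>f x\<close> supplies a single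
  control for a convex combination of velocities; the normal cone and the norm ball are convex as
  well.\<close>

lemma convex_velocities: "convex {d. (x, d) \<in> velocity_graph U}"
proof (rule convexI)
  fix a b and s t :: real assume ab: "a \<in> {d. (x, d) \<in> velocity_graph U}" "b \<in> {d. (x, d) \<in> velocity_graph U}"
    and st: "0 \<le> s" "0 \<le> t" "s + t = 1"
  obtain u where u: "x \<in> C" "u \<in> U" "f x u - a \<in> clarke_normal_cone C x" "norm (f x u - a) \<le> M" using ab(1) by (auto simp: velocity_graph_def)
  obtain v where v: "v \<in> U" "f x v - b \<in> clarke_normal_cone C x" "norm (f x v - b) \<le> M" using ab(2) by (auto simp: velocity_graph_def)
  have "s *\<^sub>R f x u + t *\<^sub>R f x v \<in> f x ` U" using u v st by (intro convexD[OF f_convex]) auto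
  then obtain w where w: "w \<in> U" "f x w = s *\<^sub>R f x u + t *\<^sub>R f x v" by force
  have eq: "f x w - (s *\<^sub>R a + t *\<^sub>R b) = s *\<^sub>R (f x u - a) + t *\<^sub>R (f x v - b)" by (simp add: w algebra_simps)
  have "f x w - (s *\<^sub>R a + t *\<^sub>R b) \<in> clarke_normal_cone C x"
    unfolding eq clarke_normal_cone_def using u v st
    by (auto simp: clarke_normal_cone_def inner_add_left intro!: add_nonpos_nonpos mult_nonneg_nonpos)
  moreover have "norm (f x w - (s *\<^sub>R a + t *\<^sub>R b)) \<le> M"
  proof -
    have "norm (f x w - (s *\<^sub>R a + t *\<^sub>R b)) \<le> s * norm (f x u - a) + t * norm (f x v - b)"
      unfolding eq using st by (intro order_trans[OF norm_triangle_ineq]) simp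
    also have "\<dots> \<le> s * M + t * M" using u v st by (intro add_mono mult_left_mono) auto
    also have "\<dots> = M" using st by (simp add: distrib_right[symmetric])
    finally show ?thesis .
  qed
  ultimately show "s *\<^sub>R a + t *\<^sub>R b \<in> {d. (x, d) \<in> velocity_graph U}" using u(1) w(1) by (auto simp: velocity_graph_def)
qed

text \<open>A closed graph with bounded values is upper semicontinuous: velocities violating the
  claim at points tending to \<open>x\<close> would accumulate at a velocity of \<open>x\<close>
  from which they keep a distance.\<close>

lemma velocities_usc:
  assumes "\<epsilon> > 0"
  obtains \<delta> where "\<delta> > 0" "\<And>y d. dist y x < \<delta> \<Longrightarrow> (y, d) \<in> velocity_graph U \<Longrightarrow> \<exists>e. (x, e) \<in> velocity_graph U \<and> norm (d - e) \<le> \<epsilon>"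
proof (rule ccontr)
  assume no: "\<not> thesis"
  note found = that
  have "\<exists>y d. dist y x < 1 / real (Suc n) \<and> (y, d) \<in> velocity_graph U \<and> (\<forall>e. (x, e) \<in> velocity_graph U \<longrightarrow> norm (d - e) > \<epsilon>)" for n
  proof (rule ccontr)
    assume "\<not> ?thesis"
    then have "\<And>y d. dist y x < 1 / real (Suc n) \<Longrightarrow> (y, d) \<in> velocity_graph U \<Longrightarrow> \<exists>e. (x, e) \<in> velocity_graph U \<and> norm (d - e) \<le> \<epsilon>"
      by (meson not_le)
    then have thesis by (intro found[of "1 / real (Suc n)"]) simp_all
    then show False using no by blast
  qed
  then obtain Y D where YD: "\<And>n. dist (Y n) x < 1 / real (Suc n)" "\<And>n. (Y n, D n) \<in> velocity_graph U"
    "\<And>n e. (x, e) \<in> velocity_graph U \<Longrightarrow> norm (D n - e) > \<epsilon>" by metis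
  have Y: "Y \<longlonglongrightarrow> x"
  proof (rule metric_LIMSEQ_I)
    fix e :: real assume e: "e > 0"
    obtain n0 where n0: "1 / real (Suc n0) < e" by (rule nat_approx_posE[OF e])
    have "dist (Y n) x < e" if "n \<ge> n0" for n
    proof -
      have "1 / real (Suc n) \<le> 1 / real (Suc n0)" using that by (intro divide_left_mono) auto
      then show ?thesis using YD(1)[of n] n0 by linarith
    qed
    then show "\<exists>n0. \<forall>n\<ge>n0. dist (Y n) x < e" by blast
  qed
  have "D n \<in> cball 0 (2 * M)" for n using velocity_bounded[OF YD(2)] by simp
  then obtain d s where s: "strict_mono s" "(D \<circ> s) \<longlonglongrightarrow> d"
    using compact_cball[of 0 "2 * M"] unfolding compact_def by metis
  have "(\<lambda>n. (Y (s n), D (s n))) \<longlonglongrightarrow> (x, d)"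
    using LIMSEQ_subseq_LIMSEQ[OF Y s(1)] s(2) by (intro tendsto_Pair) (simp_all add: o_def)
  then have xd: "(x, d) \<in> velocity_graph U"
    using closed_sequentially[OF closed_velocity_graph[OF U_compact order_refl], of "\<lambda>n. (Y (s n), D (s n))"] YD(2) by blast
  obtain n where "dist (D (s n)) d < \<epsilon>" using metric_LIMSEQ_D[OF s(2) assms] by auto
  then show False using YD(3)[OF xd, of "s n"] by (simp add: dist_norm)
qed

text \<open>The mean slope of \<open>y n\<close> over a short interval lies in a closed convex
  neighbourhood of the velocity set at the limit state, by upper semicontinuity along the interval.
  The interval is fixed before \<open>n\<close> is taken large, and the quotient is a forward
  one.\<close>

lemma sweeping_limit_velocity:
  assumes sol: "\<And>n. solves_D T f C x0 (w n) (y n)" "\<And>n. AE t in lebesgue_on {0..T}. w n t \<in> U"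
    and lim: "uniform_limit {0..T} y x sequentially"
    and t: "0 \<le> t" "t < T" and v: "(x has_vector_derivative v) (at t within {0..T})"
  shows "(x t, v) \<in> velocity_graph U"
proof -
  define S where "S = {d. (x t, d) \<in> velocity_graph U}"
  have "closed S"
  proof -
    have "S = (\<lambda>d. (x t, d)) -` velocity_graph U" by (auto simp: S_def)
    then show ?thesis using closed_velocity_graph[OF U_compact order_refl]
      by (simp add: continuous_closed_vimage)
  qed
  moreover have "bounded S" unfolding bounded_iff S_def using velocity_bounded by blast
  ultimately have "compact S" by (simp add: compact_eq_bounded_closed)
  have "continuous_on {0..T} (y n)" for n
    using sol(1)[of n] by (simp add: solves_D_def abs_cont_on_imp_continuous_on)
  then have contx: "continuous_on {0..T} x"
    by (intro uniform_limit_theorem[OF _ lim]) simp_all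
  have "\<exists>d\<in>S. dist d v < e" if "e > 0" for e
  proof -
    \<comment> \<open>Three errors of relative size \<epsilon> occur below: the width of the
      neighbourhood of \<open>S\<close>, the differentiability remainder and the uniform
      distance.\<close>
    define \<epsilon> where "\<epsilon> = e / 4"
    have "\<epsilon> > 0" using that by (simp add: \<epsilon>_def)
    obtain \<delta> where "\<delta> > 0" and \<delta>: "\<And>y d. dist y (x t) < \<delta> \<Longrightarrow> (y, d) \<in> velocity_graph U \<Longrightarrow> \<exists>e. (x t, e) \<in> velocity_graph U \<and> norm (d - e) \<le> \<epsilon>"
      using velocities_usc[OF \<open>\<epsilon> > 0\<close>] by metis
    \<comment> \<open>The sum is closed because both summands are compact, and convex because both
      are convex.\<close>
    define K where "K = {a + b | a b. a \<in> S \<and> b \<in> cball 0 \<epsilon>}"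
    have "compact K" unfolding K_def by (intro compact_sums \<open>compact S\<close> compact_cball)
    then have Kcl: "closed K" by (rule compact_imp_closed)
    have "convex S" unfolding S_def by (rule convex_velocities)
    then have "convex (\<Union>a\<in>S. \<Union>b\<in>cball 0 \<epsilon>. {a + b})" by (intro convex_sums convex_cball)
    moreover have "(\<Union>a\<in>S. \<Union>b\<in>cball 0 \<epsilon>. {a + b}) = K" unfolding K_def by blast
    ultimately have Kcv: "convex K" by simp
    have tT: "t \<in> {0..T}" using t by simp
    obtain \<eta>1 where "\<eta>1 > 0" and \<eta>1: "\<And>s. s \<in> {0..T} \<Longrightarrow> dist s t < \<eta>1 \<Longrightarrow> dist (x s) (x t) < \<delta> / 2"
      using contx tT half_gt_zero[OF \<open>\<delta> > 0\<close>] unfolding continuous_on_iff by metis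
    obtain \<eta>2 where "\<eta>2 > 0" and \<eta>2: "\<And>s. s \<in> {0..T} \<Longrightarrow> norm (s - t) < \<eta>2 \<Longrightarrow> norm (x s - x t - (s - t) *\<^sub>R v) \<le> \<epsilon> * norm (s - t)"
      using v \<open>\<epsilon> > 0\<close> unfolding has_vector_derivative_def has_derivative_within_alt by metis
    define m where "m = min (T - t) (min \<eta>1 \<eta>2)"
    have m: "m > 0" "m \<le> T - t" "m \<le> \<eta>1" "m \<le> \<eta>2" using t \<open>\<eta>1 > 0\<close> \<open>\<eta>2 > 0\<close> by (auto simp: m_def)
    define k where "k = m / 2"
    have k: "0 < k" "t + k \<le> T" "k < \<eta>1" "k < \<eta>2" using m unfolding k_def by linarith+
    \<comment> \<open>The uniform distance has to be small against the fixed length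
      \<open>k\<close>, by which it is divided in the difference quotient; the two endpoints share
      \<open>\<epsilon> * k\<close>.\<close>
    define \<rho> where "\<rho> = min (\<delta> / 2) (\<epsilon> * k / 2)"
    have "\<rho> > 0" using \<open>\<delta> > 0\<close> \<open>\<epsilon> > 0\<close> k by (simp add: \<rho>_def)
    obtain n where n: "\<And>s. s \<in> {0..T} \<Longrightarrow> dist (y n s) (x s) < \<rho>"
      using uniform_limitD[OF lim \<open>\<rho> > 0\<close>] unfolding eventually_sequentially by blast
    obtain N where N: "negligible N" and yC: "\<And>s. s \<in> {0..T} \<Longrightarrow> y n s \<in> C" and yd: "\<And>s. s \<in> {0..T} - N \<Longrightarrow> w n s \<in> U \<and> (\<exists>\<zeta>\<in>clarke_normal_cone C (y n s). norm \<zeta> \<le> M \<and>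
        (y n has_vector_derivative (f (y n s) (w n s) - \<zeta>)) (at s within {0..T}))"
      using sweeping_solution[OF sol(1) sol(2), of n] by blast
    have acy: "abs_cont_on 0 T (y n)" using sol(1)[of n] by (simp add: solves_D_def)
    have "(y n (t + k) - y n t) /\<^sub>R ((t + k) - t) \<in> K"
    proof (rule mean_value_closed_convex[OF _ _ Kcl Kcv N])
      show "abs_cont_on t (t + k) (y n)" by (rule abs_cont_on_subset[OF acy]) (use t k in auto)
      fix s assume s: "s \<in> {t..t + k} - N"
      then have s': "s \<in> {0..T} - N" "s \<in> {0..T}" "dist s t < \<eta>1" using t k by (auto simp: dist_real_def)
      obtain \<zeta> where z: "w n s \<in> U" "\<zeta> \<in> clarke_normal_cone C (y n s)" "norm \<zeta> \<le> M"
        "(y n has_vector_derivative (f (y n s) (w n s) - \<zeta>)) (at s within {0..T})" using yd[OF s'(1)] by blast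
      define d where "d = f (y n s) (w n s) - \<zeta>"
      have "(y n s, d) \<in> velocity_graph U" using z yC[OF s'(2)] by (auto simp: velocity_graph_def d_def intro!: bexI[of _ "w n s"])
      moreover have "dist (y n s) (x t) < \<delta>"
      proof -
        have "dist (y n s) (x t) \<le> dist (y n s) (x s) + dist (x s) (x t)" by (rule dist_triangle)
        also have "\<dots> < \<delta> / 2 + \<delta> / 2" using n[OF s'(2)] \<eta>1[OF s'(2,3)] by (intro add_strict_mono) (auto simp: \<rho>_def)
        finally show ?thesis by simp
      qed
      ultimately obtain e where e: "e \<in> S" "norm (d - e) \<le> \<epsilon>" using \<delta> unfolding S_def by blast
      have "d = e + (d - e)" by simp
      then have "d \<in> K" unfolding K_def using e by (intro CollectI exI[of _ e] exI[of _ "d - e"]) auto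
      moreover have "(y n has_vector_derivative d) (at s within {t..t + k})"
        using z(4) unfolding d_def by (rule has_vector_derivative_within_subset) (use t k in auto)
      ultimately show "\<exists>D\<in>K. (y n has_vector_derivative D) (at s within {t..t + k})" by blast
    qed (use k in auto)
    then obtain a b where ab: "(y n (t + k) - y n t) /\<^sub>R k = a + b" "a \<in> S" "norm b \<le> \<epsilon>" by (auto simp: K_def)
    have xk: "norm (x (t + k) - x t - k *\<^sub>R v) \<le> \<epsilon> * k" using \<eta>2[of "t + k"] t k by simp
    have yk: "norm ((y n (t + k) - y n t) - (x (t + k) - x t)) \<le> \<epsilon> * k"
    proof -
      have "(y n (t + k) - y n t) - (x (t + k) - x t) = (y n (t + k) - x (t + k)) - (y n t - x t)" by simp
      also have "norm \<dots> \<le> norm (y n (t + k) - x (t + k)) + norm (y n t - x t)" by (rule norm_triangle_ineq4)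
      also have "\<dots> \<le> \<epsilon> * k / 2 + \<epsilon> * k / 2"
        using n[of "t + k"] n[of t] t k by (intro add_mono) (auto simp: dist_norm \<rho>_def)
      finally show ?thesis by simp
    qed
    have "k *\<^sub>R (a + b) = y n (t + k) - y n t" using ab(1)[symmetric] k by simp
    then have eq: "k *\<^sub>R (a - v) = ((y n (t + k) - y n t) - (x (t + k) - x t)) + (x (t + k) - x t - k *\<^sub>R v) - k *\<^sub>R b"
      by (simp add: algebra_simps)
    have "norm (k *\<^sub>R (a - v)) \<le> norm (((y n (t + k) - y n t) - (x (t + k) - x t)) + (x (t + k) - x t - k *\<^sub>R v)) + norm (k *\<^sub>R b)"
      unfolding eq by (rule norm_triangle_ineq4)
    also have "\<dots> \<le> (\<epsilon> * k + \<epsilon> * k) + norm (k *\<^sub>R b)"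
      by (intro add_right_mono order_trans[OF norm_triangle_ineq] add_mono xk yk)
    finally have "norm (k *\<^sub>R (a - v)) \<le> \<epsilon> * k + \<epsilon> * k + norm (k *\<^sub>R b)" .
    then have "k * norm (a - v) \<le> \<epsilon> * k + \<epsilon> * k + k * norm b" using k by simp
    also have "\<dots> \<le> \<epsilon> * k + \<epsilon> * k + k * \<epsilon>" using ab(3) k by (intro add_left_mono mult_left_mono) auto
    also have "\<dots> = k * (3 * \<epsilon>)" by simp
    finally have "norm (a - v) \<le> 3 * \<epsilon>" using k by simp
    then have "dist a v < e" using that by (simp add: dist_norm \<epsilon>_def)
    then show ?thesis using ab(2) by blast
  qed
  then have "v \<in> closure S" by (simp add: closure_approachable)
  then show ?thesis using \<open>closed S\<close> by (simp add: closure_closed S_def)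
qed

text \<open>Mean slopes stay in the ball of radius \<open>2 * M\<close>, the sum of the bounds on
  \<open>f\<close> and on the normal.\<close>

lemma sweeping_solution_lipschitz:
  assumes "solves_D T f C x0 w y" "AE t in lebesgue_on {0..T}. w t \<in> U"
  shows "(2 * M)-lipschitz_on {0..T} y"
proof -
  obtain N where N: "negligible N" and yC: "\<And>s. s \<in> {0..T} \<Longrightarrow> y s \<in> C" and yd: "\<And>s. s \<in> {0..T} - N \<Longrightarrow> w s \<in> U \<and> (\<exists>\<zeta>\<in>clarke_normal_cone C (y s). norm \<zeta> \<le> M \<and>
        (y has_vector_derivative (f (y s) (w s) - \<zeta>)) (at s within {0..T}))"
    using sweeping_solution[OF assms] by blast
  have acy: "abs_cont_on 0 T y" using assms by (simp add: solves_D_def)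
  have le: "norm (y t - y s) \<le> 2 * M * (t - s)" if st: "0 \<le> s" "s < t" "t \<le> T" for s t
  proof -
    have "(y t - y s) /\<^sub>R (t - s) \<in> cball 0 (2 * M)"
    proof (rule mean_value_closed_convex[OF _ st(2) closed_cball convex_cball N])
      show "abs_cont_on s t y" by (rule abs_cont_on_subset[OF acy]) (use st in auto)
      fix q assume "q \<in> {s..t} - N"
      then have q: "q \<in> {0..T} - N" "q \<in> {0..T}" using st by auto
      obtain \<zeta> where z: "w q \<in> U" "\<zeta> \<in> clarke_normal_cone C (y q)" "norm \<zeta> \<le> M"
        "(y has_vector_derivative (f (y q) (w q) - \<zeta>)) (at q within {0..T})" using yd[OF q(1)] by blast
      have "(y q, f (y q) (w q) - \<zeta>) \<in> velocity_graph U" using z yC[OF q(2)] by (auto simp: velocity_graph_def intro!: bexI[of _ "w q"])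
      then have "f (y q) (w q) - \<zeta> \<in> cball 0 (2 * M)" using velocity_bounded by simp
      moreover have "(y has_vector_derivative (f (y q) (w q) - \<zeta>)) (at q within {s..t})"
        using z(4) by (rule has_vector_derivative_within_subset) (use st in auto)
      ultimately show "\<exists>D\<in>cball 0 (2 * M). (y has_vector_derivative D) (at q within {s..t})" by blast
    qed
    then have "norm (y t - y s) / (t - s) \<le> 2 * M" using st by (simp add: divide_inverse mult.commute)
    then show ?thesis using st by (simp add: divide_le_eq)
  qed
  show ?thesis
  proof (rule lipschitz_onI)
    fix s t assume st: "s \<in> {0..T}" "t \<in> {0..T}"
    consider "s = t" | "s < t" | "t < s" by linarith
    then show "dist (y s) (y t) \<le> 2 * M * dist s t"
    proof cases
      case 2
      then show ?thesis using le[of s t] st by (simp add: dist_norm norm_minus_commute)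
    next
      case 3
      then show ?thesis using le[of t s] st by (simp add: dist_norm)
    qed simp
  qed (use M_pos in simp)
qed

text \<open>A Filippov argument: the limit is Lipschitz, hence differentiable almost everywhere,
  with derivative in the velocity set. The controls that realize this derivative at a given time
  form a compact set, from which a measurable choice is made.\<close>

lemma sweeping_limit_admissible:
  assumes sol: "\<And>n. solves_D T f C x0 (w n) (y n)" "\<And>n. AE t in lebesgue_on {0..T}. w n t \<in> U"
    and lim: "uniform_limit {0..T} y x sequentially"
  obtains u where "u \<in> controls T U" "solves_D T f C x0 u x"
proof -
  have lipx: "(2 * M)-lipschitz_on {0..T} x"
  proof (rule lipschitz_onI)
    fix s t assume st: "s \<in> {0..T}" "t \<in> {0..T}"
    have "(\<lambda>n. dist (y n s) (y n t)) \<longlonglongrightarrow> dist (x s) (x t)"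
      by (intro tendsto_dist tendsto_uniform_limitI[OF lim] st)
    then show "dist (x s) (x t) \<le> 2 * M * dist s t"
      by (rule Lim_bounded) (use lipschitz_onD[OF sweeping_solution_lipschitz[OF sol(1) sol(2)] st] in auto)
  qed (use M_pos in simp)
  then have acx: "abs_cont_on 0 T x" by (rule lipschitz_on_imp_abs_cont_on)
  have "y n 0 = x0" for n using sol(1)[of n] by (simp add: solves_D_def)
  then have "(\<lambda>n. x0) \<longlonglongrightarrow> x 0" using tendsto_uniform_limitI[OF lim, of 0] T_pos by simp
  then have x0: "x 0 = x0" by (simp add: LIMSEQ_const_iff)
  obtain N0 where N0: "negligible N0" "\<And>t. t \<in> {0..T} - N0 \<Longrightarrow> \<exists>D. (x has_vector_derivative D) (at t within {0..T})"
    using lipschitz_differentiable_AE[OF lipx] T_pos by (metis less_imp_le)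
  \<comment> \<open>\<open>T\<close> is excluded because the velocity of the limit was identified by
    forward difference quotients.\<close>
  define N where "N = insert T N0"
  have N: "negligible N" using N0(1) by (simp add: N_def)
  define S where "S = lebesgue_on ({0..T} - N)"
  have SL: "{0..T} - N \<in> sets lebesgue" using negligible_imp_sets[OF N] by (intro sets.Diff) simp_all
  have spS: "space S = {0..T} - N" by (simp add: S_def)
  have "\<forall>t. \<exists>D. t \<in> {0..T} - N \<longrightarrow> (x has_vector_derivative D) (at t within {0..T})" using N0(2) by (auto simp: N_def)
  then obtain v where v: "\<And>t. t \<in> {0..T} - N \<Longrightarrow> (x has_vector_derivative v t) (at t within {0..T})" by metis
  have graph: "(x t, v t) \<in> velocity_graph U" if "t \<in> {0..T} - N" for t
    using that by (intro sweeping_limit_velocity[OF sol lim _ _ v[OF that]]) (auto simp: N_def)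
  \<comment> \<open>Constant extension of \<open>x\<close>, so that difference quotients are
    continuous on the whole line and exhibit the derivative as a measurable limit.\<close>
  define xe where "xe = (\<lambda>t. x (max 0 (min T t)))"
  have xe_cont: "continuous_on UNIV xe"
    unfolding xe_def using T_pos
    by (intro continuous_on_compose2[OF lipschitz_on_continuous_on[OF lipx]] continuous_intros) auto
  have cm: "g \<in> borel_measurable S" if "continuous_on UNIV g" for g :: "real \<Rightarrow> 'a"
    unfolding S_def using that SL by (intro continuous_imp_measurable_on_sets_lebesgue continuous_on_subset[OF that]) auto
  have xm: "x \<in> borel_measurable S"
  proof -
    have "xe t = x t" if "t \<in> space S" for t using that by (simp add: spS xe_def)
    then show ?thesis using cm[OF xe_cont] measurable_cong[of S xe x borel] by simp
  qed
  have vm: "v \<in> borel_measurable S"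
  proof (rule borel_measurable_LIMSEQ_metric)
    fix n
    show "(\<lambda>t. real (Suc n) *\<^sub>R (xe (t + 1 / real (Suc n)) - xe t)) \<in> borel_measurable S"
      by (intro cm continuous_intros continuous_on_compose2[OF xe_cont]) auto
  next
    fix t assume t: "t \<in> space S"
    then have t': "t \<in> {0..T} - N" "0 \<le> t" "t < T" by (auto simp: spS N_def)
    show "(\<lambda>n. real (Suc n) *\<^sub>R (xe (t + 1 / real (Suc n)) - xe t)) \<longlonglongrightarrow> v t"
    proof (rule metric_LIMSEQ_I)
      fix e :: real assume "e > 0"
      then obtain d where "d > 0" and d: "\<And>s. s \<in> {0..T} \<Longrightarrow> norm (s - t) < d \<Longrightarrow> norm (x s - x t - (s - t) *\<^sub>R v t) \<le> (e / 2) * norm (s - t)"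
        using v[OF t'(1)] half_gt_zero[OF \<open>e > 0\<close>] unfolding has_vector_derivative_def has_derivative_within_alt by metis
      have dT: "min d (T - t) > 0" using \<open>d > 0\<close> t' by simp
      obtain n0 where n0: "1 / real (Suc n0) < min d (T - t)" by (rule nat_approx_posE[OF dT])
      have "dist (real (Suc n) *\<^sub>R (xe (t + 1 / real (Suc n)) - xe t)) (v t) < e" if "n \<ge> n0" for n
      proof -
        define k where "k = 1 / real (Suc n)"
        have "k \<le> 1 / real (Suc n0)" unfolding k_def using that by (intro divide_left_mono) auto
        then have k: "0 < k" "k < d" "t + k \<le> T" using n0 by (auto simp: k_def)
        have nk: "real (Suc n) = 1 / k" by (simp add: k_def)
        have "norm (x (t + k) - x t - k *\<^sub>R v t) \<le> (e / 2) * k" using d[of "t + k"] k t' by simp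
        moreover have "real (Suc n) *\<^sub>R (xe (t + k) - xe t) - v t = (1 / k) *\<^sub>R (x (t + k) - x t - k *\<^sub>R v t)"
          using k t' unfolding nk by (simp add: xe_def scaleR_diff_right)
        ultimately have "norm (real (Suc n) *\<^sub>R (xe (t + k) - xe t) - v t) \<le> e / 2"
          using k by (simp add: divide_le_eq)
        then show ?thesis using \<open>e > 0\<close> by (simp add: dist_norm k_def)
      qed
      then show "\<exists>n0. \<forall>n\<ge>n0. dist (real (Suc n) *\<^sub>R (xe (t + 1 / real (Suc n)) - xe t)) (v t) < e" by blast
    qed
  qed
  define \<Gamma> where "\<Gamma> = (\<lambda>t. {u \<in> U. (x t, v t) \<in> velocity_graph {u}})"
  \<comment> \<open>Turns the measurability of \<Gamma> into that of the preimage of a closed set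
    under the pair formed by \<open>x\<close> and \<open>v\<close>.\<close>
  have hit: "\<Gamma> t \<inter> K \<noteq> {} \<longleftrightarrow> (x t, v t) \<in> velocity_graph (U \<inter> K)" for t K
    by (auto simp: \<Gamma>_def velocity_graph_def)
  have \<Gamma>c: "compact (\<Gamma> t)" for t
    unfolding compact_eq_bounded_closed
  proof
    show "bounded (\<Gamma> t)" using compact_imp_bounded[OF U_compact] by (rule bounded_subset) (auto simp: \<Gamma>_def)
    show "closed (\<Gamma> t)" unfolding closed_sequential_limits
    proof (intro allI impI, elim conjE)
      fix p l assume p: "\<forall>n. p n \<in> \<Gamma> t" and l: "p \<longlonglongrightarrow> l"
      have "l \<in> U" using closed_sequentially[OF compact_imp_closed[OF U_compact] _ l] p by (auto simp: \<Gamma>_def)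
      have near: "(x t, v t) \<in> velocity_graph (U \<inter> cball l e)" if e: "e > 0" for e
      proof -
        obtain n where "dist (p n) l < e" using metric_LIMSEQ_D[OF l e] by auto
        then have "p n \<in> \<Gamma> t \<inter> cball l e" using p by (simp add: dist_commute less_imp_le)
        then show ?thesis using hit[of t "cball l e"] by blast
      qed
      have xC: "x t \<in> C" using near[of 1] by (auto simp: velocity_graph_def)
      have cont: "(\<lambda>n. f (x t) (p n)) \<longlonglongrightarrow> f (x t) l"
        using continuous_on_tendsto_compose[OF f_cont tendsto_Pair[OF tendsto_const[of "x t"] l]] xC \<open>l \<in> U\<close> p
        by (auto simp: \<Gamma>_def)
      have "f (x t) l - v t \<in> clarke_normal_cone C (x t)"
        unfolding clarke_normal_cone_iff[OF xC]
      proof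
        fix z assume z: "z \<in> C"
        have "(f (x t) (p n) - v t) \<bullet> (z - x t) \<le> M\<psi> / (2 * \<eta>) * norm (f (x t) (p n) - v t) * (norm (z - x t))\<^sup>2" for n
          using p z clarke_normal_cone_iff[OF xC, of "f (x t) (p n) - v t"] by (auto simp: \<Gamma>_def velocity_graph_def)
        moreover have "(\<lambda>n. (f (x t) (p n) - v t) \<bullet> (z - x t)) \<longlonglongrightarrow> (f (x t) l - v t) \<bullet> (z - x t)"
          by (intro tendsto_intros cont)
        moreover have "(\<lambda>n. M\<psi> / (2 * \<eta>) * norm (f (x t) (p n) - v t) * (norm (z - x t))\<^sup>2) \<longlonglongrightarrow> M\<psi> / (2 * \<eta>) * norm (f (x t) l - v t) * (norm (z - x t))\<^sup>2"
          by (intro tendsto_intros cont)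
        ultimately show "(f (x t) l - v t) \<bullet> (z - x t) \<le> M\<psi> / (2 * \<eta>) * norm (f (x t) l - v t) * (norm (z - x t))\<^sup>2"
          by (intro LIMSEQ_le[of "\<lambda>n. (f (x t) (p n) - v t) \<bullet> (z - x t)"]) blast+
      qed
      moreover have "norm (f (x t) l - v t) \<le> M"
        by (rule Lim_bounded[OF tendsto_norm[OF tendsto_diff[OF cont tendsto_const]]]) (use p in \<open>auto simp: \<Gamma>_def velocity_graph_def\<close>)
      ultimately show "l \<in> \<Gamma> t" using \<open>l \<in> U\<close> xC by (auto simp: \<Gamma>_def velocity_graph_def)
    qed
  qed
  have \<Gamma>ne: "\<Gamma> t \<noteq> {}" if "t \<in> space S" for t
    using hit[of t UNIV] graph[of t] that by (auto simp: spS)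
  have \<Gamma>m: "{t \<in> space S. \<Gamma> t \<inter> K \<noteq> {}} \<in> sets S" if "compact K" for K
    proof -
      have "closed (velocity_graph (U \<inter> K))"
        using that U_compact by (intro closed_velocity_graph compact_Int) auto
      moreover have "(\<lambda>t. (x t, v t)) \<in> borel_measurable S" using xm vm by (rule borel_measurable_Pair)
      ultimately have "(\<lambda>t. (x t, v t)) -` velocity_graph (U \<inter> K) \<inter> space S \<in> sets S"
        by (intro measurable_sets[of _ S borel]) auto
      moreover have "(\<lambda>t. (x t, v t)) -` velocity_graph (U \<inter> K) \<inter> space S = {t \<in> space S. \<Gamma> t \<inter> K \<noteq> {}}"
        using hit by auto
      ultimately show ?thesis by simp
    qed
  obtain u where um: "u \<in> borel_measurable S" and u: "\<And>t. t \<in> space S \<Longrightarrow> u t \<in> \<Gamma> t"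
    using measurable_selection[OF \<Gamma>ne \<Gamma>c \<Gamma>m] by blast
  \<comment> \<open>The value 0 need not lie in \<open>U\<close>, but within \<open>{0..T}\<close>
    it is used only on a negligible set.\<close>
  define uf where "uf = (\<lambda>t. if t \<in> {0..T} - N then u t else 0)"
  have "uf \<in> borel_measurable lebesgue" unfolding uf_def using um SL unfolding S_def by (rule borel_measurable_if_I)
  then have ufm: "uf \<in> borel_measurable (lebesgue_on {0..T})" by (rule measurable_restrict_space1)
  have good: "uf t \<in> U \<and> f (x t) (uf t) - v t \<in> clarke_normal_cone C (x t)" if "t \<in> {0..T} - N" for t
    using u[of t] that by (auto simp: uf_def spS \<Gamma>_def velocity_graph_def)
  have "uf \<in> controls T U" unfolding controls_def using ufm good by (auto intro!: AE_lebesgue_on_Icc_I[OF N])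
  moreover have "solves_D T f C x0 uf x"
    unfolding solves_D_def
  proof (intro conjI acx x0 AE_lebesgue_on_Icc_I[OF N])
    fix t assume t: "t \<in> {0..T} - N"
    show "\<exists>\<zeta>\<in>clarke_normal_cone C (x t). (x has_vector_derivative f (x t) (uf t) - \<zeta>) (at t within {0..T})"
      using good[OF t] v[OF t] by (intro bexI[of _ "f (x t) (uf t) - v t"]) auto
  qed
  ultimately show thesis using that by blast
qed

end

subsection \<open>Optimal solutions\<close>

context sweeping_control
begin

text \<open>The shift is of order ln \<gamma> / \<gamma>: it vanishes, yet is large compared with
  the width 1 / \<gamma> of the boundary layer in which the penalty decays.\<close>

lemma sigma_limits:
  shows "((\<lambda>\<gamma>. sigma r M\<psi> M \<eta> \<gamma>) \<longlongrightarrow> 0) at_top"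
    and "filterlim (\<lambda>\<gamma>. \<gamma> * sigma r M\<psi> M \<eta> \<gamma>) at_top at_top"
proof -
  define a where "a = \<eta> / (2 * M)"
  define c where "c = real r * M\<psi> / (2 * \<eta>\<^sup>2)"
  define b where "b = ln (real r)"
  have a: "a > 0" using eta_pos M_pos by (simp add: a_def)
  have c: "c > 0" using r_pos Mpsi_pos eta_pos by (simp add: c_def)
  have s: "sigma r M\<psi> M \<eta> = (\<lambda>\<gamma>. c * (b / \<gamma> + 1 / \<gamma> * ln (a * \<gamma>)))"
    by (simp add: sigma_def[abs_def] alpha_def a_def b_def c_def)
  show "((\<lambda>\<gamma>. sigma r M\<psi> M \<eta> \<gamma>) \<longlongrightarrow> 0) at_top" unfolding s using a c by real_asymp
  show "filterlim (\<lambda>\<gamma>. \<gamma> * sigma r M\<psi> M \<eta> \<gamma>) at_top at_top" unfolding s using a c by real_asymp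
qed

text \<open>Along the inward direction active constraints decrease linearly, so their exponents at
  the initial point are at most a negative multiple of \<gamma> \<sigma>; inactive constraints stay
  away from 0. All exponents tend to minus infinity, which makes \<open>phi\<close> less than 1
  initially for large \<open>k\<close>.\<close>

lemma initial_approx_limits:
  fixes \<gamma> :: "nat \<Rightarrow> real"
  assumes x0: "x0 \<in> C" and lim: "filterlim \<gamma> at_top sequentially"
  defines "z \<equiv> \<lambda>k. initial_approx r \<psi> M\<psi> M \<eta> (\<gamma> k) x0"
  shows "z \<longlonglongrightarrow> x0" "(\<lambda>k. phi (\<gamma> k) (z k)) \<longlonglongrightarrow> 0"
proof -
  \<comment> \<open>The value 0 covers interior points, so that both cases share the formula
    \<open>x0 + \<sigma> k *\<^sub>R e\<close>.\<close>
  define \<sigma> where "\<sigma> = (\<lambda>k. if x0 \<in> interior C then 0 else sigma r M\<psi> M \<eta> (\<gamma> k))"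
  define e where "e = inward_dir r \<psi> x0 /\<^sub>R norm (inward_dir r \<psi> x0)"
  have z: "z k = x0 + \<sigma> k *\<^sub>R e" for k
    by (simp add: z_def \<sigma>_def e_def initial_approx_def C_eq)
  have \<sigma>0: "\<sigma> \<longlonglongrightarrow> 0"
    using filterlim_compose[OF sigma_limits(1) lim] by (cases "x0 \<in> interior C") (simp_all add: \<sigma>_def)
  have "(\<lambda>k. x0 + \<sigma> k *\<^sub>R e) \<longlonglongrightarrow> x0 + 0 *\<^sub>R e" by (intro tendsto_intros \<sigma>0)
  then show zlim: "z \<longlonglongrightarrow> x0" by (simp add: z[abs_def])
  have bot: "filterlim (\<lambda>k. \<gamma> k * \<psi> i (z k)) at_bot sequentially" if i: "i \<in> {1..r}" for i
  proof (cases "\<psi> i x0 < 0")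
    case True
    have "isCont (\<psi> i) x0" using continuous_psi[OF i] by (simp add: continuous_on_eq_continuous_at)
    then have "(\<lambda>k. \<psi> i (z k)) \<longlonglongrightarrow> \<psi> i x0" using zlim by (rule isCont_tendsto_compose)
    from filterlim_tendsto_neg_mult_at_bot[OF this True lim] show ?thesis by (simp add: mult.commute)
  next
    case False
    then have act: "i \<in> active r \<psi> x0" using x0 i mem_C_iff by (force simp: active_def)
    have nint: "x0 \<notin> interior C" using psi_neg_interior[OF _ i] False by blast
    have neg: "grad (\<psi> i) x0 \<bullet> inward_dir r \<psi> x0 < 0" by (rule inward_dir_strict[OF x0 act])
    then have "inward_dir r \<psi> x0 \<noteq> 0" by auto
    then have ge: "e \<bullet> grad (\<psi> i) x0 < 0" using neg by (simp add: e_def inner_commute mult_pos_neg)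
    \<comment> \<open>Half of the rate of decrease along \<open>e\<close>, which leaves room for the
      differentiability error.\<close>
    define c where "c = - (e \<bullet> grad (\<psi> i) x0) / 2"
    have "c > 0" using ge by (simp add: c_def)
    have "((\<lambda>s. \<psi> i (x0 + s *\<^sub>R e)) has_real_derivative (e \<bullet> grad (\<psi> i) (x0 + 0 *\<^sub>R e))) (at 0)"
      by (rule GDERIV_line[OF gderiv_psi[OF i]])
    then have "((\<lambda>s. \<psi> i (x0 + s *\<^sub>R e) + c * s) has_real_derivative (e \<bullet> grad (\<psi> i) x0 + c)) (at 0)"
      by (auto intro!: derivative_eq_intros)
    moreover have "e \<bullet> grad (\<psi> i) x0 + c < 0" using ge by (simp add: c_def)
    ultimately obtain d where d: "d > 0" "\<And>h. 0 < h \<Longrightarrow> h < d \<Longrightarrow> \<psi> i (x0 + h *\<^sub>R e) + c * h < \<psi> i x0"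
      using DERIV_neg_dec_right[of "\<lambda>s. \<psi> i (x0 + s *\<^sub>R e) + c * s" _ 0] by auto
    have gs: "filterlim (\<lambda>k. \<gamma> k * \<sigma> k) at_top sequentially"
      using filterlim_compose[OF sigma_limits(2) lim] nint by (simp add: \<sigma>_def)
    have "\<forall>\<^sub>F k in sequentially. \<gamma> k * \<psi> i (z k) \<le> - (c * (\<gamma> k * \<sigma> k))"
      using order_tendstoD(2)[OF \<sigma>0 d(1)] filterlim_at_top_dense[THEN iffD1, OF gs, rule_format, of 0]
        filterlim_at_top_dense[THEN iffD1, OF lim, rule_format, of 0]
    proof eventually_elim
      case (elim k)
      have "\<sigma> k > 0" using elim(2,3) by (simp add: zero_less_mult_iff)
      then have "\<psi> i (z k) + c * \<sigma> k < \<psi> i x0" using d(2) elim(1) z by simp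
      moreover have "\<psi> i x0 = 0" using act by (simp add: active_def)
      ultimately have "\<psi> i (z k) \<le> - (c * \<sigma> k)" by simp
      then have "\<gamma> k * \<psi> i (z k) \<le> \<gamma> k * (- (c * \<sigma> k))" using elim(3) by (intro mult_left_mono) auto
      then show ?case by (simp add: mult_ac)
    qed
    moreover have "filterlim (\<lambda>k. - (c * (\<gamma> k * \<sigma> k))) at_bot sequentially"
      using filterlim_tendsto_pos_mult_at_top[OF tendsto_const \<open>c > 0\<close> gs] by (simp add: filterlim_uminus_at_top)
    ultimately show ?thesis by (rule filterlim_at_bot_mono[rotated])
  qed
  have "(\<lambda>k. \<Sum>i\<in>{1..r}. exp (\<gamma> k * \<psi> i (z k))) \<longlonglongrightarrow> (\<Sum>i\<in>{1..r}. 0)"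
    by (intro tendsto_sum filterlim_compose[OF exp_at_bot] bot)
  then show "(\<lambda>k. phi (\<gamma> k) (z k)) \<longlonglongrightarrow> 0" by (simp add: phi_def)
qed

text \<open>\<open>k0\<close> and \<kappa> are chosen before the control, the trajectories and
  \<rho>, so the estimate is uniform in all of them; this is what decouples the penalty parameter
  from the mesh size.\<close>

lemma penalized_uniform_approximation:
  fixes \<gamma> :: "nat \<Rightarrow> real"
  assumes lim: "filterlim \<gamma> at_top sequentially" and z: "z \<longlonglongrightarrow> x0" "(\<lambda>k. phi (\<gamma> k) (z k)) \<longlonglongrightarrow> 0"
    and "\<epsilon> > 0"
  obtains k0 \<kappa> where "\<kappa> > 0" "\<And>k. k \<ge> k0 \<Longrightarrow> \<gamma> k > 0"
    "\<And>k u x t. k \<ge> k0 \<Longrightarrow> pen_sol (\<gamma> k) u x \<Longrightarrow> x 0 = z k \<Longrightarrow> t \<in> {0..T} \<Longrightarrow> x t \<in> C"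
    "\<And>k u x w y \<rho> Z t. k \<ge> k0 \<Longrightarrow> pen_sol (\<gamma> k) u x \<Longrightarrow> x 0 = z k \<Longrightarrow>
      solves_D T f C x0 w y \<Longrightarrow> (AE t in lebesgue_on {0..T}. w t \<in> U) \<Longrightarrow>
      \<rho> integrable_on {0..T} \<Longrightarrow> \<forall>t\<in>{0..T}. \<rho> t \<ge> 0 \<Longrightarrow> negligible Z \<Longrightarrow>
      \<forall>t\<in>{0..T} - Z. norm (f (y t) (u t) - f (y t) (w t)) \<le> \<rho> t \<Longrightarrow> integral {0..T} \<rho> \<le> \<kappa> \<Longrightarrow>
      t \<in> {0..T} \<Longrightarrow> norm (x t - y t) \<le> \<epsilon>"
proof -
  obtain \<gamma>0 B where B: "\<gamma>0 > 0" "B \<ge> 0"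
    "\<And>\<gamma> u x t. \<gamma> \<ge> \<gamma>0 \<Longrightarrow> pen_sol \<gamma> u x \<Longrightarrow> phi \<gamma> (x 0) < 1 \<Longrightarrow> t \<in> {0..T} \<Longrightarrow> phi \<gamma> (x t) < 1"
    "\<And>\<gamma> u x. \<gamma> \<ge> \<gamma>0 \<Longrightarrow> pen_sol \<gamma> u x \<Longrightarrow> phi \<gamma> (x 0) < 1 \<Longrightarrow> integral {0..T} (\<lambda>t. \<gamma> * phi \<gamma> (x t)) \<le> B"
    using penalty_integral_bound by blast
  have "bounded C" using compact_C by (rule compact_imp_bounded)
  then obtain R where R: "\<And>a. a \<in> C \<Longrightarrow> norm a \<le> R" unfolding bounded_iff by blast
  define d where "d = 2 * \<bar>R\<bar>"
  have d: "norm (a - b) \<le> d" if "a \<in> C" "b \<in> C" for a b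
    using norm_triangle_ineq4[of a b] R[OF that(1)] R[OF that(2)] by (simp add: d_def)
  have "d \<ge> 0" by (simp add: d_def)
  define A where "A = exp (T * (2 * M + M * M\<psi> / \<eta>) + 2 * M\<psi> * B)"
  have "A > 0" by (simp add: A_def)
  \<comment> \<open>Makes the discrepancy term at most \<open>\<epsilon>\<^sup>2 / 2\<close>;
    \<open>d + 1\<close> guards against \<open>d = 0\<close>.\<close>
  define \<kappa> where "\<kappa> = \<epsilon>\<^sup>2 / (4 * A * (d + 1))"
  have "\<kappa> > 0" using \<open>\<epsilon> > 0\<close> \<open>A > 0\<close> \<open>d \<ge> 0\<close> by (simp add: \<kappa>_def)
  have "A * (2 * d * \<kappa>) \<le> \<epsilon>\<^sup>2 / 2"
  proof -
    have "A * (2 * d * \<kappa>) \<le> A * (2 * (d + 1) * \<kappa>)" using \<open>A > 0\<close> \<open>\<kappa> > 0\<close> by (intro mult_left_mono mult_right_mono) auto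
    also have "\<dots> = (4 * A * (d + 1)) * \<kappa> / 2" by simp
    also have "(4 * A * (d + 1)) * \<kappa> = \<epsilon>\<^sup>2" unfolding \<kappa>_def using \<open>A > 0\<close> \<open>d \<ge> 0\<close> by simp
    finally show ?thesis .
  qed
  have "(\<lambda>k. A * ((norm (z k - x0))\<^sup>2 + 2 * (real r * T + B) / sqrt (\<gamma> k))) \<longlonglongrightarrow> A * ((norm (x0 - x0))\<^sup>2 + 0)"
    by (intro tendsto_intros z tendsto_divide_0[OF tendsto_const] filterlim_at_top_imp_at_infinity filterlim_compose[OF sqrt_at_top lim])
  then have "\<forall>\<^sub>F k in sequentially. A * ((norm (z k - x0))\<^sup>2 + 2 * (real r * T + B) / sqrt (\<gamma> k)) < \<epsilon>\<^sup>2 / 2"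
    using \<open>\<epsilon> > 0\<close> by (intro order_tendstoD(2)) auto
  moreover have "\<forall>\<^sub>F k in sequentially. phi (\<gamma> k) (z k) < 1" using z(2) by (rule order_tendstoD(2)) simp
  moreover have "\<forall>\<^sub>F k in sequentially. \<gamma> k \<ge> \<gamma>0" using lim by (simp add: filterlim_at_top)
  ultimately have "\<forall>\<^sub>F k in sequentially. A * ((norm (z k - x0))\<^sup>2 + 2 * (real r * T + B) / sqrt (\<gamma> k)) < \<epsilon>\<^sup>2 / 2 \<and>
      phi (\<gamma> k) (z k) < 1 \<and> \<gamma> k \<ge> \<gamma>0" by eventually_elim simp
  then obtain k0 where k0: "\<And>k. k \<ge> k0 \<Longrightarrow> A * ((norm (z k - x0))\<^sup>2 + 2 * (real r * T + B) / sqrt (\<gamma> k)) < \<epsilon>\<^sup>2 / 2"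
    "\<And>k. k \<ge> k0 \<Longrightarrow> phi (\<gamma> k) (z k) < 1" "\<And>k. k \<ge> k0 \<Longrightarrow> \<gamma> k \<ge> \<gamma>0"
    unfolding eventually_sequentially by blast
  have pos: "\<gamma> k > 0" if "k \<ge> k0" for k using k0(3)[OF that] B(1) by linarith
  have inv: "phi (\<gamma> k) (x t) < 1" if "k \<ge> k0" "pen_sol (\<gamma> k) u x" "x 0 = z k" "t \<in> {0..T}" for k u x t
    using B(3)[OF k0(3)[OF that(1)] that(2) _ that(4)] k0(2)[OF that(1)] that(3) by simp
  have inC: "x t \<in> C" if "k \<ge> k0" "pen_sol (\<gamma> k) u x" "x 0 = z k" "t \<in> {0..T}" for k u x t
    using phi_le_1_imp_C[OF pos[OF that(1)]] inv[OF that] by simp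
  have close: "norm (x t - y t) \<le> \<epsilon>" if k: "k \<ge> k0" and x: "pen_sol (\<gamma> k) u x" "x 0 = z k" and
      y: "solves_D T f C x0 w y" "AE t in lebesgue_on {0..T}. w t \<in> U" and
      \<rho>: "\<rho> integrable_on {0..T}" "\<forall>t\<in>{0..T}. \<rho> t \<ge> 0" "negligible Z"
      "\<forall>t\<in>{0..T} - Z. norm (f (y t) (u t) - f (y t) (w t)) \<le> \<rho> t" "integral {0..T} \<rho> \<le> \<kappa>" and
      t: "t \<in> {0..T}" for k u x w y \<rho> Z t
  proof -
    have "(norm (x t - y t))\<^sup>2 \<le> A * ((norm (x 0 - y 0))\<^sup>2 + (2 * d * integral {0..T} \<rho> + 2 * (real r * T + B) / sqrt (\<gamma> k)))"
      unfolding A_def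
    proof (rule penalized_sweeping_comparison[OF pos[OF k] x(1) _ _ y \<rho>(1) _ \<rho>(3) _ d t])
      show "phi (\<gamma> k) (x s) < 1" if "s \<in> {0..T}" for s by (rule inv[OF k x that])
      show "integral {0..T} (\<lambda>t. \<gamma> k * phi (\<gamma> k) (x t)) \<le> B"
        using B(4)[OF k0(3)[OF k] x(1)] k0(2)[OF k] x(2) by simp
    qed (use \<rho> in auto)
    also have "\<dots> = A * (2 * d * integral {0..T} \<rho>) + A * ((norm (z k - x0))\<^sup>2 + 2 * (real r * T + B) / sqrt (\<gamma> k))"
      using x(2) y(1) by (simp add: solves_D_def algebra_simps)
    also have "A * (2 * d * integral {0..T} \<rho>) \<le> A * (2 * d * \<kappa>)"
      using \<rho>(5) \<open>A > 0\<close> \<open>d \<ge> 0\<close> by (intro mult_left_mono) auto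
    also have "A * (2 * d * \<kappa>) \<le> \<epsilon>\<^sup>2 / 2" by fact
    finally have "(norm (x t - y t))\<^sup>2 \<le> \<epsilon>\<^sup>2" using k0(1)[OF k] by linarith
    then show ?thesis using \<open>\<epsilon> > 0\<close> by (simp add: power2_le_iff_abs_le)
  qed
  show thesis by (rule that[of \<kappa> k0]) (fact \<open>\<kappa> > 0\<close> pos inC close)+
qed

text \<open>Optimality is used on both sides: \<open>xtil\<close> competes with \<open>xbar\<close>
  in the sweeping problem, and a penalized trajectory close to \<open>xbar\<close> competes with
  \<open>xhat\<close>. The uniform closeness of \<open>xhat\<close> and \<open>xtil\<close> is
  recorded too because the convergence argument needs it.\<close>

lemma optimal_value_estimate:
  fixes g :: "'a \<Rightarrow> real" and \<gamma> :: "nat \<Rightarrow> real"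
  assumes g: "Lg-lipschitz_on C g" and x0: "x0 \<in> C" and lim: "filterlim \<gamma> at_top sequentially"
    and z: "\<And>k. z k = initial_approx r \<psi> M\<psi> M \<eta> (\<gamma> k) x0"
    and opt: "optimal_P T g f U C x0 xbar ubar" and "\<epsilon> > 0"
  obtains k\<epsilon> N\<epsilon> where "\<And>k N xhat uhat xtil. k \<ge> k\<epsilon> \<Longrightarrow> N \<ge> N\<epsilon> \<Longrightarrow> N \<ge> 1 \<Longrightarrow>
      optimal_PN T g f U r \<psi> (\<gamma> k) (z k) N xhat uhat \<Longrightarrow> solves_D T f C x0 uhat xtil \<Longrightarrow>
      (\<forall>t\<in>{0..T}. norm (xhat t - xtil t) \<le> \<epsilon>) \<and>
      g (xbar T) \<le> g (xtil T) \<and> g (xtil T) \<le> g (xbar T) + \<epsilon> \<and>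
      g (xbar T) - \<epsilon> / 3 \<le> g (xhat T) \<and> g (xhat T) \<le> g (xbar T) + 2 * \<epsilon> / 3"
proof -
  have zlim: "z \<longlonglongrightarrow> x0" "(\<lambda>k. phi (\<gamma> k) (z k)) \<longlonglongrightarrow> 0"
    using initial_approx_limits[OF x0 lim] unfolding z[symmetric] by auto
  have "Lg \<ge> 0" using g by (rule lipschitz_on_nonneg)
  \<comment> \<open>Within this distance values of \<open>g\<close> on \<open>C\<close> differ by at
    most \<open>\<epsilon> / 3\<close>; \<open>Lg + 1\<close> keeps the denominator
    positive.\<close>
  define e where "e = \<epsilon> / (3 * (Lg + 1))"
  have "e > 0" using \<open>\<epsilon> > 0\<close> \<open>Lg \<ge> 0\<close> by (simp add: e_def)
  have Le: "Lg * e \<le> \<epsilon> / 3"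
  proof -
    have "Lg * e \<le> (Lg + 1) * e" using \<open>e > 0\<close> by (intro mult_right_mono) auto
    also have "\<dots> = \<epsilon> / 3"
    proof -
      have "3 * (Lg + 1) > 0" using \<open>Lg \<ge> 0\<close> by simp
      then show ?thesis by (simp add: e_def field_simps)
    qed
    finally show ?thesis .
  qed
  have "e \<le> \<epsilon>"
  proof -
    have "e * 1 \<le> e * (3 * (Lg + 1))" using \<open>e > 0\<close> \<open>Lg \<ge> 0\<close> by (intro mult_left_mono) auto
    also have "\<dots> = \<epsilon>"
    proof -
      have "3 * (Lg + 1) > 0" using \<open>Lg \<ge> 0\<close> by simp
      then show ?thesis unfolding e_def by (metis less_irrefl nonzero_eq_divide_eq)
    qed
    finally show ?thesis by simp
  qed
  obtain k0 \<kappa> where \<kappa>: "\<kappa> > 0" and pos: "\<And>k. k \<ge> k0 \<Longrightarrow> \<gamma> k > 0"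
    and inC: "\<And>k u x t. k \<ge> k0 \<Longrightarrow> pen_sol (\<gamma> k) u x \<Longrightarrow> x 0 = z k \<Longrightarrow> t \<in> {0..T} \<Longrightarrow> x t \<in> C"
    and close: "\<And>k u x w y \<rho> Z t. k \<ge> k0 \<Longrightarrow> pen_sol (\<gamma> k) u x \<Longrightarrow> x 0 = z k \<Longrightarrow>
      solves_D T f C x0 w y \<Longrightarrow> (AE t in lebesgue_on {0..T}. w t \<in> U) \<Longrightarrow>
      \<rho> integrable_on {0..T} \<Longrightarrow> \<forall>t\<in>{0..T}. \<rho> t \<ge> 0 \<Longrightarrow> negligible Z \<Longrightarrow>
      \<forall>t\<in>{0..T} - Z. norm (f (y t) (u t) - f (y t) (w t)) \<le> \<rho> t \<Longrightarrow> integral {0..T} \<rho> \<le> \<kappa> \<Longrightarrow>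
      t \<in> {0..T} \<Longrightarrow> norm (x t - y t) \<le> e"
    proof (rule penalized_uniform_approximation[OF lim zlim \<open>e > 0\<close>], goal_cases)
      case (1 k0 \<kappa>)
      show ?case by (rule 1(1)) (fact 1)+
    qed
  have bar: "ubar \<in> controls T U" "solves_D T f C x0 ubar xbar"
    and min: "\<And>y v. v \<in> controls T U \<Longrightarrow> solves_D T f C x0 v y \<Longrightarrow> g (xbar T) \<le> g (y T)"
    using opt by (auto simp: optimal_P_def admissible_P_def)
  have barU: "AE t in lebesgue_on {0..T}. ubar t \<in> U" using bar(1) by (simp add: controls_def)
  have contbar: "continuous_on {0..T} xbar" using bar(2) by (simp add: solves_D_def abs_cont_on_imp_continuous_on)
  have barC: "\<And>t. t \<in> {0..T} \<Longrightarrow> xbar t \<in> C" using sweeping_solution[OF bar(2) barU] by blast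
  have TT: "T \<in> {0..T}" using T_pos by simp
  have glip: "\<bar>g a - g b\<bar> \<le> \<epsilon> / 3" if "a \<in> C" "b \<in> C" "norm (a - b) \<le> e" for a b
  proof -
    have "\<bar>g a - g b\<bar> \<le> Lg * norm (a - b)" using lipschitz_onD[OF g that(1,2)] by (simp add: dist_norm dist_real_def)
    also have "\<dots> \<le> Lg * e" using that(3) \<open>Lg \<ge> 0\<close> by (rule mult_left_mono)
    finally show ?thesis using Le by linarith
  qed
  obtain N0 where N0: "\<And>N. N \<ge> N0 \<Longrightarrow> N \<ge> 1 \<Longrightarrow> \<exists>v\<in>pc_controls T U N. \<exists>\<rho> Z. \<rho> integrable_on {0..T} \<and>
     (\<forall>t\<in>{0..T}. \<rho> t \<ge> 0) \<and> negligible Z \<and> (\<forall>t\<in>{0..T} - Z. norm (f (xbar t) (v t) - f (xbar t) (ubar t)) \<le> \<rho> t) \<and>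
     integral {0..T} \<rho> \<le> \<kappa>"
    proof (rule pc_controls_field_approximation[OF contbar barC bar(1) \<kappa>], goal_cases)
      case (2 N0)
      show ?case by (rule 2(1)) (fact 2)
    qed
  show thesis
  proof (rule that[of k0 N0])
    fix k N xhat uhat xtil
    assume k: "k \<ge> k0" and N: "N \<ge> N0" "N \<ge> 1" and opt_hat: "optimal_PN T g f U r \<psi> (\<gamma> k) (z k) N xhat uhat"
      and til: "solves_D T f C x0 uhat xtil"
    have hat: "uhat \<in> pc_controls T U N" "solves_Dpen T f r \<psi> (\<gamma> k) (z k) uhat xhat"
      and hat_min: "\<And>y v. v \<in> pc_controls T U N \<Longrightarrow> solves_Dpen T f r \<psi> (\<gamma> k) (z k) v y \<Longrightarrow> g (xhat T) \<le> g (y T)"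
      using opt_hat by (auto simp: optimal_PN_def admissible_PN_def)
    have hatU: "AE t in lebesgue_on {0..T}. uhat t \<in> U" by (rule pc_controls_AE[OF hat(1) N(2) T_pos])
    have hatc: "uhat \<in> controls T U" by (rule pc_controls_subset_controls[OF hat(1) N(2) T_pos])
    have hatp: "pen_sol (\<gamma> k) uhat xhat" by (rule solves_Dpen_imp_pen_sol[OF hat(2) hatU])
    have hat0: "xhat 0 = z k" using hat(2) by (simp add: solves_Dpen_def)
    \<comment> \<open>The controls are equal, so \<rho> can be taken to be 0.\<close>
    have near: "norm (xhat t - xtil t) \<le> e" if "t \<in> {0..T}" for t
      by (rule close[OF k hatp hat0 til hatU, of "\<lambda>_. 0" "{}"]) (use that \<kappa> in auto)
    have "xhat T \<in> C" by (rule inC[OF k hatp hat0 TT])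
    moreover have "xtil T \<in> C" using sweeping_solution[OF til hatU] TT by blast
    ultimately have hat_til: "\<bar>g (xhat T) - g (xtil T)\<bar> \<le> \<epsilon> / 3" using near[OF TT] by (intro glip)
    have lower: "g (xbar T) \<le> g (xtil T)" by (rule min[OF hatc til])
    obtain v \<rho> Z where v: "v \<in> pc_controls T U N" and \<rho>: "\<rho> integrable_on {0..T}" "\<forall>t\<in>{0..T}. \<rho> t \<ge> 0" "negligible Z"
      "\<forall>t\<in>{0..T} - Z. norm (f (xbar t) (v t) - f (xbar t) (ubar t)) \<le> \<rho> t" "integral {0..T} \<rho> \<le> \<kappa>"
      using N0[OF N] by blast
    \<comment> \<open>The competitor for \<open>xhat\<close>: driven by a piecewise constant
      approximation of \<open>ubar\<close>, it stays close to \<open>xbar\<close>.\<close>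
    obtain y where y: "pen_sol (\<gamma> k) v y" "y 0 = z k" using penalized_solution_exists[OF pos[OF k] v N(2)] by blast
    have yC: "y t \<in> C" if "t \<in> {0..T}" for t by (rule inC[OF k y that])
    have "solves_Dpen T f r \<psi> (\<gamma> k) (z k) v y" using pen_sol_imp_solves_Dpen[OF y(1) yC] y(2) by simp
    then have "g (xhat T) \<le> g (y T)" by (rule hat_min[OF v])
    moreover have "norm (y T - xbar T) \<le> e" by (rule close[OF k y bar(2) barU \<rho> TT])
    then have "\<bar>g (y T) - g (xbar T)\<bar> \<le> \<epsilon> / 3" by (rule glip[OF yC[OF TT] barC[OF TT]])
    ultimately have upper: "g (xhat T) \<le> g (xbar T) + \<epsilon> / 3" by linarith
    show "(\<forall>t\<in>{0..T}. norm (xhat t - xtil t) \<le> \<epsilon>) \<and>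
      g (xbar T) \<le> g (xtil T) \<and> g (xtil T) \<le> g (xbar T) + \<epsilon> \<and>
      g (xbar T) - \<epsilon> / 3 \<le> g (xhat T) \<and> g (xhat T) \<le> g (xbar T) + 2 * \<epsilon> / 3"
      using near \<open>e \<le> \<epsilon>\<close> lower upper hat_til \<open>\<epsilon> > 0\<close> by (intro conjI ballI) (fastforce, linarith+)
  qed
qed

text \<open>Compactness is applied to the sweeping trajectories, which share a Lipschitz constant,
  and is transferred to the penalized ones by uniform closeness. A diagonal choice sends both
  indices to infinity, so a single subsequence serves both.\<close>

lemma optimal_limit:
  fixes g :: "'a \<Rightarrow> real" and \<gamma> :: "nat \<Rightarrow> real"
  assumes g: "Lg-lipschitz_on C g" and x0: "x0 \<in> C" and lim: "filterlim \<gamma> at_top sequentially"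
    and z: "\<And>k. z k = initial_approx r \<psi> M\<psi> M \<eta> (\<gamma> k) x0"
    and opt: "optimal_P T g f U C x0 xbar ubar"
    and hat: "\<And>k N. k \<ge> K \<Longrightarrow> N \<ge> 1 \<Longrightarrow> optimal_PN T g f U r \<psi> (\<gamma> k) (z k) N (xhat k N) (uhat k N) \<and>
      solves_D T f C x0 (uhat k N) (xtil k N)"
  shows "\<exists>xlim ulim \<kappa> \<nu>. optimal_P T g f U C x0 xlim ulim \<and>
               strict_mono (\<kappa> :: nat \<Rightarrow> nat) \<and> strict_mono (\<nu> :: nat \<Rightarrow> nat) \<and>
               uniform_limit {0..T} (\<lambda>j. xhat (\<kappa> j) (\<nu> j)) xlim sequentially \<and>
               uniform_limit {0..T} (\<lambda>j. xtil (\<kappa> j) (\<nu> j)) xlim sequentially"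
proof -
  \<comment> \<open>\<open>Suc j\<close> keeps the number of cells positive, and
    \<open>K + j\<close> stays in the range where solutions are given.\<close>
  define X where "X = (\<lambda>j. xtil (K + j) (Suc j))"
  define W where "W = (\<lambda>j. uhat (K + j) (Suc j))"
  have Xsol: "solves_D T f C x0 (W j) (X j)" for j using hat[of "K + j" "Suc j"] by (simp add: X_def W_def)
  have "W j \<in> pc_controls T U (Suc j)" for j
    using hat[of "K + j" "Suc j"] by (simp add: W_def optimal_PN_def admissible_PN_def)
  then have WU: "AE t in lebesgue_on {0..T}. W j t \<in> U" for j by (rule pc_controls_AE) (simp_all add: T_pos)
  have lipX: "(2 * M)-lipschitz_on {0..T} (X j)" for j by (rule sweeping_solution_lipschitz[OF Xsol WU])
  have XC: "X j t \<in> C" if "t \<in> {0..T}" for j t using sweeping_solution[OF Xsol WU] that by blast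
  obtain R where R: "\<And>a. a \<in> C \<Longrightarrow> norm a \<le> R" using compact_imp_bounded[OF compact_C] unfolding bounded_iff by blast
  obtain xlim s where s: "strict_mono (s :: nat \<Rightarrow> nat)"
    and conv: "\<And>e. 0 < e \<Longrightarrow> \<exists>N. \<forall>n t. n \<ge> N \<and> t \<in> {0..T} \<longrightarrow> norm (X (s n) t - xlim t) < e"
  proof (rule Arzela_Ascoli[of "{0..T}" X R])
    show "norm (X n t) \<le> R" if "t \<in> {0..T}" for n t using R[OF XC[OF that]] .
    show "\<exists>d>0. \<forall>n y. y \<in> {0..T} \<and> norm (t - y) < d \<longrightarrow> norm (X n t - X n y) < e" if t: "t \<in> {0..T}" and e: "0 < e" for t e
    proof (intro exI[of _ "e / (2 * M)"] conjI allI impI)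
      show "e / (2 * M) > 0" using e M_pos by simp
      fix n y assume y: "y \<in> {0..T} \<and> norm (t - y) < e / (2 * M)"
      have "norm (X n t - X n y) \<le> 2 * M * norm (t - y)" using lipschitz_on_normD[OF lipX t] y by blast
      also have "\<dots> < 2 * M * (e / (2 * M))" using y M_pos by (intro mult_strict_left_mono) auto
      finally show "norm (X n t - X n y) < e" using M_pos by simp
    qed
  qed (use that in blast)+
  have tillim: "uniform_limit {0..T} (\<lambda>j. X (s j)) xlim sequentially"
    unfolding uniform_limit_iff
  proof (intro allI impI)
    fix e :: real assume "e > 0"
    from conv[OF this] show "\<forall>\<^sub>F j in sequentially. \<forall>t\<in>{0..T}. dist (X (s j) t) (xlim t) < e"
      unfolding eventually_sequentially dist_norm by blast
  qed
  obtain ulim where ulim: "ulim \<in> controls T U" "solves_D T f C x0 ulim xlim"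
    by (rule sweeping_limit_admissible[OF Xsol WU tillim])
  \<comment> \<open>A subsequence index dominates its position, so both thresholds of the value
    estimate are eventually passed.\<close>
  have sj: "s j \<ge> j" for j using s by (rule seq_suble)
  have est: "\<exists>j0. \<forall>j\<ge>j0. (\<forall>t\<in>{0..T}. norm (xhat (K + s j) (Suc (s j)) t - X (s j) t) \<le> \<epsilon>) \<and>
      g (X (s j) T) \<le> g (xbar T) + \<epsilon>" if "\<epsilon> > 0" for \<epsilon>
  proof -
    obtain k\<epsilon> N\<epsilon> where E: "\<And>k N xhat uhat xtil. k \<ge> k\<epsilon> \<Longrightarrow> N \<ge> N\<epsilon> \<Longrightarrow> N \<ge> 1 \<Longrightarrow>
      optimal_PN T g f U r \<psi> (\<gamma> k) (z k) N xhat uhat \<Longrightarrow> solves_D T f C x0 uhat xtil \<Longrightarrow>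
      (\<forall>t\<in>{0..T}. norm (xhat t - xtil t) \<le> \<epsilon>) \<and>
      g (xbar T) \<le> g (xtil T) \<and> g (xtil T) \<le> g (xbar T) + \<epsilon> \<and>
      g (xbar T) - \<epsilon> / 3 \<le> g (xhat T) \<and> g (xhat T) \<le> g (xbar T) + 2 * \<epsilon> / 3"
      proof (rule optimal_value_estimate[OF g x0 lim z opt \<open>\<epsilon> > 0\<close>], goal_cases)
      case (1 k\<epsilon> N\<epsilon>)
      show ?case by (rule 1(1)) (fact 1)
    qed
    have "(\<forall>t\<in>{0..T}. norm (xhat (K + s j) (Suc (s j)) t - X (s j) t) \<le> \<epsilon>) \<and> g (X (s j) T) \<le> g (xbar T) + \<epsilon>"
      if "j \<ge> max k\<epsilon> N\<epsilon>" for j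
    proof -
      have j: "K + s j \<ge> k\<epsilon>" "Suc (s j) \<ge> N\<epsilon>" using sj[of j] that by linarith+
      have h: "optimal_PN T g f U r \<psi> (\<gamma> (K + s j)) (z (K + s j)) (Suc (s j)) (xhat (K + s j) (Suc (s j))) (uhat (K + s j) (Suc (s j)))"
        "solves_D T f C x0 (uhat (K + s j) (Suc (s j))) (X (s j))"
        using hat[of "K + s j" "Suc (s j)"] by (simp_all add: X_def)
      show ?thesis using E[OF j _ h] by simp
    qed
    then show ?thesis by blast
  qed
  have hatlim: "uniform_limit {0..T} (\<lambda>j. xhat (K + s j) (Suc (s j))) xlim sequentially"
    unfolding uniform_limit_iff
  proof (intro allI impI)
    fix e :: real assume "e > 0"
    then have "e / 2 > 0" by simp
    from est[OF this] obtain j0 where j0: "\<And>j t. j \<ge> j0 \<Longrightarrow> t \<in> {0..T} \<Longrightarrow> norm (xhat (K + s j) (Suc (s j)) t - X (s j) t) \<le> e / 2"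
      by blast
    obtain j1 where j1: "\<And>j t. j \<ge> j1 \<Longrightarrow> t \<in> {0..T} \<Longrightarrow> norm (X (s j) t - xlim t) < e / 2"
      using conv[of "e / 2"] \<open>e > 0\<close> by auto
    have "dist (xhat (K + s j) (Suc (s j)) t) (xlim t) < e" if "j \<ge> max j0 j1" "t \<in> {0..T}" for j t
    proof -
      have "dist (xhat (K + s j) (Suc (s j)) t) (xlim t) \<le> dist (xhat (K + s j) (Suc (s j)) t) (X (s j) t) + dist (X (s j) t) (xlim t)"
        by (rule dist_triangle)
      then show ?thesis using j0[of j t] j1[of j t] that by (simp add: dist_norm)
    qed
    then show "\<forall>\<^sub>F j in sequentially. \<forall>t\<in>{0..T}. dist (xhat (K + s j) (Suc (s j)) t) (xlim t) < e"
      unfolding eventually_sequentially by blast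
  qed
  have TT: "T \<in> {0..T}" using T_pos by simp
  have XT: "(\<lambda>j. X (s j) T) \<longlonglongrightarrow> xlim T" by (rule tendsto_uniform_limitI[OF tillim TT])
  have limC: "xlim T \<in> C" using closed_sequentially[OF closed_C _ XT] XC[OF TT] by blast
  have gX: "(\<lambda>j. g (X (s j) T)) \<longlonglongrightarrow> g (xlim T)"
    by (rule continuous_on_tendsto_compose[OF lipschitz_on_continuous_on[OF g] XT limC]) (simp add: XC[OF TT])
  have "g (xlim T) \<le> g (xbar T) + \<epsilon>" if "\<epsilon> > 0" for \<epsilon>
  proof (rule LIMSEQ_le_const2[OF gX])
    show "\<exists>N. \<forall>n\<ge>N. g (X (s n) T) \<le> g (xbar T) + \<epsilon>" using est[OF that] by blast
  qed
  then have "g (xlim T) \<le> g (xbar T)" by (rule field_le_epsilon)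
  then have "optimal_P T g f U C x0 xlim ulim"
    using opt ulim by (force simp: optimal_P_def admissible_P_def)
  moreover have "strict_mono (\<lambda>j. K + s j)" "strict_mono (\<lambda>j. Suc (s j))"
    using s by (simp_all add: strict_mono_def)
  ultimately show ?thesis using hatlim tillim unfolding X_def by blast
qed

end

theorem theorem5p1:
  fixes T M \<eta> L\<^sub>g M\<psi> :: real
    and g :: "real ^ 'n \<Rightarrow> real"
    and f :: "real ^ 'n \<Rightarrow> real ^ 'm \<Rightarrow> real ^ 'n"
    and U :: "(real ^ 'm) set"
    and r :: nat
    and \<psi> :: "nat \<Rightarrow> real ^ 'n \<Rightarrow> real"
    and C :: "(real ^ 'n) set"
    and x0 :: "real ^ 'n"
    and \<gamma> :: "nat \<Rightarrow> real"
    and x0k :: "nat \<Rightarrow> real ^ 'n"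
    and xbar :: "real \<Rightarrow> real ^ 'n"
    and ubar :: "real \<Rightarrow> real ^ 'm"
  assumes T_pos: "T > 0"
    and U_ne: "U \<noteq> {}"
    and r_pos: "r \<ge> 1"
    and C_eq: "C = constr_set r \<psi>"
    and x0_in: "x0 \<in> C"
    and f_cont: "continuous_on (C \<times> U) (\<lambda>(x, u). f x u)"
    and M_pos: "M > 0"
    and f_lip: "\<And>u. u \<in> U \<Longrightarrow> M-lipschitz_on C (\<lambda>x. f x u)"
    and f_bound: "\<And>x u. x \<in> C \<Longrightarrow> u \<in> U \<Longrightarrow> norm (f x u) \<le> M"
    and f_convex: "\<And>x. convex (f x ` U)"
    and U_compact: "compact U"
    and C_ne: "C \<noteq> {}"
    and psi_C11: "\<And>i. i \<in> {1..r} \<Longrightarrow> C11 (\<psi> i)"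
    and Ci_compact: "\<And>i. i \<in> {1..r} \<Longrightarrow> compact (sublevel (\<psi> i))"
    and Ci_connected: "\<And>i. i \<in> {1..r} \<Longrightarrow> CARD('n) > 1 \<Longrightarrow> connected (frontier (sublevel (\<psi> i)))"
    and Ci_convex: "\<And>i. i \<in> {1..r} \<Longrightarrow> CARD('n) = 1 \<Longrightarrow> convex (sublevel (\<psi> i))"
    and eta_pos: "\<eta> > 0"
    and grad_bound: "\<And>c l. active r \<psi> c \<noteq> {} \<Longrightarrow> (\<And>i. i \<in> active r \<psi> c \<Longrightarrow> l i \<ge> 0) \<Longrightarrow>
          (\<Sum>i\<in>active r \<psi> c. l i) = 1 \<Longrightarrow>
          norm (\<Sum>i\<in>active r \<psi> c. l i *\<^sub>R grad (\<psi> i) c) > 2 * \<eta>"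
    and g_lip: "L\<^sub>g-lipschitz_on C g"
    and Mpsi_pos: "M\<psi> > 0"
    and Mpsi_lip: "\<And>i. i \<in> {1..r} \<Longrightarrow> (2 * M\<psi>)-lipschitz_on (convex hull C) (grad (\<psi> i))"
    and gamma_gt: "\<And>k. \<gamma> k > 2 * M / \<eta>"
    and gamma_lim: "filterlim \<gamma> at_top sequentially"
    and x0k_eq: "\<And>k. x0k k = initial_approx r \<psi> M\<psi> M \<eta> (\<gamma> k) x0"
    and bar_optimal: "optimal_P T g f U C x0 xbar ubar"
  shows "(\<forall>\<epsilon>>0. \<exists>k\<epsilon> N\<epsilon>. \<forall>k\<ge>k\<epsilon>. \<forall>N\<ge>N\<epsilon>. N \<ge> 1 \<longrightarrow>
            (\<forall>xhat uhat xtil.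
               optimal_PN T g f U r \<psi> (\<gamma> k) (x0k k) N xhat uhat \<longrightarrow>
               solves_D T f C x0 uhat xtil \<longrightarrow>
                 g (xbar T) \<le> g (xtil T) \<and> g (xtil T) \<le> g (xbar T) + \<epsilon> \<and>
                 g (xbar T) - \<epsilon> / 3 \<le> g (xhat T) \<and> g (xhat T) \<le> g (xbar T) + 2 * \<epsilon> / 3)) \<and>
         (\<forall>xhat uhat xtil K.
            (\<forall>k\<ge>K. \<forall>N\<ge>1.
               optimal_PN T g f U r \<psi> (\<gamma> k) (x0k k) N (xhat k N) (uhat k N) \<and>
               solves_D T f C x0 (uhat k N) (xtil k N)) \<longrightarrow>
            (\<exists>xlim ulim \<kappa> \<nu>.
               optimal_P T g f U C x0 xlim ulim \<and>
               strict_mono (\<kappa> :: nat \<Rightarrow> nat) \<and> strict_mono (\<nu> :: nat \<Rightarrow> nat) \<and>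
               uniform_limit {0..T} (\<lambda>j. xhat (\<kappa> j) (\<nu> j)) xlim sequentially \<and>
               uniform_limit {0..T} (\<lambda>j. xtil (\<kappa> j) (\<nu> j)) xlim sequentially))"
proof -
  interpret sweeping_control r \<psi> C \<eta> M\<psi> T M f U
    by unfold_locales (fact r_pos C_eq C_ne psi_C11 Ci_compact eta_pos grad_bound Mpsi_pos Mpsi_lip
      T_pos U_ne f_cont M_pos f_lip f_bound f_convex U_compact)+
  show ?thesis
  proof (intro conjI allI impI)
    fix \<epsilon> :: real assume "\<epsilon> > 0"
    obtain k\<epsilon> N\<epsilon> where E: "\<And>k N xhat uhat xtil. k \<ge> k\<epsilon> \<Longrightarrow> N \<ge> N\<epsilon> \<Longrightarrow> N \<ge> 1 \<Longrightarrow>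
      optimal_PN T g f U r \<psi> (\<gamma> k) (x0k k) N xhat uhat \<Longrightarrow> solves_D T f C x0 uhat xtil \<Longrightarrow>
      (\<forall>t\<in>{0..T}. norm (xhat t - xtil t) \<le> \<epsilon>) \<and>
      g (xbar T) \<le> g (xtil T) \<and> g (xtil T) \<le> g (xbar T) + \<epsilon> \<and>
      g (xbar T) - \<epsilon> / 3 \<le> g (xhat T) \<and> g (xhat T) \<le> g (xbar T) + 2 * \<epsilon> / 3"
      proof (rule optimal_value_estimate[OF g_lip x0_in gamma_lim x0k_eq bar_optimal \<open>\<epsilon> > 0\<close>], goal_cases)
      case (1 k\<epsilon> N\<epsilon>)
      show ?case by (rule 1(1)) (fact 1)
    qed
    show "\<exists>k\<epsilon> N\<epsilon>. \<forall>k\<ge>k\<epsilon>. \<forall>N\<ge>N\<epsilon>. N \<ge> 1 \<longrightarrow>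
            (\<forall>xhat uhat xtil.
               optimal_PN T g f U r \<psi> (\<gamma> k) (x0k k) N xhat uhat \<longrightarrow>
               solves_D T f C x0 uhat xtil \<longrightarrow>
                 g (xbar T) \<le> g (xtil T) \<and> g (xtil T) \<le> g (xbar T) + \<epsilon> \<and>
                 g (xbar T) - \<epsilon> / 3 \<le> g (xhat T) \<and> g (xhat T) \<le> g (xbar T) + 2 * \<epsilon> / 3)"
      by (rule exI[of _ k\<epsilon>], rule exI[of _ N\<epsilon>], intro allI impI, drule (4) E, elim conjE, intro conjI) assumption+
  next
    fix xhat uhat xtil K
    assume "\<forall>k\<ge>K. \<forall>N\<ge>1.
               optimal_PN T g f U r \<psi> (\<gamma> k) (x0k k) N (xhat k N) (uhat k N) \<and>
               solves_D T f C x0 (uhat k N) (xtil k N)"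
    then show "\<exists>xlim ulim \<kappa> \<nu>.
               optimal_P T g f U C x0 xlim ulim \<and>
               strict_mono (\<kappa> :: nat \<Rightarrow> nat) \<and> strict_mono (\<nu> :: nat \<Rightarrow> nat) \<and>
               uniform_limit {0..T} (\<lambda>j. xhat (\<kappa> j) (\<nu> j)) xlim sequentially \<and>
               uniform_limit {0..T} (\<lambda>j. xtil (\<kappa> j) (\<nu> j)) xlim sequentially"
      by (intro optimal_limit[OF g_lip x0_in gamma_lim x0k_eq bar_optimal]) blast
  qed
qed

end
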